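(* Let $f_1,\ldots,f_N:\mathbb{R}^n\to\mathbb{R}$, $D_1,\ldots,D_N:\mathbb{R}^n\rightrightarrows\mathbb{R}^n$ and $g:\mathbb{R}^n\to\overline{\mathbb{R}}$ satisfy the standing assumption stated in the context, with $\Phi:=f_1+\cdots+f_N+g$. Assume in addition that $f_1,\ldots,f_N$ are subdifferentially regular, that $D_i=\partial f_i$ (Clarke subdifferential) for all $i\in\{1,\ldots,N\}$, and that $\Phi$ is weakly convex. Let $\delta,\epsilon>0$. For all $x_0\in\operatorname{dom}\Phi$, there exists $T_0\geqslant0$ such that for all $T\geqslant T_0$ there exists $\bar\alpha>0$ such that any sequence $(x_k)_{k\in\mathbb{N}}$ generated by proximal random reshuffling (PRR) initialized at $x_0$ with step sizes satisfying $$\alpha_k\in(0,\bar\alpha]\ \ \text{for all } k\in\mathbb{N}\quad\text{and}\quad\sum_{k=0}^\infty\alpha_k=T$$ converges to an $(\epsilon,\delta)$-near approximate $\partial\Phi$-stationary point.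
   Context: Notation: $\mathbb{R}^n$ carries an inner product $\langle\cdot,\cdot\rangle$ with induced norm $\|\cdot\|$; $\overline{\mathbb{R}}=\mathbb{R}\cup\{\pm\infty\}$; $\mathbb{N}=\{0,1,2,\ldots\}$; $\operatorname{dom}\Phi=\{x:\Phi(x)<\infty\}$; $B(x,r)$ is the closed ball of radius $r$ centered at $x$; $d(x,S)=\inf\{\|x-y\|:y\in S\}$ (equal to $+\infty$ if $S=\emptyset$); $D(S)=\bigcup_{x\in S}D(x)$. A set-valued map $D$ is locally bounded if every point has a neighborhood $U$ with $D(U)$ bounded. Conservative field: for a locally Lipschitz $f:\mathbb{R}^n\to\mathbb{R}$, a set-valued map $D:\mathbb{R}^n\rightrightarrows\mathbb{R}^n$ with closed graph and nonempty compact values is a conservative field for $f$ if for every absolutely continuous curve $\gamma:[0,1]\to\mathbb{R}^n$, for almost every $t\in[0,1]$, $\frac{d}{dt}f(\gamma(t))=\langle v,\gamma'(t)\rangle$ for all $v\in D(\gamma(t))$. Standing assumption: (1) $f_1,\ldots,f_N$ ($N\geqslant 1$) are locally Lipschitz; (2) each $D_i$ is a locally bounded conservative field with nonempty convex values for $f_i$; (3) $g$ is proper and convex, its domain is closed, and $g$ is locally Lipschitz on its domain; (4) $\Phi:=f+g$ is bounded below, where $f:=f_1+\cdots+f_N$. A locally Lipschitz $f:\mathbb{R}^n\to\mathbb{R}$ is subdifferentially regular if for all $x,h\in\mathbb{R}^n$ the directional derivative $\lim_{t\searrow0}(f(x+th)-f(x))/t$ exists and equals $\limsup_{y\to x,\,t\searrow0}(f(y+th)-f(y))/t$.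 A function $\Phi:\mathbb{R}^n\to\overline{\mathbb{R}}$ is weakly convex if $\Phi+\rho\|\cdot\|^2$ is convex for some $\rho\geqslant0$. $\partial$ denotes the Clarke subdifferential: for $x\in\operatorname{dom}\Phi$, $\partial\Phi(x)=\{v:(v,-1)\in \overline{\operatorname{co}}\,N_{\operatorname{epi}\Phi}(x,\Phi(x))\}$ where $N$ is the limiting normal cone ($\partial\Phi(x)=\emptyset$ for $x\notin\operatorname{dom}\Phi$); for locally Lipschitz $f_i$ it is the usual Clarke subdifferential, for convex $g$ the convex subdifferential, and under the hypotheses of the claim $\partial\Phi=\partial f_1+\cdots+\partial f_N+\partial g$. PRR algorithm: given step sizes $\alpha_0,\alpha_1,\ldots>0$ and $x_0\in\operatorname{dom}\Phi$, for $k=0,1,2,\ldots$: set $x_{k,0}=x_k$; choose an arbitrary permutation $\sigma^k$ of $\{1,\ldots,N\}$; for $i=1,\ldots,N$ choose $x_{k,i}\in x_{k,i-1}-\alpha_k D_{\sigma^k_i}(x_{k,i-1})$; set $x_{k+1}=\operatorname{prox}_{\alpha_k g}(x_{k,N})$, where $\operatorname{prox}_{h}(x)=\operatorname{argmin}_{y\in\mathbb{R}^n}\{h(y)+\|y-x\|^2/2\}$. Near approximate stationarity: a point $x$ is $(\epsilon,\delta)$-near approximate $D$-stationary if $d(0,D(B(x,\epsilon)))\leqslant\delta$. *)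

theory Defs
  imports "HOL-Analysis.Analysis" "HOL-Combinatorics.Permutations"
begin

section \<open>Locally Lipschitz functions and absolutely continuous curves\<close>

text \<open>The library notion \<^const>\<open>local_lipschitz\<close> carries a time parameter; here it
  ranges over a single point.\<close>

definition locally_lipschitz_on ::
    "'a::metric_space set \<Rightarrow> ('a \<Rightarrow> 'b::metric_space) \<Rightarrow> bool" where
  "locally_lipschitz_on S f \<longleftrightarrow> local_lipschitz {0::real} S (\<lambda>_. f)"

lemma locally_lipschitz_on_iff:
  "locally_lipschitz_on S f \<longleftrightarrow> (\<forall>x\<in>S. \<exists>u>0. \<exists>L. lipschitz_on L (cball x u \<inter> S) f)"
  unfolding locally_lipschitz_on_def local_lipschitz_def by fastforce

definition absolutely_continuous_curve :: "real set \<Rightarrow> (real \<Rightarrow> 'a::metric_space) \<Rightarrow> bool" where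
  "absolutely_continuous_curve S \<gamma> \<longleftrightarrow>
    (\<forall>e>0. \<exists>d>0. \<forall>(n::nat) a b.
       (\<forall>i<n. a i \<le> b i \<and> {a i..b i} \<subseteq> S) \<longrightarrow>
       disjoint_family_on (\<lambda>i. {a i<..<b i}) {..<n} \<longrightarrow>
       (\<Sum>i<n. b i - a i) < d \<longrightarrow>
       (\<Sum>i<n. dist (\<gamma> (a i)) (\<gamma> (b i))) < e)"


section \<open>Set-valued maps and conservative fields\<close>

text \<open>A set-valued map from the space to itself is a function into sets.\<close>

definition locally_bounded :: "('a::real_normed_vector \<Rightarrow> 'a set) \<Rightarrow> bool" where
  "locally_bounded D \<longleftrightarrow> (\<forall>x. \<exists>U. open U \<and> x \<in> U \<and> bounded (\<Union>y\<in>U. D y))"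

text \<open>The chain rule along curves includes the existence of both derivatives almost everywhere.
  Derivatives are taken within the unit interval, which only matters at its two endpoints.\<close>

definition conservative_field :: "('a::euclidean_space \<Rightarrow> real) \<Rightarrow> ('a \<Rightarrow> 'a set) \<Rightarrow> bool" where
  "conservative_field f D \<longleftrightarrow>
    locally_lipschitz_on UNIV f \<and>
    closed {(x, v). v \<in> D x} \<and>
    (\<forall>x. D x \<noteq> {} \<and> compact (D x)) \<and>
    (\<forall>\<gamma>. absolutely_continuous_curve {0..1} \<gamma> \<longrightarrow>
      (AE t in lebesgue_on {0..1}. \<exists>\<gamma>'.
         (\<gamma> has_vector_derivative \<gamma>') (at t within {0..1}) \<and>
         (\<forall>v\<in>D (\<gamma> t).
            ((\<lambda>s. f (\<gamma> s)) has_real_derivative (v \<bullet> \<gamma>')) (at t within {0..1}))))"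


section \<open>Extended-real-valued functions\<close>

definition edom :: "('a \<Rightarrow> ereal) \<Rightarrow> 'a set" where
  "edom h = {x. h x < \<infinity>}"

definition epi :: "('a \<Rightarrow> ereal) \<Rightarrow> ('a \<times> real) set" where
  "epi h = {(x, t). h x \<le> ereal t}"

definition proper_fun :: "('a \<Rightarrow> ereal) \<Rightarrow> bool" where
  "proper_fun h \<longleftrightarrow> (\<forall>x. h x \<noteq> -\<infinity>) \<and> (\<exists>x. h x \<noteq> \<infinity>)"

definition convex_fun :: "('a::real_vector \<Rightarrow> ereal) \<Rightarrow> bool" where
  "convex_fun h \<longleftrightarrow> convex (epi h)"

definition weakly_convex :: "('a::real_normed_vector \<Rightarrow> ereal) \<Rightarrow> bool" where
  "weakly_convex h \<longleftrightarrow> (\<exists>\<rho>\<ge>0. convex_fun (\<lambda>x. h x + ereal (\<rho> * (norm x)\<^sup>2)))"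


section \<open>Normal cones, Clarke subdifferential and subdifferential regularity\<close>

text \<open>Regular (Frechet) normals \<open>v\<close> satisfy \<open>v \<bullet> (y - x) \<le> o(norm (y - x))\<close> for \<open>y\<close> in \<open>C\<close>;
  limiting normals are limits of regular normals at points of \<open>C\<close> converging to \<open>x\<close>.\<close>

definition regular_normal_cone :: "'a::real_inner set \<Rightarrow> 'a \<Rightarrow> 'a set" where
  "regular_normal_cone C x =
    {v. x \<in> C \<and> (\<forall>e>0. \<forall>\<^sub>F y in at x within C. v \<bullet> (y - x) \<le> e * norm (y - x))}"

definition limiting_normal_cone :: "'a::real_inner set \<Rightarrow> 'a \<Rightarrow> 'a set" where
  "limiting_normal_cone C x =
    {v. x \<in> C \<and> (\<exists>y w. (\<forall>k::nat. y k \<in> C \<and> w k \<in> regular_normal_cone C (y k)) \<and>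
                        y \<longlonglongrightarrow> x \<and> w \<longlonglongrightarrow> v)}"

text \<open>The guard makes the value empty outside the domain (and where the function is \<open>-\<infinity>\<close>, so
  that \<open>(x, h x)\<close> is not a point of the product space).  A real-valued \<open>f\<close> is handled as
  \<open>\<lambda>x. ereal (f x)\<close>.\<close>

definition clarke_subdiff :: "('a::euclidean_space \<Rightarrow> ereal) \<Rightarrow> 'a \<Rightarrow> 'a set" where
  "clarke_subdiff h x =
    {v. \<bar>h x\<bar> \<noteq> \<infinity> \<and>
        (v, -1) \<in> closure (convex hull (limiting_normal_cone (epi h) (x, real_of_ereal (h x))))}"

definition subdiff_regular :: "('a::euclidean_space \<Rightarrow> real) \<Rightarrow> bool" where
  "subdiff_regular f \<longleftrightarrow>
    locally_lipschitz_on UNIV f \<and>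
    (\<forall>x h. \<exists>L::real.
       ((\<lambda>t. (f (x + t *\<^sub>R h) - f x) / t) \<longlongrightarrow> L) (at_right 0) \<and>
       ereal L = Limsup (nhds x \<times>\<^sub>F at_right 0)
                   (\<lambda>(y, t). ereal ((f (y + t *\<^sub>R h) - f y) / t)))"


section \<open>The objective and the standing assumption\<close>

definition objective :: "nat \<Rightarrow> (nat \<Rightarrow> 'a \<Rightarrow> real) \<Rightarrow> ('a \<Rightarrow> ereal) \<Rightarrow> 'a \<Rightarrow> ereal" where
  "objective N f g x = ereal (\<Sum>i=1..N. f i x) + g x"

definition standing_assumption ::
    "nat \<Rightarrow> (nat \<Rightarrow> 'a::euclidean_space \<Rightarrow> real) \<Rightarrow> (nat \<Rightarrow> 'a \<Rightarrow> 'a set) \<Rightarrow> ('a \<Rightarrow> ereal) \<Rightarrow> bool"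
  where
  "standing_assumption N f D g \<longleftrightarrow>
    N \<ge> 1 \<and>
    (\<forall>i\<in>{1..N}. locally_lipschitz_on UNIV (f i)) \<and>
    (\<forall>i\<in>{1..N}. locally_bounded (D i) \<and> conservative_field (f i) (D i) \<and>
                 (\<forall>x. D i x \<noteq> {} \<and> convex (D i x))) \<and>
    proper_fun g \<and> convex_fun g \<and> closed (edom g) \<and>
    locally_lipschitz_on (edom g) (\<lambda>x. real_of_ereal (g x)) \<and>
    (\<exists>m::real. \<forall>x. ereal m \<le> objective N f g x)"


section \<open>Proximal random reshuffling\<close>

text \<open>The proximal map is the set of minimizers, so that no choice has to be made when the
  minimizer fails to exist or to be unique.\<close>

definition prox :: "('a::real_normed_vector \<Rightarrow> ereal) \<Rightarrow> 'a \<Rightarrow> 'a set" where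
  "prox h x = {p. is_arg_min (\<lambda>y. h y + ereal ((norm (y - x))\<^sup>2 / 2)) (\<lambda>_. True) p}"

text \<open>In epoch \<open>k\<close>, \<open>z i\<close> is the inner iterate after \<open>i\<close> steps.\<close>

definition prr_sequence ::
    "nat \<Rightarrow> (nat \<Rightarrow> 'a::euclidean_space \<Rightarrow> 'a set) \<Rightarrow> ('a \<Rightarrow> ereal) \<Rightarrow>
     (nat \<Rightarrow> real) \<Rightarrow> (nat \<Rightarrow> 'a) \<Rightarrow> bool" where
  "prr_sequence N D g \<alpha> x \<longleftrightarrow>
    (\<forall>k. \<exists>\<sigma> z. \<sigma> permutes {1..N} \<and>
       z 0 = x k \<and>
       (\<forall>i\<in>{1..N}. \<exists>v\<in>D (\<sigma> i) (z (i - 1)). z i = z (i - 1) - \<alpha> k *\<^sub>R v) \<and>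
       x (Suc k) \<in> prox (\<lambda>y. ereal (\<alpha> k) * g y) (z N))"


section \<open>Near approximate stationarity\<close>

text \<open>Unlike \<^const>\<open>infdist\<close>, the extended distance to the empty set is \<open>\<infinity>\<close>.\<close>

definition edist_set :: "'a::metric_space \<Rightarrow> 'a set \<Rightarrow> ereal" where
  "edist_set x S = (INF y\<in>S. ereal (dist x y))"

definition near_approx_stationary ::
    "real \<Rightarrow> real \<Rightarrow> ('a::real_normed_vector \<Rightarrow> 'a set) \<Rightarrow> 'a \<Rightarrow> bool" where
  "near_approx_stationary \<epsilon> \<delta> D x \<longleftrightarrow> edist_set 0 (\<Union>y\<in>cball x \<epsilon>. D y) \<le> ereal \<delta>"

end

theory Submission
  imports Defs
begin

text \<open>Each epoch of the algorithm satisfies, up to an error that is uniformly small on bounded sets,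
  the evolution variational inequality
  \<open>\<parallel>x' - y\<parallel>\<^sup>2 \<le> \<parallel>x - y\<parallel>\<^sup>2 + 2 \<alpha> (\<Phi> y - \<Phi> x + \<rho> \<parallel>y - x\<parallel>\<^sup>2)\<close> of the subgradient flow.
  Regularity and weak convexity enter only here.  Testing with two runs at once shows that all runs
  from \<open>x0\<close> converge, as the steps vanish, to one limit curve \<open>Y\<close>, along which \<open>\<Phi>\<close> decreases.
  Since \<open>\<Phi>\<close> is bounded below, it hardly decreases on \<open>[T - h, T]\<close> for \<open>T\<close> large and \<open>h\<close> fixed;
  the inequality over that interval then says that \<open>Y T\<close> nearly minimizes \<open>\<Phi> + 2 \<rho> \<parallel>\<cdot> - Y T\<parallel>\<^sup>2\<close>
  locally, and a minimizer of \<open>\<Phi> + (2 \<rho> + 1) \<parallel>\<cdot> - Y T\<parallel>\<^sup>2\<close> is a nearby point with a small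
  subgradient.\<close>

section \<open>Clarke subgradients of regular functions\<close>

text \<open>\<open>T0\<close> must be fixed before step sizes, orders and subgradients are chosen,
  and the claim concerns the limit of the run, not its best iterate. A time after which
  \<open>\<Phi>\<close> hardly drops exists along any single trajectory, but it could depend on the
  trajectory; uniqueness of the limit curve makes it common to all runs. The evolution variational
  inequality is the form in which uniqueness is provable by comparing two curves, and it survives
  pointwise limits, because it involves only positions and values of \<open>\<Phi>\<close>, no
  velocities and no subgradients. Within an epoch the subgradients of the \<open>f i\<close> are
  taken at displaced points. They still lie, up to a small error, below the generalized directional
  derivative at the base point; regularity identifies the latter with the limit of difference
  quotients, and these add up over \<open>i\<close>. Only then can weak convexity be used, which is
  available for the sum alone. Since the steps are positive, their partial sums never reach
  \<open>T\<close>. A run is therefore compared with the curve slightly before \<open>T\<close>, and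
  speed bounds for both cover the remaining time.\<close>

lemma subdiff_regularE:
  assumes "subdiff_regular f"
  obtains L where "((\<lambda>t. (f (x + t *\<^sub>R h) - f x) / t) \<longlongrightarrow> L) (at_right 0)"
    and "\<And>e. e > 0 \<Longrightarrow> \<exists>r>0. \<forall>y t. dist y x < r \<longrightarrow> 0 < t \<longrightarrow> t < r \<longrightarrow>
           (f (y + t *\<^sub>R h) - f y) / t < L + e"
proof -
  obtain L where L: "((\<lambda>t. (f (x + t *\<^sub>R h) - f x) / t) \<longlongrightarrow> L) (at_right 0)"
    and sup: "ereal L = Limsup (nhds x \<times>\<^sub>F at_right 0) (\<lambda>(y, t). ereal ((f (y + t *\<^sub>R h) - f y) / t))"
    using assms unfolding subdiff_regular_def by blast
  have "\<exists>r>0. \<forall>y t. dist y x < r \<longrightarrow> 0 < t \<longrightarrow> t < r \<longrightarrow> (f (y + t *\<^sub>R h) - f y) / t < L + e"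
    if "e > 0" for e
  proof -
    have "Limsup (nhds x \<times>\<^sub>F at_right 0) (\<lambda>(y, t). ereal ((f (y + t *\<^sub>R h) - f y) / t)) < ereal (L + e)"
      unfolding sup[symmetric] using that by simp
    from Limsup_lessD[OF this] obtain P Q where P: "eventually P (nhds x)"
      and Q: "eventually Q (at_right 0)"
      and PQ: "\<And>y t. P y \<Longrightarrow> Q t \<Longrightarrow> (f (y + t *\<^sub>R h) - f y) / t < L + e"
      unfolding eventually_prod_filter by auto
    obtain r1 where r1: "r1 > 0" "\<And>y. dist y x < r1 \<Longrightarrow> P y"
      using P unfolding eventually_nhds_metric by auto
    obtain r2 where r2: "r2 > 0" "\<And>t. 0 < t \<Longrightarrow> t < r2 \<Longrightarrow> Q t"
      using Q unfolding eventually_at_right_field by auto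
    show ?thesis
      by (rule exI[of _ "min r1 r2"]) (use r1 r2 PQ in auto)
  qed
  with L show thesis by (rule that)
qed

text \<open>The epigraph contains the vertical ray above each of its points, and testing the normal
  along that ray bounds \<open>s\<close>. The sign is what later lets an upper bound on a difference
  quotient be multiplied by \<open>s\<close>.\<close>

lemma regular_normal_epi_nonpos:
  fixes f :: "'a::euclidean_space \<Rightarrow> real"
  assumes "(w, s) \<in> regular_normal_cone (epi (\<lambda>x. ereal (f x))) (y, \<tau>)"
  shows "s \<le> 0"
proof (rule field_le_epsilon)
  fix e :: real assume e: "e > 0"
  let ?E = "epi (\<lambda>x. ereal (f x))"
  have mem: "(y, \<tau>) \<in> ?E"
    and "\<forall>\<^sub>F p in at (y, \<tau>) within ?E. (w, s) \<bullet> (p - (y, \<tau>)) \<le> e * norm (p - (y, \<tau>))"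
    using assms e unfolding regular_normal_cone_def by auto
  then obtain r where r: "r > 0"
    "\<And>p. p \<in> ?E \<Longrightarrow> p \<noteq> (y, \<tau>) \<Longrightarrow> dist p (y, \<tau>) < r \<Longrightarrow>
       (w, s) \<bullet> (p - (y, \<tau>)) \<le> e * norm (p - (y, \<tau>))"
    unfolding eventually_at by auto
  have "(w, s) \<bullet> ((y, \<tau> + r/2) - (y, \<tau>)) \<le> e * norm ((y, \<tau> + r/2) - (y, \<tau>))"
    by (rule r(2)) (use mem r(1) in \<open>auto simp: epi_def dist_Pair_Pair dist_real_def\<close>)
  then have "s * (r/2) \<le> e * (r/2)"
    using r(1) by (simp add: norm_Pair)
  then show "s \<le> 0 + e" using r(1) by simp
qed

text \<open>Translating along \<open>(t d, f (y + t d) - f y)\<close> stays in the epigraph, so \<open>(y, \<tau>)\<close> need not lie on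
  the graph.\<close>

lemma regular_normal_epi_le:
  fixes f :: "'a::euclidean_space \<Rightarrow> real"
  assumes lip: "locally_lipschitz_on UNIV f"
    and nor: "(w, s) \<in> regular_normal_cone (epi (\<lambda>x. ereal (f x))) (y, \<tau>)"
    and "r0 > 0" and quot: "\<And>t. 0 < t \<Longrightarrow> t < r0 \<Longrightarrow> (f (y + t *\<^sub>R d) - f y) / t < b"
  shows "w \<bullet> d + s * b \<le> 0"
proof -
  let ?E = "epi (\<lambda>x. ereal (f x))"
  have s: "s \<le> 0" by (rule regular_normal_epi_nonpos[OF nor])
  obtain u L where u: "u > 0" and "lipschitz_on L (cball y u) f"
    using lip unfolding locally_lipschitz_on_iff by (metis Int_UNIV_right UNIV_I)
  then have L: "L \<ge> 0" "\<And>z. dist y z \<le> u \<Longrightarrow> \<bar>f z - f y\<bar> \<le> L * dist z y"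
    unfolding lipschitz_on_def by (auto simp: dist_real_def)
  \<comment> \<open>\<open>c\<close> bounds the displacement \<open>(t d, f (y + t d) - f y)\<close>
    per unit of \<open>t\<close>, with \<open>L\<close> for its vertical part. The error allowed by
    a regular normal is then at most \<open>e * c * t\<close>, and \<open>e\<close> can be sent to 0
    after division by \<open>t\<close>.\<close>
  define c where "c = norm d + L * norm d"
  have c: "c \<ge> 0" using L(1) by (simp add: c_def)
  have key: "w \<bullet> d + s * b \<le> e * c" if e: "e > 0" for e
  proof -
    have mem: "(y, \<tau>) \<in> ?E"
      and "\<forall>\<^sub>F p in at (y, \<tau>) within ?E. (w, s) \<bullet> (p - (y, \<tau>)) \<le> e * norm (p - (y, \<tau>))"
      using nor e unfolding regular_normal_cone_def by auto
    then obtain r where r: "r > 0"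
      "\<And>p. p \<in> ?E \<Longrightarrow> p \<noteq> (y, \<tau>) \<Longrightarrow> dist p (y, \<tau>) < r \<Longrightarrow>
         (w, s) \<bullet> (p - (y, \<tau>)) \<le> e * norm (p - (y, \<tau>))"
      unfolding eventually_at by auto
    have rr: "(w, s) \<bullet> (p - (y, \<tau>)) \<le> e * norm (p - (y, \<tau>))"
      if "p \<in> ?E" "dist p (y, \<tau>) < r" for p
      using r(2)[OF that(1) _ that(2)] by (cases "p = (y, \<tau>)") auto
    define t where "t = min r0 (min (u / (norm d + 1)) (r / (c + 1))) / 2"
    have t0: "t > 0" using \<open>r0 > 0\<close> u r(1) c by (simp add: t_def add_nonneg_pos)
    have t1: "t < r0" using \<open>r0 > 0\<close> t0 unfolding t_def by linarith
    have "t < u / (norm d + 1)" using t0 unfolding t_def by linarith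
    then have "t * (norm d + 1) < u"
      by (simp add: pos_less_divide_eq add_nonneg_pos)
    then have t2: "t * norm d \<le> u" using t0 by (simp add: algebra_simps)
    have "t < r / (c + 1)" using t0 unfolding t_def by linarith
    then have "t * (c + 1) < r"
      using c by (simp add: pos_less_divide_eq add_nonneg_pos)
    then have t3: "t * c < r" using t0 by (simp add: algebra_simps)
    define p where "p = (y + t *\<^sub>R d, \<tau> + (f (y + t *\<^sub>R d) - f y))"
    have pE: "p \<in> ?E" using mem by (auto simp: epi_def p_def)
    have "\<bar>f (y + t *\<^sub>R d) - f y\<bar> \<le> L * dist (y + t *\<^sub>R d) y"
      by (rule L(2)) (use t0 t2 in \<open>simp add: dist_norm\<close>)
    then have fd: "\<bar>f (y + t *\<^sub>R d) - f y\<bar> \<le> L * (t * norm d)"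
      using t0 by (simp add: dist_norm)
    have "norm (p - (y, \<tau>)) \<le> norm (t *\<^sub>R d) + norm (f (y + t *\<^sub>R d) - f y)"
      using norm_Pair_le[of "t *\<^sub>R d" "f (y + t *\<^sub>R d) - f y"] by (simp add: p_def)
    also have "\<dots> \<le> t * c" using fd t0 by (simp add: c_def algebra_simps)
    finally have np: "norm (p - (y, \<tau>)) \<le> t * c" .
    have "(w, s) \<bullet> (p - (y, \<tau>)) \<le> e * norm (p - (y, \<tau>))"
      by (rule rr[OF pE]) (use np t3 in \<open>simp add: dist_norm\<close>)
    also have "\<dots> \<le> e * (t * c)" using np e by simp
    finally have "t * (w \<bullet> d) + s * (f (y + t *\<^sub>R d) - f y) \<le> e * (t * c)"
      by (simp add: p_def)
    moreover have "s * (b * t) \<le> s * (f (y + t *\<^sub>R d) - f y)"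
      using quot[OF t0 t1] t0 s by (intro mult_left_mono_neg) (auto simp: field_simps)
    ultimately have "t * (w \<bullet> d + s * b) \<le> t * (e * c)" by (simp add: algebra_simps)
    then show ?thesis using t0 by simp
  qed
  show ?thesis
  proof (rule field_le_epsilon)
    fix e :: real assume "e > 0"
    then have "w \<bullet> d + s * b \<le> e / (c + 1) * c" using c by (intro key) (simp add: add_nonneg_pos)
    also have "\<dots> \<le> e" using c \<open>e > 0\<close> by (simp add: field_simps)
    finally show "w \<bullet> d + s * b \<le> 0 + e" by simp
  qed
qed

text \<open>Nonpositive pairing with \<open>(d, L)\<close> defines a closed half-space, so it passes
  from limiting normals to their closed convex hull. For a limiting normal it comes from regular
  normals at nearby points; this is why \<open>quot\<close> is uniform in the base point
  \<open>y\<close>.\<close>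

lemma clarke_subdiff_le_directional:
  fixes f :: "'a::euclidean_space \<Rightarrow> real"
  assumes lip: "locally_lipschitz_on UNIV f"
    and quot: "\<And>e. e > 0 \<Longrightarrow> \<exists>r>0. \<forall>y t. dist y x < r \<longrightarrow> 0 < t \<longrightarrow> t < r \<longrightarrow>
           (f (y + t *\<^sub>R d) - f y) / t < L + e"
    and v: "v \<in> clarke_subdiff (\<lambda>x. ereal (f x)) x"
  shows "v \<bullet> d \<le> L"
proof -
  let ?E = "epi (\<lambda>x. ereal (f x))"
  have "limiting_normal_cone ?E (x, f x) \<subseteq> {p. (d, L) \<bullet> p \<le> 0}"
  proof
    fix p assume "p \<in> limiting_normal_cone ?E (x, f x)"
    then obtain y w where yw: "\<And>k::nat. w k \<in> regular_normal_cone ?E (y k)"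
      and y: "y \<longlonglongrightarrow> (x, f x)" and w: "w \<longlonglongrightarrow> p"
      unfolding limiting_normal_cone_def by auto
    have lw: "(\<lambda>k. fst (w k)) \<longlonglongrightarrow> fst p" "(\<lambda>k. snd (w k)) \<longlonglongrightarrow> snd p"
      using w by (auto intro: tendsto_intros)
    have ly: "(\<lambda>k. fst (y k)) \<longlonglongrightarrow> x" using tendsto_fst[OF y] by simp
    have e: "fst p \<bullet> d + snd p * (L + e) \<le> 0" if e0: "e > 0" for e
    proof -
      obtain r where r: "r > 0" "\<forall>y t. dist y x < r \<longrightarrow> 0 < t \<longrightarrow> t < r \<longrightarrow>
           (f (y + t *\<^sub>R d) - f y) / t < L + e" using quot[OF e0] by auto
      have "\<forall>\<^sub>F k in sequentially. dist (fst (y k)) x < r" using ly r(1) by (rule tendstoD)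
      then have ev: "\<forall>\<^sub>F k in sequentially. fst (w k) \<bullet> d + snd (w k) * (L + e) \<le> 0"
      proof eventually_elim
        case (elim k)
        have "(fst (w k), snd (w k)) \<in> regular_normal_cone ?E (fst (y k), snd (y k))"
          using yw[of k] by simp
        then show ?case by (rule regular_normal_epi_le[OF lip]) (use r elim in auto)
      qed
      have "(\<lambda>k. fst (w k) \<bullet> d + snd (w k) * (L + e)) \<longlonglongrightarrow> fst p \<bullet> d + snd p * (L + e)"
        by (intro tendsto_intros lw)
      then show ?thesis by (rule tendsto_upperbound[OF _ ev]) simp
    qed
    have "((\<lambda>e. fst p \<bullet> d + snd p * (L + e)) \<longlongrightarrow> fst p \<bullet> d + snd p * (L + 0)) (at_right 0)"
      by (intro tendsto_intros)
    moreover have "\<forall>\<^sub>F h in at_right (0::real). fst p \<bullet> d + snd p * (L + h) \<le> 0"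
      unfolding eventually_at_right_field by (intro exI[of _ 1]) (auto intro: e)
    ultimately have "fst p \<bullet> d + snd p * (L + 0) \<le> 0"
      by (rule tendsto_upperbound) simp
    then show "p \<in> {p. (d, L) \<bullet> p \<le> 0}"
      by (cases p) (simp add: inner_commute mult.commute)
  qed
  then have "closure (convex hull limiting_normal_cone ?E (x, f x)) \<subseteq> {p. (d, L) \<bullet> p \<le> 0}"
    by (intro closure_minimal hull_minimal convex_halfspace_le closed_halfspace_le)
  with v have "(d, L) \<bullet> (v, -1) \<le> 0" unfolding clarke_subdiff_def by auto
  then show ?thesis by (simp add: inner_commute)
qed

text \<open>At one fixed small \<open>t\<close> the quotient at \<open>x0\<close> is within
  \<open>\<eta>/4\<close> of the directional derivative \<open>L\<close>, and by regularity
  \<open>L\<close> also controls the subgradients at nearby points. With \<open>t\<close> frozen the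
  quotient is jointly continuous in point and direction, so one radius, depending on
  \<open>t\<close>, serves all \<open>x\<close> and \<open>e\<close>.\<close>

lemma clarke_subdiff_le_quotient:
  fixes f :: "'a::euclidean_space \<Rightarrow> real"
  assumes reg: "subdiff_regular f"
    and bd: "locally_bounded (clarke_subdiff (\<lambda>x. ereal (f x)))"
    and \<eta>: "\<eta> > 0"
  shows "\<forall>\<^sub>F t in at_right 0. \<exists>r>0. \<forall>z x e v. dist z x0 < r \<longrightarrow> dist x x0 < r \<longrightarrow> dist e d < r \<longrightarrow>
    v \<in> clarke_subdiff (\<lambda>x. ereal (f x)) z \<longrightarrow> v \<bullet> e \<le> (f (x + t *\<^sub>R e) - f x) / t + \<eta>"
proof -
  have lip: "locally_lipschitz_on UNIV f" using reg unfolding subdiff_regular_def by blast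
  have cont: "isCont f y" for y
  proof -
    obtain u L where "u > 0" "lipschitz_on L (cball y u) f"
      using lip unfolding locally_lipschitz_on_iff by (metis Int_UNIV_right UNIV_I)
    then have "continuous_on (ball y u) f"
      by (metis ball_subset_cball continuous_on_subset lipschitz_on_continuous_on)
    then show ?thesis using \<open>u > 0\<close> by (simp add: continuous_on_interior)
  qed
  obtain L where L: "((\<lambda>t. (f (x0 + t *\<^sub>R d) - f x0) / t) \<longlongrightarrow> L) (at_right 0)"
    and up: "\<And>e. e > 0 \<Longrightarrow> \<exists>r>0. \<forall>y t. dist y x0 < r \<longrightarrow> 0 < t \<longrightarrow> t < r \<longrightarrow>
           (f (y + t *\<^sub>R d) - f y) / t < L + e"
    by (rule subdiff_regularE[OF reg, of x0 d]) (rule that)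
  obtain r1 where r1: "r1 > 0" "\<And>y t. dist y x0 < r1 \<Longrightarrow> 0 < t \<Longrightarrow> t < r1 \<Longrightarrow>
           (f (y + t *\<^sub>R d) - f y) / t < L + \<eta>/4"
    using up[of "\<eta>/4"] \<eta> by auto
  \<comment> \<open>Upper semicontinuity: every \<open>z\<close> within \<open>r1\<close> of
    \<open>x0\<close> has its quotients below \<open>L + \<eta>/4\<close>, so its own derivative
    \<open>L'\<close> is at most that, and \<open>L'\<close> bounds its subgradients.\<close>
  have vd: "v \<bullet> d \<le> L + \<eta>/4" if z: "dist z x0 < r1" and v: "v \<in> clarke_subdiff (\<lambda>x. ereal (f x)) z" for z v
  proof -
    obtain L' where L': "((\<lambda>t. (f (z + t *\<^sub>R d) - f z) / t) \<longlongrightarrow> L') (at_right 0)"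
      and up': "\<And>e. e > 0 \<Longrightarrow> \<exists>r>0. \<forall>y t. dist y z < r \<longrightarrow> 0 < t \<longrightarrow> t < r \<longrightarrow>
             (f (y + t *\<^sub>R d) - f y) / t < L' + e"
      by (rule subdiff_regularE[OF reg, of z d]) (rule that)
    have "v \<bullet> d \<le> L'" by (rule clarke_subdiff_le_directional[OF lip up' v])
    also have "L' \<le> L + \<eta>/4"
    proof (rule tendsto_upperbound[OF L'])
      show "\<forall>\<^sub>F t in at_right 0. (f (z + t *\<^sub>R d) - f z) / t \<le> L + \<eta>/4"
        unfolding eventually_at_right_field
        by (intro exI[of _ r1]) (use r1 z in \<open>auto intro: less_imp_le\<close>)
    qed simp
    finally show ?thesis .
  qed
  obtain U where U: "open U" "x0 \<in> U" "bounded (\<Union>y\<in>U. clarke_subdiff (\<lambda>x. ereal (f x)) y)"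
    using bd unfolding locally_bounded_def by blast
  obtain r2 where r2: "r2 > 0" "\<And>y. dist y x0 < r2 \<Longrightarrow> y \<in> U"
    using U(1,2) unfolding open_dist by blast
  obtain B where B: "B > 0" "\<And>v. v \<in> (\<Union>y\<in>U. clarke_subdiff (\<lambda>x. ereal (f x)) y) \<Longrightarrow> norm v \<le> B"
    using U(3) unfolding bounded_pos by blast
  have "\<forall>\<^sub>F t in at_right 0. dist ((f (x0 + t *\<^sub>R d) - f x0) / t) L < \<eta>/4"
    using L \<eta> by (intro tendstoD) auto
  moreover have "\<forall>\<^sub>F t in at_right (0::real). t > 0" by (rule eventually_at_right_less)
  ultimately show ?thesis
  proof eventually_elim
    case (elim t)
    have "((\<lambda>p. (f (fst p + t *\<^sub>R snd p) - f (fst p)) / t) \<longlongrightarrow> (f (fst (x0, d) + t *\<^sub>R snd (x0, d)) - f (fst (x0, d))) / t) (at (x0, d))"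
      by (intro tendsto_intros isCont_tendsto_compose[OF cont]) (use elim in auto)
    then obtain r3 where r3: "r3 > 0" "\<And>p. p \<noteq> (x0, d) \<Longrightarrow> dist p (x0, d) < r3 \<Longrightarrow>
      dist ((f (fst p + t *\<^sub>R snd p) - f (fst p)) / t) ((f (x0 + t *\<^sub>R d) - f x0) / t) < \<eta>/4"
      using \<eta> unfolding tendsto_iff eventually_at by (metis fst_conv snd_conv UNIV_I divide_pos_pos zero_less_numeral)
    \<comment> \<open>The quarters of \<open>\<eta>\<close> pay for replacing \<open>e\<close> by
      \<open>d\<close> (the subgradients being bounded by \<open>B\<close>), for
      \<open>v \<bullet> d\<close> against \<open>L\<close>, for \<open>L\<close> against the
      quotient at \<open>(x0, d)\<close>, and for moving that quotient to \<open>(x, e)\<close>.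
      Each coordinate of the pair receives half of \<open>r3\<close>.\<close>
    define r where "r = min (min r1 r2) (min (r3 / 2) (\<eta> / (4 * B)))"
    have "r > 0" using r1 r2 r3 \<eta> B by (auto simp: r_def)
    moreover have "v \<bullet> e \<le> (f (x + t *\<^sub>R e) - f x) / t + \<eta>"
      if "dist z x0 < r" "dist x x0 < r" "dist e d < r" "v \<in> clarke_subdiff (\<lambda>x. ereal (f x)) z"
      for z x e v
    proof -
      have "norm v \<le> B" using that r2 by (intro B(2)) (auto simp: r_def)
      then have "v \<bullet> (e - d) \<le> B * norm (e - d)"
        by (meson dual_order.trans mult_right_mono norm_cauchy_schwarz norm_ge_zero)
      also have "\<dots> \<le> B * (\<eta> / (4 * B))"
        using that(3) B(1) by (intro mult_left_mono) (auto simp: r_def dist_norm)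
      also have "\<dots> = \<eta>/4" using B by simp
      finally have 1: "v \<bullet> e \<le> v \<bullet> d + \<eta>/4" by (simp add: inner_diff_right)
      have 2: "v \<bullet> d \<le> L + \<eta>/4" using that by (intro vd) (auto simp: r_def)
      have "dist (x, e) (x0, d) \<le> dist x x0 + dist e d"
        by (simp add: dist_Pair_Pair sqrt_sum_squares_le_sum)
      also have "\<dots> < r3" using that by (simp add: r_def)
      finally have "dist ((f (x + t *\<^sub>R e) - f x) / t) ((f (x0 + t *\<^sub>R d) - f x0) / t) < \<eta>/4"
        using r3(2)[of "(x, e)"] \<eta> by (cases "(x, e) = (x0, d)") auto
      then show ?thesis using 1 2 elim(1) unfolding dist_real_def by linarith
    qed
    ultimately show ?case by blast
  qed
qed

text \<open>The graphs of the subdifferentials are closed, but without any rate, so the error is controlled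
  by compactness.  Comparing with difference quotients at one fixed \<open>t\<close> instead of directional
  derivatives means that no limit of the (possibly unbounded) subgradients \<open>w\<close> of \<open>G\<close> is taken.\<close>

lemma approx_subgradient_uniform:
  fixes f :: "'i \<Rightarrow> 'a::euclidean_space \<Rightarrow> real"
  assumes I: "finite I"
    and reg: "\<And>i. i \<in> I \<Longrightarrow> subdiff_regular (f i)"
    and bd: "\<And>i. i \<in> I \<Longrightarrow> locally_bounded (clarke_subdiff (\<lambda>x. ereal (f i x)))"
    and C: "convex C"
    and \<phi>: "\<And>x. x \<in> C \<Longrightarrow> \<phi> x = (\<Sum>i\<in>I. f i x) + G x"
    and wc: "\<And>x y t. x \<in> C \<Longrightarrow> y \<in> C \<Longrightarrow> 0 < t \<Longrightarrow> t < 1 \<Longrightarrow>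
       \<phi> (x + t *\<^sub>R (y - x)) \<le> (1 - t) * \<phi> x + t * \<phi> y + \<rho> * t * (1 - t) * (norm (y - x))\<^sup>2"
    and "\<rho> \<ge> 0" and K: "compact K" and \<eta>: "\<eta> > 0"
  shows "\<exists>r>0. \<forall>x\<in>K \<inter> C. \<forall>y\<in>K \<inter> C. \<forall>z v w.
     (\<forall>i\<in>I. dist (z i) x < r \<and> v i \<in> clarke_subdiff (\<lambda>x. ereal (f i x)) (z i)) \<longrightarrow>
     (\<forall>y\<in>C. G x + w \<bullet> (y - x) \<le> G y) \<longrightarrow>
     \<phi> x + ((\<Sum>i\<in>I. v i) + w) \<bullet> (y - x) - \<rho> * (norm (y - x))\<^sup>2 - \<eta> \<le> \<phi> y"
proof (rule ccontr)
  assume neg: "\<not> ?thesis"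
  define bad where "bad r x y z v w \<longleftrightarrow> x \<in> K \<inter> C \<and> y \<in> K \<inter> C \<and>
     (\<forall>i\<in>I. dist (z i) x < r \<and> v i \<in> clarke_subdiff (\<lambda>x. ereal (f i x)) (z i)) \<and>
     (\<forall>y\<in>C. G x + w \<bullet> (y - x) \<le> G y) \<and>
     \<phi> y < \<phi> x + ((\<Sum>i\<in>I. v i) + w) \<bullet> (y - x) - \<rho> * (norm (y - x))\<^sup>2 - \<eta>" for r x y z v w
  have "\<exists>x y z v w. bad r x y z v w" if "r > 0" for r
    using neg that unfolding bad_def by (auto simp: not_le) blast
  then have "\<forall>n. \<exists>x y z v w. bad (1 / real (Suc n)) x y z v w" by simp
  then obtain x y z v w where bad: "\<And>n. bad (1 / real (Suc n)) (x n) (y n) (z n) (v n) (w n)"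
    by metis
  have "\<And>n. (x n, y n) \<in> K \<times> K" using bad unfolding bad_def by auto
  then obtain p \<theta> where p: "strict_mono (\<theta> :: nat \<Rightarrow> nat)" "((\<lambda>n. (x n, y n)) \<circ> \<theta>) \<longlonglongrightarrow> p"
    using compact_Times[OF K K, unfolded compact_def, rule_format, of "\<lambda>n. (x n, y n)"] by blast
  define x0 d where "x0 = fst p" and "d = snd p - fst p"
  have lx: "(\<lambda>n. x (\<theta> n)) \<longlonglongrightarrow> x0" and ly: "(\<lambda>n. y (\<theta> n)) \<longlonglongrightarrow> snd p"
    using tendsto_fst[OF p(2)] tendsto_snd[OF p(2)] by (auto simp: x0_def o_def)
  have ld: "(\<lambda>n. y (\<theta> n) - x (\<theta> n)) \<longlonglongrightarrow> d"
    using tendsto_diff[OF ly lx] by (simp add: d_def x0_def)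
  \<comment> \<open>One share for each index; the \<open>+ 1\<close> keeps \<open>\<eta>'\<close>
    positive when \<open>I\<close> is empty.\<close>
  define \<eta>' where "\<eta>' = \<eta> / (real (card I) + 1)"
  have \<eta>': "\<eta>' > 0" "real (card I) * \<eta>' \<le> \<eta>" using \<eta> by (auto simp: \<eta>'_def field_simps)
  have "\<forall>\<^sub>F t in at_right 0. \<forall>i\<in>I. \<exists>r>0. \<forall>z x e v. dist z x0 < r \<longrightarrow> dist x x0 < r \<longrightarrow> dist e d < r \<longrightarrow>
    v \<in> clarke_subdiff (\<lambda>x. ereal (f i x)) z \<longrightarrow> v \<bullet> e \<le> (f i (x + t *\<^sub>R e) - f i x) / t + \<eta>'"
    by (intro eventually_ball_finite[OF I] ballI clarke_subdiff_le_quotient reg bd \<eta>')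
  moreover have "\<forall>\<^sub>F t in at_right (0::real). 0 < t \<and> t < 1"
    unfolding eventually_at_right_field by (intro exI[of _ 1]) auto
  ultimately have "\<forall>\<^sub>F t in at_right (0::real). 0 < t \<and> t < 1 \<and> (\<forall>i\<in>I. \<exists>r>0. \<forall>z x e v. dist z x0 < r \<longrightarrow> dist x x0 < r \<longrightarrow> dist e d < r \<longrightarrow>
    v \<in> clarke_subdiff (\<lambda>x. ereal (f i x)) z \<longrightarrow> v \<bullet> e \<le> (f i (x + t *\<^sub>R e) - f i x) / t + \<eta>')"
    by eventually_elim auto
  then obtain t where t: "0 < t" "t < 1" and "\<forall>i\<in>I. \<exists>r>0. \<forall>z x e v. dist z x0 < r \<longrightarrow> dist x x0 < r \<longrightarrow> dist e d < r \<longrightarrow>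
    v \<in> clarke_subdiff (\<lambda>x. ereal (f i x)) z \<longrightarrow> v \<bullet> e \<le> (f i (x + t *\<^sub>R e) - f i x) / t + \<eta>'"
    using eventually_happens'[OF trivial_limit_at_right_real] by blast
  then obtain R where R: "\<And>i. i \<in> I \<Longrightarrow> R i > 0" and
    RR: "\<And>i z x e v. i \<in> I \<Longrightarrow> dist z x0 < R i \<Longrightarrow> dist x x0 < R i \<Longrightarrow> dist e d < R i \<Longrightarrow>
    v \<in> clarke_subdiff (\<lambda>x. ereal (f i x)) z \<Longrightarrow> v \<bullet> e \<le> (f i (x + t *\<^sub>R e) - f i x) / t + \<eta>'"
    by metis
  define r where "r = Min (insert 1 (R ` I))"
  have r: "r > 0" "\<And>i. i \<in> I \<Longrightarrow> r \<le> R i" using I R by (auto simp: r_def)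
  have "(\<lambda>n. 1 / real (Suc (\<theta> n))) \<longlonglongrightarrow> 0"
    using LIMSEQ_subseq_LIMSEQ[OF LIMSEQ_inverse_real_of_nat p(1)] by (simp add: o_def inverse_eq_divide)
  then have "\<forall>\<^sub>F n in sequentially. 1 / real (Suc (\<theta> n)) < r / 2"
    by (rule order_tendstoD) (use r in simp)
  moreover have "\<forall>\<^sub>F n in sequentially. dist (x (\<theta> n)) x0 < r / 2"
    using lx by (rule tendstoD) (use r in simp)
  moreover have "\<forall>\<^sub>F n in sequentially. dist (y (\<theta> n) - x (\<theta> n)) d < r"
    using ld r(1) by (rule tendstoD)
  ultimately have "\<forall>\<^sub>F n in sequentially. False"
  proof eventually_elim
    case (elim n)
    define a b Z V W where "a = x (\<theta> n)" and "b = y (\<theta> n)" and "Z = z (\<theta> n)" and "V = v (\<theta> n)" and "W = w (\<theta> n)"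
    have B: "a \<in> C" "b \<in> C" "\<And>i. i \<in> I \<Longrightarrow> dist (Z i) a < r / 2"
      "\<And>i. i \<in> I \<Longrightarrow> V i \<in> clarke_subdiff (\<lambda>x. ereal (f i x)) (Z i)"
      "\<And>y. y \<in> C \<Longrightarrow> G a + W \<bullet> (y - a) \<le> G y"
      "\<phi> b < \<phi> a + ((\<Sum>i\<in>I. V i) + W) \<bullet> (b - a) - \<rho> * (norm (b - a))\<^sup>2 - \<eta>"
      using bad[of "\<theta> n"] elim(1) unfolding bad_def a_def b_def Z_def V_def W_def by force+
    \<comment> \<open>Three bounds meet at this point of the segment: the quotients bound the
      \<open>V i\<close> by increments of \<open>f i\<close> from \<open>a\<close> to
      \<open>c\<close>, the subgradient inequality bounds \<open>W\<close> by the increment of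
      \<open>G\<close>, and weak convexity bounds \<open>\<phi> c\<close> from above by the values
      at the ends. Division by \<open>t\<close> finishes.\<close>
    define c where "c = a + t *\<^sub>R (b - a)"
    have "c = (1 - t) *\<^sub>R a + t *\<^sub>R b" by (simp add: c_def algebra_simps)
    then have c: "c \<in> C" using C B(1,2) t unfolding convex_alt by auto
    have "V i \<bullet> (b - a) * t \<le> f i c - f i a + \<eta>' * t" if i: "i \<in> I" for i
    proof -
      have "V i \<bullet> (b - a) \<le> (f i (a + t *\<^sub>R (b - a)) - f i a) / t + \<eta>'"
      proof (rule RR[OF i])
        show "dist (Z i) x0 < R i"
          using B(3)[OF i] elim(2) r(2)[OF i] dist_triangle[of "Z i" x0 a] unfolding a_def by linarith
        show "dist a x0 < R i" using elim(2) r(1) r(2)[OF i] unfolding a_def by linarith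
        show "dist (b - a) d < R i" using elim(3) r(2)[OF i] unfolding a_def b_def by linarith
      qed (rule B(4)[OF i])
      from mult_right_mono[OF this, of t] t(1) show ?thesis by (simp add: c_def distrib_right)
    qed
    then have "(\<Sum>i\<in>I. V i \<bullet> (b - a) * t) \<le> (\<Sum>i\<in>I. f i c - f i a + \<eta>' * t)" by (rule sum_mono)
    then have "t * ((\<Sum>i\<in>I. V i) \<bullet> (b - a)) \<le> (\<Sum>i\<in>I. f i c) - (\<Sum>i\<in>I. f i a) + t * (real (card I) * \<eta>')"
      by (simp add: sum.distrib sum_subtractf inner_sum_left sum_distrib_left mult_ac)
    moreover have "t * (real (card I) * \<eta>') \<le> t * \<eta>" using t \<eta>' by simp
    moreover have "t * (W \<bullet> (b - a)) \<le> G c - G a"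
      using B(5)[OF c] by (simp add: c_def)
    ultimately have "t * (((\<Sum>i\<in>I. V i) + W) \<bullet> (b - a)) \<le> \<phi> c - \<phi> a + t * \<eta>"
      using \<phi>[OF c] \<phi>[OF B(1)] by (simp add: inner_add_left distrib_left)
    moreover have "\<phi> c \<le> (1 - t) * \<phi> a + t * \<phi> b + \<rho> * t * (1 - t) * (norm (b - a))\<^sup>2"
      unfolding c_def by (rule wc) (use B t in auto)
    moreover have "\<rho> * t * (1 - t) * (norm (b - a))\<^sup>2 \<le> \<rho> * t * 1 * (norm (b - a))\<^sup>2"
      using t \<open>\<rho> \<ge> 0\<close> by (intro mult_right_mono mult_left_mono) auto
    ultimately have "t * (((\<Sum>i\<in>I. V i) + W) \<bullet> (b - a)) \<le> t * (\<phi> b - \<phi> a + \<rho> * (norm (b - a))\<^sup>2 + \<eta>)"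
      by (simp add: algebra_simps)
    then have "((\<Sum>i\<in>I. V i) + W) \<bullet> (b - a) \<le> \<phi> b - \<phi> a + \<rho> * (norm (b - a))\<^sup>2 + \<eta>"
      using t by simp
    then show False using B(6) by linarith
  qed
  then show False by simp
qed

section \<open>One epoch of proximal random reshuffling\<close>

lemma le_if_le_add_mult:
  fixes a b c :: real
  assumes "\<And>t. 0 < t \<Longrightarrow> t < 1 \<Longrightarrow> a \<le> b + t * c"
  shows "a \<le> b"
proof -
  have "((\<lambda>t. b + t * c) \<longlongrightarrow> b + 0 * c) (at_right 0)" by (intro tendsto_intros)
  moreover have "\<forall>\<^sub>F t in at_right 0. a \<le> b + t * c"
    unfolding eventually_at_right_field by (intro exI[of _ 1]) (auto intro: assms)
  ultimately have "a \<le> b + 0 * c" by (rule tendsto_lowerbound) simp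
  then show ?thesis by simp
qed

lemma locally_lipschitz_on_compact:
  assumes "locally_lipschitz_on S f" "compact K" "K \<subseteq> S"
  obtains L where "L-lipschitz_on K f"
proof -
  have "local_lipschitz {0::real} K (\<lambda>_. f)"
    using assms(1,3) local_lipschitz_subset[OF _ order_refl] unfolding locally_lipschitz_on_def by blast
  then obtain L where "\<And>t. t \<in> {0::real} \<Longrightarrow> L-lipschitz_on K f"
    by (rule local_lipschitz_compact_implies_lipschitz[OF _ assms(2)]) (auto intro: continuous_intros)
  then show thesis using that by blast
qed

lemma locally_bounded_compact:
  assumes D: "locally_bounded D" and K: "compact K"
  shows "bounded (\<Union>x\<in>K. D x)"
proof -
  obtain U where U: "\<And>x. open (U x)" "\<And>x. x \<in> U x" "\<And>x. bounded (\<Union>y\<in>U x. D y)"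
    using D unfolding locally_bounded_def by metis
  have "K \<subseteq> \<Union>(U ` K)" using U(2) by blast
  then obtain F where F: "F \<subseteq> K" "finite F" "K \<subseteq> \<Union>(U ` F)"
    using compactE_image[OF K, of K U] U(1) by metis
  have "bounded (\<Union>x\<in>F. \<Union>y\<in>U x. D y)" using F U(3) by (intro bounded_UN) auto
  then show ?thesis by (rule bounded_subset) (use F(3) in blast)
qed

lemma edom_real:
  assumes "proper_fun h" "x \<in> edom h"
  shows "h x = ereal (real_of_ereal (h x))"
  using assms by (cases "h x") (auto simp: proper_fun_def edom_def)

text \<open>Only the value \<open>-\<infinity>\<close> is excluded, so that this applies to
  \<open>g\<close> as well as to \<open>\<Phi>\<close> plus its quadratic.\<close>

lemma convex_fun_edom:
  assumes nm: "\<And>x. h x \<noteq> -\<infinity>" and cv: "convex_fun h" and xy: "x \<in> edom h" "y \<in> edom h" and t: "0 \<le> t" "t \<le> 1"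
  shows "x + t *\<^sub>R (y - x) \<in> edom h"
    and "real_of_ereal (h (x + t *\<^sub>R (y - x))) \<le> (1 - t) * real_of_ereal (h x) + t * real_of_ereal (h y)"
proof -
  have r: "h z = ereal (real_of_ereal (h z))" if "z \<in> edom h" for z
    using that nm[of z] by (cases "h z") (auto simp: edom_def)
  have "(x, real_of_ereal (h x)) \<in> epi h" "(y, real_of_ereal (h y)) \<in> epi h"
    using r xy by (auto simp: epi_def)
  then have "(1 - t) *\<^sub>R (x, real_of_ereal (h x)) + t *\<^sub>R (y, real_of_ereal (h y)) \<in> epi h"
    using cv t unfolding convex_fun_def convex_alt by blast
  moreover have "(1 - t) *\<^sub>R x + t *\<^sub>R y = x + t *\<^sub>R (y - x)" by (simp add: algebra_simps)
  ultimately have *: "h (x + t *\<^sub>R (y - x)) \<le> ereal ((1 - t) * real_of_ereal (h x) + t * real_of_ereal (h y))"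
    by (simp add: epi_def)
  then show "x + t *\<^sub>R (y - x) \<in> edom h" by (auto simp: edom_def intro: le_less_trans)
  show "real_of_ereal (h (x + t *\<^sub>R (y - x))) \<le> (1 - t) * real_of_ereal (h x) + t * real_of_ereal (h y)"
    using * nm[of "x + t *\<^sub>R (y - x)"] by (cases "h (x + t *\<^sub>R (y - x))") auto
qed

lemma sq_norm_add:
  fixes a b :: "'a::real_inner"
  shows "(norm (a + b))\<^sup>2 = (norm a)\<^sup>2 + 2 * (a \<bullet> b) + (norm b)\<^sup>2"
  by (simp add: power2_norm_eq_inner inner_add_left inner_add_right inner_commute)

lemma prox_real:
  fixes g :: "'a::euclidean_space \<Rightarrow> ereal"
  assumes g: "proper_fun g" and a: "a > 0" and p: "p \<in> prox (\<lambda>y. ereal a * g y) u"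
  shows "p \<in> edom g"
    and "\<And>y. y \<in> edom g \<Longrightarrow> a * real_of_ereal (g p) + (norm (p - u))\<^sup>2 / 2 \<le> a * real_of_ereal (g y) + (norm (y - u))\<^sup>2 / 2"
proof -
  have min: "ereal a * g p + ereal ((norm (p - u))\<^sup>2 / 2) \<le> ereal a * g y + ereal ((norm (y - u))\<^sup>2 / 2)" for y
    using p unfolding prox_def is_arg_min_def by (auto simp: not_less)
  obtain y where y: "g y \<noteq> \<infinity>" using g unfolding proper_fun_def by blast
  show pe: "p \<in> edom g"
  proof (rule ccontr)
    assume "p \<notin> edom g"
    then have "g p = \<infinity>" by (auto simp: edom_def)
    with min[of y] y a g show False
      by (cases "g y") (auto simp: proper_fun_def)
  qed
  fix y assume "y \<in> edom g"
  then show "a * real_of_ereal (g p) + (norm (p - u))\<^sup>2 / 2 \<le> a * real_of_ereal (g y) + (norm (y - u))\<^sup>2 / 2"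
    using min[of y] edom_real[OF g pe] edom_real[OF g, of y]
    by (metis ereal_less_eq(3) plus_ereal.simps(1) times_ereal.simps(1))
qed

text \<open>First-order optimality: moving from \<open>p\<close> to \<open>p + t (y - p)\<close>
  changes the quadratic by its linear part plus a term of order \<open>t^2\<close>, and convexity
  bounds the change of \<open>g\<close> by \<open>t (g y - g p)\<close>. Dividing by
  \<open>t\<close> and letting \<open>t\<close> tend to 0 leaves the subgradient inequality.\<close>

lemma prox_subgradient:
  fixes g :: "'a::euclidean_space \<Rightarrow> ereal"
  assumes g: "proper_fun g" "convex_fun g" and a: "a > 0" and p: "p \<in> prox (\<lambda>y. ereal a * g y) u"
    and y: "y \<in> edom g"
  shows "real_of_ereal (g p) + ((1 / a) *\<^sub>R (u - p)) \<bullet> (y - p) \<le> real_of_ereal (g y)"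
proof -
  define G where "G z = real_of_ereal (g z)" for z
  note pe = prox_real(1)[OF g(1) a p]
  have nm: "\<And>x. g x \<noteq> -\<infinity>" using g(1) by (auto simp: proper_fun_def)
  have "(u - p) \<bullet> (y - p) \<le> a * (G y - G p)"
  proof (rule le_if_le_add_mult)
    fix t :: real assume t: "0 < t" "t < 1"
    define q where "q = p + t *\<^sub>R (y - p)"
    have q: "q \<in> edom g" "G q \<le> (1 - t) * G p + t * G y"
      using convex_fun_edom[OF nm g(2) pe y, of t] t by (auto simp: q_def G_def)
    have "a * G p + (norm (p - u))\<^sup>2 / 2 \<le> a * G q + (norm (q - u))\<^sup>2 / 2"
      using prox_real(2)[OF g(1) a p q(1)] by (simp add: G_def)
    also have "a * G q \<le> a * ((1 - t) * G p + t * G y)" using q(2) a by simp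
    finally have 1: "a * G p + (norm (p - u))\<^sup>2 / 2 \<le> a * ((1 - t) * G p + t * G y) + (norm (q - u))\<^sup>2 / 2" by simp
    define X where "X = (p - u) \<bullet> (y - p)"
    have "q - u = (p - u) + t *\<^sub>R (y - p)" by (simp add: q_def)
    then have "(norm (q - u))\<^sup>2 = (norm (p - u))\<^sup>2 + 2 * (t * X) + t\<^sup>2 * (norm (y - p))\<^sup>2"
      unfolding X_def by (simp only: sq_norm_add norm_scaleR inner_scaleR_right power_mult_distrib power2_abs)
    moreover have "a * ((1 - t) * G p + t * G y) = a * G p + t * (a * (G y - G p))"
      by (simp add: algebra_simps)
    ultimately have "0 \<le> t * (a * (G y - G p)) + t * X + t\<^sup>2 * (norm (y - p))\<^sup>2 / 2"
      using 1 by linarith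
    also have "\<dots> = t * (a * (G y - G p) + X + t * ((norm (y - p))\<^sup>2 / 2))"
      by (simp add: power2_eq_square algebra_simps)
    finally have "0 \<le> t * (a * (G y - G p) + X + t * ((norm (y - p))\<^sup>2 / 2))" .
    then have "0 \<le> a * (G y - G p) + X + t * ((norm (y - p))\<^sup>2 / 2)"
      using t by (simp add: zero_le_mult_iff)
    then show "(u - p) \<bullet> (y - p) \<le> a * (G y - G p) + t * ((norm (y - p))\<^sup>2 / 2)"
      by (simp add: X_def inner_diff_left)
  qed
  then have "(1 / a) * ((u - p) \<bullet> (y - p)) \<le> G y - G p"
    using a by (simp add: pos_divide_le_eq mult.commute)
  then show ?thesis unfolding inner_scaleR_left G_def by linarith
qed

text \<open>The Lipschitz bound holds only within distance 1 of \<open>x\<close>, while nothing is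
  known beforehand about where \<open>p\<close> lies. Convexity closes the gap: a decrease of
  \<open>g\<close> from \<open>x\<close> to \<open>p\<close> at a rate above \<open>L\<close> would
  already show at distance 1. Comparing \<open>p\<close> with the competitor \<open>x\<close> then
  bounds \<open>d^2\<close> by a multiple of \<open>a * d\<close>.\<close>

lemma prox_displacement:
  fixes g :: "'a::euclidean_space \<Rightarrow> ereal"
  assumes g: "proper_fun g" "convex_fun g" and a: "a > 0" and p: "p \<in> prox (\<lambda>y. ereal a * g y) u"
    and x: "x \<in> edom g" and L: "L-lipschitz_on (edom g \<inter> cball x 1) (\<lambda>x. real_of_ereal (g x))"
    and u: "norm (x - u) \<le> a * B"
  shows "norm (p - x) \<le> 2 * (L + B) * a"
proof -
  define G where "G z = real_of_ereal (g z)" for z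
  note pe = prox_real(1)[OF g(1) a p]
  have nm: "\<And>x. g x \<noteq> -\<infinity>" using g(1) by (auto simp: proper_fun_def)
  define d where "d = norm (p - x)"
  have L0: "L \<ge> 0" using L lipschitz_on_nonneg by blast
  have near: "G x - G q \<le> L * norm (q - x)" if "q \<in> edom g" "norm (q - x) \<le> 1" for q
  proof -
    have "dist (G x) (G q) \<le> L * dist x q"
      unfolding G_def by (rule lipschitz_onD[OF L]) (use that x in \<open>auto simp: dist_norm norm_minus_commute\<close>)
    then show ?thesis by (simp add: dist_real_def dist_norm norm_minus_commute abs_le_iff)
  qed
  have Gp: "G x - G p \<le> L * d"
  proof (cases "d \<le> 1")
    case True
    then show ?thesis using near[OF pe] by (simp add: d_def)
  next
    case False
    then have d: "0 < 1 / d" "1 / d \<le> 1" by auto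
    define q where "q = x + (1 / d) *\<^sub>R (p - x)"
    have q: "q \<in> edom g" "G q \<le> (1 - 1 / d) * G x + (1 / d) * G p"
      using convex_fun_edom[OF nm g(2) x pe, of "1 / d"] d by (auto simp: q_def G_def)
    have "norm (q - x) = 1" using False by (auto simp: q_def d_def)
    then have "G x - G q \<le> L" using near[OF q(1)] by simp
    then have "(1 / d) * (G x - G p) \<le> L" using q(2) by (simp add: algebra_simps)
    then show ?thesis using False by (simp add: field_simps)
  qed
  have "a * G p + (norm (p - u))\<^sup>2 / 2 \<le> a * G x + (norm (x - u))\<^sup>2 / 2"
    using prox_real(2)[OF g(1) a p x] by (simp add: G_def)
  moreover have "(norm (p - u))\<^sup>2 = d\<^sup>2 + 2 * ((p - x) \<bullet> (x - u)) + (norm (x - u))\<^sup>2"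
    using sq_norm_add[of "p - x" "x - u"] by (simp add: d_def)
  ultimately have "d\<^sup>2 \<le> 2 * (a * G x) - 2 * (a * G p) - 2 * ((p - x) \<bullet> (x - u))" by linarith
  also have "\<dots> = 2 * (a * (G x - G p)) - 2 * ((p - x) \<bullet> (x - u))"
    by (simp add: right_diff_distrib)
  finally have 1: "d\<^sup>2 \<le> 2 * (a * (G x - G p)) - 2 * ((p - x) \<bullet> (x - u))" .
  have "- ((p - x) \<bullet> (x - u)) \<le> norm (p - x) * norm (x - u)"
    using Cauchy_Schwarz_ineq2[of "p - x" "x - u"] by linarith
  also have "\<dots> \<le> d * (a * B)" using u by (simp add: d_def mult_left_mono)
  finally have 2: "- ((p - x) \<bullet> (x - u)) \<le> d * (a * B)" .
  have "a * (G x - G p) \<le> a * (L * d)" using Gp a by simp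
  then have "d\<^sup>2 \<le> 2 * (a * (L * d)) + 2 * (d * (a * B))" using 1 2 by linarith
  then have "d * d \<le> (2 * (L + B) * a) * d" by (simp add: power2_eq_square algebra_simps)
  moreover have "0 \<le> 2 * (L + B) * a"
    using L0 u a norm_ge_zero[of "x - u"] by (smt (verit) mult_nonneg_nonneg zero_le_mult_iff)
  ultimately show ?thesis
    unfolding d_def[symmetric] by (cases "d > 0") auto
qed

text \<open>Indexing by component instead of by position makes the order \<open>\<sigma>\<close>
  disappear: each component is used exactly once, at some point close to the start of the epoch, and
  only this closeness matters afterwards.\<close>

lemma reshuffled_epoch:
  fixes z :: "nat \<Rightarrow> 'a::real_normed_vector"
  assumes \<sigma>: "\<sigma> permutes {1..N}" and a: "a \<ge> 0" and B: "B \<ge> 0" and small: "a * (real N * B) \<le> 1"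
    and z: "\<And>i. i \<in> {1..N} \<Longrightarrow> \<exists>v\<in>D (\<sigma> i) (z (i - 1)). z i = z (i - 1) - a *\<^sub>R v"
    and D: "\<And>i y v. i \<in> {1..N} \<Longrightarrow> dist y (z 0) \<le> 1 \<Longrightarrow> v \<in> D i y \<Longrightarrow> norm v \<le> B"
  obtains y v where "\<And>i. i \<in> {1..N} \<Longrightarrow> v i \<in> D i (y i) \<and> dist (y i) (z 0) \<le> a * (real N * B)"
    and "z N = z 0 - a *\<^sub>R (\<Sum>i\<in>{1..N}. v i)" and "norm (z 0 - z N) \<le> a * (real N * B)"
proof -
  obtain w where w: "\<And>i. i \<in> {1..N} \<Longrightarrow> w i \<in> D (\<sigma> i) (z (i - 1)) \<and> z i = z (i - 1) - a *\<^sub>R w i"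
    using z by metis
  have rad: "a * (real i * B) \<le> a * (real N * B)" if "i \<le> N" for i
    using that a B by (intro mult_left_mono mult_right_mono) auto
  \<comment> \<open>The bound \<open>B\<close> is known only within distance 1 of the start;
    \<open>small\<close> keeps the iterates there, and the induction confirms this one step at a
    time.\<close>
  have main: "z i = z 0 - a *\<^sub>R (\<Sum>j\<in>{1..i}. w j) \<and> dist (z i) (z 0) \<le> a * (real i * B)" if "i \<le> N" for i
    using that
  proof (induction i)
    case 0
    then show ?case by simp
  next
    case (Suc i)
    have wi: "w (Suc i) \<in> D (\<sigma> (Suc i)) (z i)" "z (Suc i) = z i - a *\<^sub>R w (Suc i)"
      using w[of "Suc i"] Suc.prems by auto
    have IH: "z i = z 0 - a *\<^sub>R (\<Sum>j\<in>{1..i}. w j)" "dist (z i) (z 0) \<le> a * (real i * B)" using Suc by auto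
    have "\<sigma> (Suc i) \<in> {1..N}" using permutes_in_image[OF \<sigma>, of "Suc i"] Suc.prems by simp
    then have "norm (w (Suc i)) \<le> B"
      by (rule D[OF _ _ wi(1)]) (use IH(2) rad[of i] small Suc.prems in linarith)
    then have "dist (z (Suc i)) (z i) \<le> a * B" using a wi(2) by (simp add: dist_norm mult_left_mono)
    then have "dist (z (Suc i)) (z 0) \<le> a * (real (Suc i) * B)"
      using IH(2) dist_triangle[of "z (Suc i)" "z 0" "z i"] by (simp add: algebra_simps)
    moreover have "z (Suc i) = z 0 - a *\<^sub>R (\<Sum>j\<in>{1..Suc i}. w j)"
      using wi(2) IH(1) by (simp add: algebra_simps)
    ultimately show ?case by blast
  qed
  \<comment> \<open>Component \<open>i\<close> is used in step \<open>\<tau> i\<close>, which starts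
    from the iterate with index \<open>\<tau> i - 1\<close>; \<open>\<tau> i\<close> is at least 1,
    so the subtraction of naturals is exact.\<close>
  define \<tau> where "\<tau> = inv \<sigma>"
  have \<tau>: "\<tau> permutes {1..N}" unfolding \<tau>_def by (rule permutes_inv[OF \<sigma>])
  have \<sigma>\<tau>: "\<sigma> (\<tau> i) = i" for i unfolding \<tau>_def by (rule permutes_inverses(1)[OF \<sigma>])
  show thesis
  proof (rule that[of "\<lambda>i. w (\<tau> i)" "\<lambda>i. z (\<tau> i - 1)"])
    fix i assume "i \<in> {1..N}"
    then have \<tau>i: "\<tau> i \<in> {1..N}" using permutes_in_image[OF \<tau>] by blast
    then have "\<tau> i - 1 \<le> N" by auto
    then have "dist (z (\<tau> i - 1)) (z 0) \<le> a * (real N * B)"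
      using main[of "\<tau> i - 1"] rad[of "\<tau> i - 1"] by linarith
    then show "w (\<tau> i) \<in> D i (z (\<tau> i - 1)) \<and> dist (z (\<tau> i - 1)) (z 0) \<le> a * (real N * B)"
      using w[OF \<tau>i] \<sigma>\<tau> by simp
  next
    have "(\<Sum>i\<in>{1..N}. w (\<tau> i)) = (\<Sum>i\<in>{1..N}. w i)"
      using sum.permute[OF \<tau>, of w] by (simp add: o_def)
    then show "z N = z 0 - a *\<^sub>R (\<Sum>i\<in>{1..N}. w (\<tau> i))" using main[of N] by simp
    show "norm (z 0 - z N) \<le> a * (real N * B)" using main[of N] by (metis dist_commute dist_norm order_refl)
  qed
qed

text \<open>An epoch is almost a backward step: \<open>x k - p = a (\<Sum>v + w)\<close>, where
  \<open>w\<close> is a subgradient of \<open>g\<close> at the new point \<open>p\<close> and each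
  \<open>v i\<close> is taken within order \<open>a\<close> of \<open>p\<close>. The approximate
  subgradient inequality at \<open>p\<close> therefore applies; replacing \<open>p\<close> by
  \<open>x k\<close> on its right-hand side costs a further error of order \<open>a\<close>,
  absorbed by \<open>\<eta>\<close>. \<open>M\<close> is chosen before \<open>\<eta>\<close>, so the
  speed bound does not deteriorate when the accuracy is increased.\<close>

lemma prr_step:
  fixes f :: "nat \<Rightarrow> 'a::euclidean_space \<Rightarrow> real" and g :: "'a \<Rightarrow> ereal"
  assumes reg: "\<And>i. i \<in> {1..N} \<Longrightarrow> subdiff_regular (f i)"
    and bd: "\<And>i. i \<in> {1..N} \<Longrightarrow> locally_bounded (D i)"
    and D: "\<And>i. i \<in> {1..N} \<Longrightarrow> D i = clarke_subdiff (\<lambda>x. ereal (f i x))"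
    and g: "proper_fun g" "convex_fun g" "closed (edom g)"
      "locally_lipschitz_on (edom g) (\<lambda>x. real_of_ereal (g x))"
    and \<phi>: "\<And>x. x \<in> edom g \<Longrightarrow> \<phi> x = (\<Sum>i\<in>{1..N}. f i x) + real_of_ereal (g x)"
    and wc: "\<And>x y t. x \<in> edom g \<Longrightarrow> y \<in> edom g \<Longrightarrow> 0 < t \<Longrightarrow> t < 1 \<Longrightarrow>
       \<phi> (x + t *\<^sub>R (y - x)) \<le> (1 - t) * \<phi> x + t * \<phi> y + \<rho> * t * (1 - t) * (norm (y - x))\<^sup>2"
    and \<rho>: "\<rho> \<ge> 0" and R: "R \<ge> 0"
    and lip: "\<And>R. \<exists>L. L-lipschitz_on (edom g \<inter> cball x0 R) \<phi>"
  shows "\<exists>M>0. \<forall>\<eta>>0. \<exists>b>0. \<forall>\<alpha> x k.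
       prr_sequence N D g \<alpha> x \<longrightarrow> 0 < \<alpha> k \<longrightarrow> \<alpha> k \<le> b \<longrightarrow> x k \<in> edom g \<inter> cball x0 R \<longrightarrow>
       x (Suc k) \<in> edom g \<and> norm (x (Suc k) - x k) \<le> M * \<alpha> k \<and>
       (\<forall>y\<in>edom g \<inter> cball x0 R. (norm (x (Suc k) - y))\<^sup>2 \<le>
          (norm (x k - y))\<^sup>2 + 2 * \<alpha> k * (\<phi> y - \<phi> (x k) + \<rho> * (norm (y - x k))\<^sup>2 + \<eta>))"
proof -
  define C where "C = edom g"
  define G where "G z = real_of_ereal (g z)" for z
  \<comment> \<open>One unit of slack beyond \<open>R\<close>: the bound on the step keeps inner
    iterates and the new point within distance 1 of \<open>x k\<close>.\<close>
  define K where "K = cball x0 (R + 1)"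
  have K: "compact K" by (simp add: K_def)
  have nm: "\<And>x. g x \<noteq> -\<infinity>" using g(1) by (auto simp: proper_fun_def)
  have convC: "convex C" unfolding C_def convex_alt
  proof (intro ballI allI impI)
    fix x y u assume "x \<in> edom g" "y \<in> edom g" "(0::real) \<le> u \<and> u \<le> 1"
    then have "x + u *\<^sub>R (y - x) \<in> edom g" by (intro convex_fun_edom(1)[OF nm g(2)]) auto
    then show "(1 - u) *\<^sub>R x + u *\<^sub>R y \<in> edom g" by (simp add: algebra_simps)
  qed
  have "compact (C \<inter> K)" using K g(3) by (auto simp: C_def intro: closed_Int_compact)
  then obtain L where L: "L-lipschitz_on (C \<inter> K) G"
    unfolding G_def by (rule locally_lipschitz_on_compact[OF g(4)]) (auto simp: C_def)
  have L0: "L \<ge> 0" using L lipschitz_on_nonneg by blast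
  obtain L' where L': "L'-lipschitz_on (C \<inter> K) \<phi>" using lip unfolding C_def K_def by blast
  have L'0: "L' \<ge> 0" using L' lipschitz_on_nonneg by blast
  have "bounded (\<Union>i\<in>{1..N}. \<Union>x\<in>K. D i x)"
    by (intro bounded_UN ballI locally_bounded_compact bd K) auto
  then obtain B where B0: "B > 0" and "\<And>v. v \<in> (\<Union>i\<in>{1..N}. \<Union>x\<in>K. D i x) \<Longrightarrow> norm v \<le> B"
    unfolding bounded_pos by blast
  then have B: "norm v \<le> B" if "i \<in> {1..N}" "y \<in> K" "v \<in> D i y" for i y v using that by blast
  define M where "M = 2 * (L + real N * B) + 1"
  have M: "M > 0" using L0 B0 by (simp add: M_def add_nonneg_pos)
  have NB: "real N * B \<ge> 0" using B0 by simp
  show ?thesis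
  proof (rule exI[of _ M], intro conjI M allI impI)
    fix \<eta> :: real assume \<eta>: "\<eta> > 0"
    then have \<eta>2: "\<eta> / 2 > 0" by simp
    have bd': "locally_bounded (clarke_subdiff (\<lambda>x. ereal (f i x)))" if "i \<in> {1..N}" for i
      using bd[OF that] D[OF that] by simp
    have "\<exists>r>0. \<forall>x\<in>K \<inter> C. \<forall>y\<in>K \<inter> C. \<forall>z v w.
       (\<forall>i\<in>{1..N}. dist (z i) x < r \<and> v i \<in> clarke_subdiff (\<lambda>x. ereal (f i x)) (z i)) \<longrightarrow>
       (\<forall>y\<in>C. G x + w \<bullet> (y - x) \<le> G y) \<longrightarrow>
       \<phi> x + ((\<Sum>i\<in>{1..N}. v i) + w) \<bullet> (y - x) - \<rho> * (norm (y - x))\<^sup>2 - \<eta> / 2 \<le> \<phi> y"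
      by (rule approx_subgradient_uniform[where f=f and I="{1..N}" and C=C and G=G and \<phi>=\<phi> and K=K and \<rho>=\<rho>])
         (rule finite_atLeastAtMost convC \<rho> K \<eta>2 | erule reg | erule bd' |
          erule \<phi>[folded C_def G_def] | erule (3) wc[folded C_def])+
    then obtain r where r: "r > 0" and appr: "\<forall>x\<in>K \<inter> C. \<forall>y\<in>K \<inter> C. \<forall>z v w.
       (\<forall>i\<in>{1..N}. dist (z i) x < r \<and> v i \<in> clarke_subdiff (\<lambda>x. ereal (f i x)) (z i)) \<longrightarrow>
       (\<forall>y\<in>C. G x + w \<bullet> (y - x) \<le> G y) \<longrightarrow>
       \<phi> x + ((\<Sum>i\<in>{1..N}. v i) + w) \<bullet> (y - x) - \<rho> * (norm (y - x))\<^sup>2 - \<eta> / 2 \<le> \<phi> y"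
      by (elim exE conjE) (rule that)
    \<comment> \<open>Per unit of step size, \<open>c1\<close> bounds the distance of the inner
      points from the new point, and \<open>c2\<close> the cost of replacing \<open>p\<close> by
      \<open>x k\<close>: \<open>L' * M\<close> in \<open>\<phi>\<close> and
      \<open>(4 * R + 4) * M\<close> in the squared distance to a test point. The \<open>+ 1\<close>
      makes \<open>c2\<close> positive.\<close>
    define c1 c2 where "c1 = real N * B + M" and "c2 = L' * M + \<rho> * (4 * R + 4) * M + 1"
    have c1: "c1 > 0" using NB M by (simp add: c1_def add_nonneg_pos)
    have c2: "c2 > 0" using L'0 M \<rho> R by (simp add: c2_def add_nonneg_pos)
    define b where "b = min (1 / c1) (min (r / (2 * c1)) (\<eta> / (2 * c2)))"
    have b: "b > 0" "b * c1 \<le> 1" "b * c1 < r" "b * c2 \<le> \<eta> / 2"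
    proof -
      show "b > 0" using c1 c2 r \<eta> by (simp add: b_def)
      have "b \<le> 1 / c1" "b \<le> r / (2 * c1)" "b \<le> \<eta> / (2 * c2)" by (auto simp: b_def)
      then have "b * c1 \<le> 1" "b * (2 * c1) \<le> r" "b * (2 * c2) \<le> \<eta>" using c1 c2 by (simp_all add: pos_le_divide_eq)
      then show "b * c1 \<le> 1" "b * c1 < r" "b * c2 \<le> \<eta> / 2" using r by auto
    qed
    show "\<exists>b>0. \<forall>\<alpha> x k.
       prr_sequence N D g \<alpha> x \<longrightarrow> 0 < \<alpha> k \<longrightarrow> \<alpha> k \<le> b \<longrightarrow> x k \<in> edom g \<inter> cball x0 R \<longrightarrow>
       x (Suc k) \<in> edom g \<and> norm (x (Suc k) - x k) \<le> M * \<alpha> k \<and>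
       (\<forall>y\<in>edom g \<inter> cball x0 R. (norm (x (Suc k) - y))\<^sup>2 \<le>
          (norm (x k - y))\<^sup>2 + 2 * \<alpha> k * (\<phi> y - \<phi> (x k) + \<rho> * (norm (y - x k))\<^sup>2 + \<eta>))"
    proof (rule exI[of _ b], intro conjI b(1) allI impI)
      fix \<alpha> x k
      assume prr: "prr_sequence N D g \<alpha> x" and a0: "0 < \<alpha> k" and ab: "\<alpha> k \<le> b" and xk: "x k \<in> edom g \<inter> cball x0 R"
      define a where "a = \<alpha> k"
      have a: "0 < a" "a \<le> b" using a0 ab by (auto simp: a_def)
      obtain \<sigma> z where \<sigma>: "\<sigma> permutes {1..N}" and z0: "z 0 = x k"
        and z: "\<And>i. i \<in> {1..N} \<Longrightarrow> \<exists>v\<in>D (\<sigma> i) (z (i - 1)). z i = z (i - 1) - a *\<^sub>R v"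
        and p: "x (Suc k) \<in> prox (\<lambda>y. ereal a * g y) (z N)"
        using prr unfolding prr_sequence_def a_def by blast
      define p where "p = x (Suc k)"
      note p = p[folded p_def]
      have ac: "a * c1 \<le> 1" "a * c1 < r" "a * c2 \<le> \<eta> / 2"
        using mult_right_mono[OF a(2), of c1] mult_right_mono[OF a(2), of c2] b c1 c2 by linarith+
      have small: "a * (real N * B) \<le> 1"
        using ac(1) a(1) M by (simp add: c1_def distrib_left) (smt (verit) mult_nonneg_nonneg)
      have inK: "y \<in> K" if "dist y (x k) \<le> 1" for y
        using that xk dist_triangle[of x0 y "x k"] by (simp add: K_def dist_commute)
      have DB: "norm v \<le> B" if "i \<in> {1..N}" "dist y (z 0) \<le> 1" "v \<in> D i y" for i y v
        using that B inK unfolding z0 by blast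
      obtain y v where yv: "\<And>i. i \<in> {1..N} \<Longrightarrow> v i \<in> D i (y i) \<and> dist (y i) (z 0) \<le> a * (real N * B)"
        and zN: "z N = z 0 - a *\<^sub>R (\<Sum>i\<in>{1..N}. v i)" and zd: "norm (z 0 - z N) \<le> a * (real N * B)"
      proof (rule reshuffled_epoch[where D=D and z=z and N=N and \<sigma>=\<sigma> and a=a and B=B,
            OF \<sigma> less_imp_le[OF a(1)] less_imp_le[OF B0] small])
        show "\<exists>v\<in>D (\<sigma> i) (z (i - 1)). z i = z (i - 1) - a *\<^sub>R v" if "i \<in> {1..N}" for i
          by (rule z[OF that])
        show "norm v \<le> B" if "i \<in> {1..N}" "dist y (z 0) \<le> 1" "v \<in> D i y" for i y v
          by (rule DB[OF that])
      qed (rule that)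
      note yv = yv[unfolded z0] and zN = zN[unfolded z0] and zd = zd[unfolded z0]
      have pC: "p \<in> C" unfolding C_def by (rule prox_real(1)[OF g(1) a(1) p])
      then show "x (Suc k) \<in> edom g" by (simp add: C_def p_def)
      have "L-lipschitz_on (edom g \<inter> cball (x k) 1) (\<lambda>x. real_of_ereal (g x))"
        by (rule lipschitz_on_subset[OF L[unfolded G_def]]) (auto simp: C_def intro: inK simp: dist_commute)
      from prox_displacement[OF g(1,2) a(1) p _ this zd] xk
      have "norm (p - x k) \<le> 2 * (L + real N * B) * a" by auto
      also have "\<dots> \<le> M * a" using a(1) by (intro mult_right_mono) (auto simp: M_def)
      finally have pd: "norm (p - x k) \<le> M * a" .
      then show "norm (x (Suc k) - x k) \<le> M * \<alpha> k" by (simp add: p_def a_def)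
      have Ma: "M * a \<le> 1" using ac(1) a(1) NB by (simp add: c1_def distrib_left mult.commute) (smt (verit) mult_nonneg_nonneg)
      have pK: "p \<in> K" by (rule inK) (use pd Ma in \<open>simp add: dist_norm\<close>)
      have xK: "x k \<in> K" "x k \<in> C" using inK[of "x k"] xk by (auto simp: C_def)
      define w where "w = (1 / a) *\<^sub>R (z N - p)"
      have wsub: "\<forall>y\<in>C. G p + w \<bullet> (y - p) \<le> G y"
        using prox_subgradient[OF g(1,2) a(1) p] by (auto simp: C_def G_def w_def)
      have near: "\<forall>i\<in>{1..N}. dist (y i) p < r \<and> v i \<in> clarke_subdiff (\<lambda>x. ereal (f i x)) (y i)"
      proof (intro ballI conjI)
        fix i assume i: "i \<in> {1..N}"
        have "dist (y i) p \<le> a * (real N * B) + M * a"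
          using yv[OF i] pd dist_triangle[of "y i" p "x k"] by (simp add: dist_norm norm_minus_commute)
        also have "\<dots> = a * c1" by (simp add: c1_def algebra_simps)
        finally show "dist (y i) p < r" using ac(2) by linarith
        show "v i \<in> clarke_subdiff (\<lambda>x. ereal (f i x)) (y i)" using yv[OF i] D[OF i] by simp
      qed
      have xp: "x k - p = a *\<^sub>R ((\<Sum>i\<in>{1..N}. v i) + w)"
        using a(1) by (simp add: w_def zN algebra_simps)
      show "\<forall>y\<in>edom g \<inter> cball x0 R. (norm (x (Suc k) - y))\<^sup>2 \<le>
          (norm (x k - y))\<^sup>2 + 2 * \<alpha> k * (\<phi> y - \<phi> (x k) + \<rho> * (norm (y - x k))\<^sup>2 + \<eta>)"
      proof
        fix y assume y: "y \<in> edom g \<inter> cball x0 R"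
        then have yK: "y \<in> K" "y \<in> C" by (auto simp: K_def C_def)
        have "\<phi> p + ((\<Sum>i\<in>{1..N}. v i) + w) \<bullet> (y - p) - \<rho> * (norm (y - p))\<^sup>2 - \<eta> / 2 \<le> \<phi> y"
          by (rule appr[THEN bspec, THEN bspec, THEN spec, THEN spec, THEN spec, THEN mp, THEN mp, OF _ _ near wsub])
             (use pK pC yK in auto)
        then have 1: "((\<Sum>i\<in>{1..N}. v i) + w) \<bullet> (y - p) \<le> \<phi> y - \<phi> p + \<rho> * (norm (y - p))\<^sup>2 + \<eta> / 2" by linarith
        have "dist (\<phi> (x k)) (\<phi> p) \<le> L' * dist (x k) p"
          by (rule lipschitz_onD[OF L']) (use xK pK pC in auto)
        also have "\<dots> \<le> L' * (M * a)" using pd L'0 by (intro mult_left_mono) (auto simp: dist_norm norm_minus_commute)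
        finally have 2: "- \<phi> p \<le> - \<phi> (x k) + L' * (M * a)" by (simp add: dist_real_def abs_le_iff)
        have nb: "norm (y - q) \<le> 2 * R + 2" if "q \<in> K" for q
          using that y dist_triangle[of y q x0] by (simp add: K_def dist_commute dist_norm[symmetric])
        have "norm (y - p) - norm (y - x k) \<le> M * a"
          using norm_triangle_ineq2[of "y - p" "y - x k"] pd by (simp add: norm_minus_commute)
        then have "(norm (y - p) - norm (y - x k)) * (norm (y - p) + norm (y - x k)) \<le> (M * a) * (norm (y - p) + norm (y - x k))"
          by (intro mult_right_mono) auto
        also have "\<dots> \<le> (M * a) * (4 * R + 4)"
          using nb[OF pK] nb[OF xK(1)] M a(1) by (intro mult_left_mono) auto
        finally have "(norm (y - p))\<^sup>2 \<le> (norm (y - x k))\<^sup>2 + (4 * R + 4) * (M * a)"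
          by (simp add: power2_eq_square algebra_simps)
        from mult_left_mono[OF this \<rho>]
        have 3: "\<rho> * (norm (y - p))\<^sup>2 \<le> \<rho> * (norm (y - x k))\<^sup>2 + \<rho> * (4 * R + 4) * M * a" by (simp add: algebra_simps)
        have "a * c2 = L' * (M * a) + \<rho> * (4 * R + 4) * M * a + a" by (simp add: c2_def algebra_simps)
        then have 4: "((\<Sum>i\<in>{1..N}. v i) + w) \<bullet> (y - p) \<le> \<phi> y - \<phi> (x k) + \<rho> * (norm (y - x k))\<^sup>2 + \<eta>"
          using 1 2 3 ac(3) a(1) by linarith
        have "(norm (x k - y))\<^sup>2 = (norm (x k - p))\<^sup>2 + 2 * ((x k - p) \<bullet> (p - y)) + (norm (p - y))\<^sup>2"
          using sq_norm_add[of "x k - p" "p - y"] by simp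
        \<comment> \<open>The square \<open>norm (x k - p)\<close> squared is dropped. It has the
          favourable sign because the inequality was used at the end point of the step.\<close>
        then have "(norm (p - y))\<^sup>2 \<le> (norm (x k - y))\<^sup>2 + 2 * ((x k - p) \<bullet> (y - p))"
          by (simp add: inner_diff_right)
        also have "(x k - p) \<bullet> (y - p) = a * (((\<Sum>i\<in>{1..N}. v i) + w) \<bullet> (y - p))"
          unfolding xp by simp
        also have "\<dots> \<le> a * (\<phi> y - \<phi> (x k) + \<rho> * (norm (y - x k))\<^sup>2 + \<eta>)"
          using 4 a(1) by (intro mult_left_mono) auto
        finally show "(norm (x (Suc k) - y))\<^sup>2 \<le>
          (norm (x k - y))\<^sup>2 + 2 * \<alpha> k * (\<phi> y - \<phi> (x k) + \<rho> * (norm (y - x k))\<^sup>2 + \<eta>)"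
          by (simp add: p_def a_def)
      qed
    qed
  qed
qed

section \<open>Approximate evolution variational inequalities\<close>

lemma discrete_gronwall:
  fixes u :: "nat \<Rightarrow> real"
  assumes "u 0 \<le> 0" and step: "\<And>j. j < n \<Longrightarrow> u (Suc j) \<le> (1 + a) * u j + b"
    and a: "a \<ge> 0" and b: "b \<ge> 0" and "j \<le> n"
  shows "u j \<le> exp (a * real j) * (real j * b)"
  using \<open>j \<le> n\<close>
proof (induction j)
  case 0
  then show ?case using assms(1) by simp
next
  case (Suc j)
  have "u (Suc j) \<le> (1 + a) * u j + b" using Suc.prems by (intro step) simp
  also have "\<dots> \<le> (1 + a) * (exp (a * real j) * (real j * b)) + b"
    using Suc a by (intro add_right_mono mult_left_mono) auto
  also have "\<dots> \<le> exp a * (exp (a * real j) * (real j * b)) + exp (a * real (Suc j)) * b"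
    using a b by (intro add_mono mult_right_mono exp_ge_add_one_self) (auto simp: mult_le_cancel_right1)
  also have "\<dots> = exp (a * real (Suc j)) * (real (Suc j) * b)"
    by (simp add: exp_add[symmetric] mult_exp_exp algebra_simps)
  finally show ?case .
qed

lemma le_if_le_add_divide:
  fixes a b c :: real
  assumes "\<And>n::nat. n \<ge> 1 \<Longrightarrow> a \<le> b + c / real n"
  shows "a \<le> b"
proof -
  have "(\<lambda>n. b + c / real n) \<longlonglongrightarrow> b + 0"
    by (rule tendsto_add[OF tendsto_const lim_const_over_n])
  then have "a \<le> b + 0"
    by (rule tendsto_lowerbound) (use assms in \<open>auto simp: eventually_sequentially\<close>)
  then show ?thesis by simp
qed

section \<open>Runs read as curves in elapsed time\<close>

definition elapsed :: "(nat \<Rightarrow> real) \<Rightarrow> nat \<Rightarrow> real" where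
  "elapsed \<alpha> n = (\<Sum>i<n. \<alpha> i)"

text \<open>Unspecified if the elapsed times all stay below \<open>t\<close>.\<close>

definition index_at :: "(nat \<Rightarrow> real) \<Rightarrow> real \<Rightarrow> nat" where
  "index_at \<alpha> t = (LEAST n. t \<le> elapsed \<alpha> n)"

lemma elapsed_0 [simp]: "elapsed \<alpha> 0 = 0"
  and elapsed_Suc [simp]: "elapsed \<alpha> (Suc n) = elapsed \<alpha> n + \<alpha> n"
  by (simp_all add: elapsed_def)

lemma elapsed_mono:
  assumes "\<And>k. 0 \<le> \<alpha> k" "k \<le> l"
  shows "elapsed \<alpha> k \<le> elapsed \<alpha> l"
  unfolding elapsed_def using assms by (intro sum_mono2) auto

text \<open>The index before \<open>index_at \<alpha> t\<close> still has elapsed time below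
  \<open>t\<close>, so the overshoot is at most one step. The bound by
  \<open>elapsed \<alpha> n\<close> guarantees that the least index exists.\<close>

lemma index_at:
  assumes \<alpha>: "\<And>k. 0 < \<alpha> k" "\<And>k. \<alpha> k \<le> b" and "0 \<le> t" "t \<le> elapsed \<alpha> n"
  shows "t \<le> elapsed \<alpha> (index_at \<alpha> t)" "elapsed \<alpha> (index_at \<alpha> t) \<le> t + b"
proof -
  show 1: "t \<le> elapsed \<alpha> (index_at \<alpha> t)"
    unfolding index_at_def by (rule LeastI) (rule assms(4))
  have b: "b > 0" using \<alpha>[of 0] by linarith
  show "elapsed \<alpha> (index_at \<alpha> t) \<le> t + b"
  proof (cases "index_at \<alpha> t")
    case 0
    then show ?thesis using \<open>0 \<le> t\<close> b by simp
  next
    case (Suc k)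
    then have "k < (LEAST n. t \<le> elapsed \<alpha> n)" unfolding index_at_def by simp
    then have "\<not> t \<le> elapsed \<alpha> k" by (rule not_less_Least)
    then show ?thesis using Suc \<alpha>(2)[of k] by simp
  qed
qed

lemma index_at_0 [simp]: "index_at \<alpha> 0 = 0"
  unfolding index_at_def by (intro Least_eq_0) simp

lemma index_at_mono:
  assumes "s \<le> t" "t \<le> elapsed \<alpha> n"
  shows "index_at \<alpha> s \<le> index_at \<alpha> t"
proof -
  have "t \<le> elapsed \<alpha> (index_at \<alpha> t)"
    unfolding index_at_def by (rule LeastI) (rule assms(2))
  then show ?thesis using assms(1) unfolding index_at_def[of \<alpha> s] by (intro Least_le) simp
qed

text \<open>The increments are dominated by a convergent series. The estimate by speed times
  remaining time later bridges the gap between the last comparison with the limit curve and the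
  limit of the run.\<close>

lemma steps_sum_converges:
  fixes x :: "nat \<Rightarrow> 'a::banach"
  assumes sums: "\<alpha> sums T" and M: "M \<ge> 0"
    and steps: "\<And>k. norm (x (Suc k) - x k) \<le> M * \<alpha> k"
  obtains y where "x \<longlonglongrightarrow> y" "\<And>k. norm (y - x k) \<le> M * (T - elapsed \<alpha> k)"
proof -
  have lim: "elapsed \<alpha> \<longlonglongrightarrow> T" using sums unfolding sums_def elapsed_def .
  have "summable (\<lambda>k. M * \<alpha> k)" using sums by (intro summable_mult) (rule sums_summable)
  then have "summable (\<lambda>k. x (Suc k) - x k)"
    by (rule summable_comparison_test') (rule steps)
  then have "convergent (\<lambda>n. \<Sum>k<n. x (Suc k) - x k)" by (rule summable_iff_convergent[THEN iffD1])
  then obtain l where "(\<lambda>n. \<Sum>k<n. x (Suc k) - x k) \<longlonglongrightarrow> l" unfolding convergent_def by blast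
  then have "(\<lambda>n. x n - x 0) \<longlonglongrightarrow> l" by (simp add: sum_lessThan_telescope)
  from tendsto_add[OF this tendsto_const[of "x 0"]] have y: "x \<longlonglongrightarrow> l + x 0" by simp
  have "norm (l + x 0 - x k) \<le> M * (T - elapsed \<alpha> k)" for k
  proof -
    have "norm (x j - x k) \<le> M * (elapsed \<alpha> j - elapsed \<alpha> k)" if "k \<le> j" for j
      using that
    proof (induction j rule: dec_induct)
      case (step j)
      have "norm (x (Suc j) - x k) \<le> norm (x (Suc j) - x j) + norm (x j - x k)"
        using norm_triangle_ineq[of "x (Suc j) - x j" "x j - x k"] by simp
      then show ?case using steps[of j] step.IH by (simp add: algebra_simps)
    qed simp
    then have ev: "\<forall>\<^sub>F j in sequentially. norm (x j - x k) \<le> M * (elapsed \<alpha> j - elapsed \<alpha> k)"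
      unfolding eventually_sequentially by blast
    show ?thesis
      by (rule tendsto_le[OF _ _ _ ev]) (auto intro!: tendsto_intros lim y)
  qed
  with y show thesis by (rule that)
qed

lemma sq_norm_diff_le:
  fixes a b :: "'a::real_inner"
  assumes "norm a \<le> c" "norm b \<le> c" "norm (a - b) \<le> d"
  shows "(norm a)\<^sup>2 \<le> (norm b)\<^sup>2 + 2 * c * d"
proof -
  have "norm a - norm b \<le> d" using norm_triangle_ineq2[of a b] assms(3) by linarith
  moreover have "d \<ge> 0" "c \<ge> 0" using assms norm_ge_zero by (meson order_trans)+
  ultimately have "(norm a - norm b) * (norm a + norm b) \<le> d * (2 * c)"
    using assms by (cases "norm a \<ge> norm b") (auto intro!: mult_mono intro: order_trans[OF mult_nonpos_nonneg])
  then show ?thesis by (simp add: power2_eq_square algebra_simps)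
qed

text \<open>From here on the algorithm is known only through the inequality for one step.
  \<open>step\<close> says nothing outside a given ball and its constants depend on that ball, so
  confinement of the runs has to be proved; \<open>M\<close> precedes \<open>\<eta>\<close> because
  the speed must be independent of the accuracy.\<close>

locale evi_runs =
  fixes C :: "'a::euclidean_space set" and \<phi> :: "'a \<Rightarrow> real" and \<rho> m :: real and x0 :: 'a
    and run :: "(nat \<Rightarrow> real) \<Rightarrow> (nat \<Rightarrow> 'a) \<Rightarrow> bool"
  assumes closed_C: "closed C" and x0_C: "x0 \<in> C" and rho: "\<rho> \<ge> 0"
    and lower: "\<And>x. x \<in> C \<Longrightarrow> m \<le> \<phi> x"
    and lip: "\<And>R. \<exists>L. L-lipschitz_on (C \<inter> cball x0 R) \<phi>"
    and run_0: "\<And>\<alpha> x. run \<alpha> x \<Longrightarrow> x 0 = x0"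
    and run_pos: "\<And>\<alpha> x k. run \<alpha> x \<Longrightarrow> 0 < \<alpha> k"
    and step: "\<And>R. R \<ge> 0 \<Longrightarrow> \<exists>M>0. \<forall>\<eta>>0. \<exists>b>0. \<forall>\<alpha> x k.
       run \<alpha> x \<longrightarrow> \<alpha> k \<le> b \<longrightarrow> x k \<in> C \<inter> cball x0 R \<longrightarrow>
       x (Suc k) \<in> C \<and> norm (x (Suc k) - x k) \<le> M * \<alpha> k \<and>
       (\<forall>y\<in>C \<inter> cball x0 R. (norm (x (Suc k) - y))\<^sup>2 \<le>
          (norm (x k - y))\<^sup>2 + 2 * \<alpha> k * (\<phi> y - \<phi> (x k) + \<rho> * (norm (y - x k))\<^sup>2 + \<eta>))"
begin

text \<open>Testing at \<open>y = x0\<close> and bounding \<open>\<phi>\<close> from below by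
  \<open>m\<close> gives a Gronwall inequality for the squared distance to \<open>x0\<close> that
  does not contain \<open>M\<close>. Hence \<open>R\<close> is computed from \<open>T\<close> alone,
  and only then is \<open>step\<close> invoked with radius \<open>R + 1\<close>; this avoids a
  circular choice of constants.\<close>

lemma confined:
  assumes T: "T \<ge> 0"
  shows "\<exists>R\<ge>0. \<exists>M>0. \<forall>\<eta>>0. \<exists>b>0. \<forall>\<alpha> x. run \<alpha> x \<longrightarrow> (\<forall>k. \<alpha> k \<le> b) \<longrightarrow>
    (\<forall>k. elapsed \<alpha> k \<le> T \<longrightarrow> x k \<in> C \<inter> cball x0 R \<and> norm (x (Suc k) - x k) \<le> M * \<alpha> k \<and>
       (\<forall>y\<in>C \<inter> cball x0 (R + 1). (norm (x (Suc k) - y))\<^sup>2 \<le>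
          (norm (x k - y))\<^sup>2 + 2 * \<alpha> k * (\<phi> y - \<phi> (x k) + \<rho> * (norm (y - x k))\<^sup>2 + \<eta>)))"
proof -
  \<comment> \<open>The \<open>+ 1\<close> absorbs the error term, capped at 1 by
    \<open>min \<eta> 1\<close>, so that \<open>R\<close> is fixed before
    \<open>\<eta>\<close>.\<close>
  define c where "c = \<phi> x0 - m + 1"
  have c: "c \<ge> 1" using lower[OF x0_C] by (simp add: c_def)
  define U where "U t = exp (2 * \<rho> * t) * (2 * c * t)" for t
  define R where "R = sqrt (U T)"
  have U_mono: "U s \<le> U t" if "0 \<le> s" "s \<le> t" for s t
    unfolding U_def using that c rho by (intro mult_mono) (auto intro: mult_left_mono)
  have R: "R \<ge> 0" using U_mono[of 0 T] T by (simp add: R_def U_def)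
  obtain M where M: "M > 0" and st: "\<forall>\<eta>>0. \<exists>b>0. \<forall>\<alpha> x k.
       run \<alpha> x \<longrightarrow> \<alpha> k \<le> b \<longrightarrow> x k \<in> C \<inter> cball x0 (R + 1) \<longrightarrow>
       x (Suc k) \<in> C \<and> norm (x (Suc k) - x k) \<le> M * \<alpha> k \<and>
       (\<forall>y\<in>C \<inter> cball x0 (R + 1). (norm (x (Suc k) - y))\<^sup>2 \<le>
          (norm (x k - y))\<^sup>2 + 2 * \<alpha> k * (\<phi> y - \<phi> (x k) + \<rho> * (norm (y - x k))\<^sup>2 + \<eta>))"
    using step[of "R + 1"] R by auto
  show ?thesis
  proof (rule exI[of _ R], intro conjI R, rule exI[of _ M], intro conjI M allI impI)
    fix \<eta> :: real assume \<eta>: "\<eta> > 0"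
    have \<eta>1: "min \<eta> 1 > 0" using \<eta> by simp
    from st[rule_format, OF \<eta>1] obtain b where b: "b > 0" and bb: "\<And>\<alpha> x k.
       run \<alpha> x \<Longrightarrow> \<alpha> k \<le> b \<Longrightarrow> x k \<in> C \<inter> cball x0 (R + 1) \<Longrightarrow>
       x (Suc k) \<in> C \<and> norm (x (Suc k) - x k) \<le> M * \<alpha> k \<and>
       (\<forall>y\<in>C \<inter> cball x0 (R + 1). (norm (x (Suc k) - y))\<^sup>2 \<le>
          (norm (x k - y))\<^sup>2 + 2 * \<alpha> k * (\<phi> y - \<phi> (x k) + \<rho> * (norm (y - x k))\<^sup>2 + min \<eta> 1))"
      by blast
    show "\<exists>b>0. \<forall>\<alpha> x. run \<alpha> x \<longrightarrow> (\<forall>k. \<alpha> k \<le> b) \<longrightarrow>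
    (\<forall>k. elapsed \<alpha> k \<le> T \<longrightarrow> x k \<in> C \<inter> cball x0 R \<and> norm (x (Suc k) - x k) \<le> M * \<alpha> k \<and>
       (\<forall>y\<in>C \<inter> cball x0 (R + 1). (norm (x (Suc k) - y))\<^sup>2 \<le>
          (norm (x k - y))\<^sup>2 + 2 * \<alpha> k * (\<phi> y - \<phi> (x k) + \<rho> * (norm (y - x k))\<^sup>2 + \<eta>)))"
    proof (intro exI[of _ b] conjI b allI impI)
      fix \<alpha> x k assume run: "run \<alpha> x" and \<alpha>b: "\<forall>k. \<alpha> k \<le> b" and "elapsed \<alpha> k \<le> T"
      note pos = run_pos[OF run]
      have el0: "elapsed \<alpha> j \<ge> 0" for j
        using elapsed_mono[of \<alpha> 0 j] pos by (simp add: less_imp_le)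
      have cb: "x j \<in> C \<inter> cball x0 R" if "x j \<in> C" "(norm (x j - x0))\<^sup>2 \<le> U (elapsed \<alpha> j)" "elapsed \<alpha> j \<le> T" for j
      proof -
        have "(norm (x j - x0))\<^sup>2 \<le> U T"
          using U_mono[OF el0 that(3)] that(2) by linarith
        then have "norm (x j - x0) \<le> R" unfolding R_def by (rule real_le_rsqrt)
        then show ?thesis using that(1) by (simp add: dist_norm norm_minus_commute)
      qed
      have main: "x j \<in> C \<and> (norm (x j - x0))\<^sup>2 \<le> U (elapsed \<alpha> j)" if "elapsed \<alpha> j \<le> T" for j
        using that
      proof (induction j)
        case 0
        then show ?case using run_0[OF run] x0_C by (simp add: U_def)
      next
        case (Suc j)
        have jT: "elapsed \<alpha> j \<le> T" using Suc.prems pos[of j] by simp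
        have xj: "x j \<in> C \<inter> cball x0 R" using cb jT Suc.IH by blast
        then have xj1: "x j \<in> C \<inter> cball x0 (R + 1)" by auto
        have x01: "x0 \<in> C \<inter> cball x0 (R + 1)" using x0_C R by simp
        from bb[OF run \<alpha>b[rule_format] xj1] x01
        have xs: "x (Suc j) \<in> C" and "(norm (x (Suc j) - x0))\<^sup>2 \<le>
          (norm (x j - x0))\<^sup>2 + 2 * \<alpha> j * (\<phi> x0 - \<phi> (x j) + \<rho> * (norm (x0 - x j))\<^sup>2 + min \<eta> 1)" by blast+
        note this(2)
        also have "(norm (x j - x0))\<^sup>2 + 2 * \<alpha> j * (\<phi> x0 - \<phi> (x j) + \<rho> * (norm (x0 - x j))\<^sup>2 + min \<eta> 1)
          \<le> (norm (x j - x0))\<^sup>2 + 2 * \<alpha> j * (c + \<rho> * (norm (x j - x0))\<^sup>2)"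
          using lower[of "x j"] xj pos[of j] by (intro add_left_mono mult_left_mono) (auto simp: c_def norm_minus_commute)
        also have "\<dots> = (1 + 2 * \<rho> * \<alpha> j) * (norm (x j - x0))\<^sup>2 + 1 * (2 * c * \<alpha> j)"
          by (simp add: algebra_simps)
        also have "\<dots> \<le> exp (2 * \<rho> * \<alpha> j) * U (elapsed \<alpha> j) + exp (2 * \<rho> * elapsed \<alpha> (Suc j)) * (2 * c * \<alpha> j)"
        proof (intro add_mono mult_mono exp_ge_add_one_self)
          show "1 \<le> exp (2 * \<rho> * elapsed \<alpha> (Suc j))" using rho el0[of "Suc j"] by simp
        qed (use Suc.IH[OF jT] c pos[of j] in auto)
        also have "\<dots> = U (elapsed \<alpha> (Suc j))"
          by (simp add: U_def exp_add[symmetric] mult_exp_exp algebra_simps)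
        finally show ?case using xs by simp
      qed
      have kk: "x k \<in> C \<inter> cball x0 R" using cb main \<open>elapsed \<alpha> k \<le> T\<close> by blast
      then show "x k \<in> C \<inter> cball x0 R" .
      from kk have k1: "x k \<in> C \<inter> cball x0 (R + 1)" by auto
      note B = bb[OF run \<alpha>b[rule_format] k1]
      show "norm (x (Suc k) - x k) \<le> M * \<alpha> k" using B by blast
      show "\<forall>y\<in>C \<inter> cball x0 (R + 1). (norm (x (Suc k) - y))\<^sup>2 \<le>
          (norm (x k - y))\<^sup>2 + 2 * \<alpha> k * (\<phi> y - \<phi> (x k) + \<rho> * (norm (y - x k))\<^sup>2 + \<eta>)"
      proof
        fix y assume "y \<in> C \<inter> cball x0 (R + 1)"
        then have "(norm (x (Suc k) - y))\<^sup>2 \<le>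
          (norm (x k - y))\<^sup>2 + 2 * \<alpha> k * (\<phi> y - \<phi> (x k) + \<rho> * (norm (y - x k))\<^sup>2 + min \<eta> 1)" using B by blast
        also have "\<dots> \<le> (norm (x k - y))\<^sup>2 + 2 * \<alpha> k * (\<phi> y - \<phi> (x k) + \<rho> * (norm (y - x k))\<^sup>2 + \<eta>)"
          using pos[of k] by (intro add_left_mono mult_left_mono) auto
        finally show "(norm (x (Suc k) - y))\<^sup>2 \<le>
          (norm (x k - y))\<^sup>2 + 2 * \<alpha> k * (\<phi> y - \<phi> (x k) + \<rho> * (norm (y - x k))\<^sup>2 + \<eta>)" .
      qed
    qed
  qed
qed

text \<open>The inequality between two arbitrary times, in a form that also fits discontinuous step
  curves. \<open>\<beta>\<close> absorbs jumps and rounding and vanishes in the limit;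
  \<open>A * (t - s)\<close> is the price of evaluating \<open>\<phi>\<close> at the left end only
  and remains in the limit. Test points reach up to \<open>R + 1\<close> because the curve will be
  compared with points within distance 1 of it.\<close>

definition evi_curve :: "real \<Rightarrow> real \<Rightarrow> real \<Rightarrow> real \<Rightarrow> real \<Rightarrow> (real \<Rightarrow> 'a) \<Rightarrow> bool" where
  "evi_curve R M A T \<beta> X \<longleftrightarrow> X 0 = x0 \<and> (\<forall>t\<in>{0..T}. X t \<in> C \<inter> cball x0 R) \<and>
     (\<forall>s t. 0 \<le> s \<longrightarrow> s \<le> t \<longrightarrow> t \<le> T \<longrightarrow> norm (X t - X s) \<le> M * (t - s) + \<beta> \<and>
        (\<forall>y\<in>C \<inter> cball x0 (R + 1). (norm (X t - y))\<^sup>2 \<le> (norm (X s - y))\<^sup>2 +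
           2 * (t - s) * (\<phi> y - \<phi> (X s) + \<rho> * (norm (y - X s))\<^sup>2 + A * (t - s)) + \<beta>))"

lemma evi_curveD:
  assumes "evi_curve R M A T \<beta> X"
  shows "X 0 = x0"
    and "0 \<le> t \<Longrightarrow> t \<le> T \<Longrightarrow> X t \<in> C"
    and "0 \<le> t \<Longrightarrow> t \<le> T \<Longrightarrow> X t \<in> cball x0 R"
    and "0 \<le> s \<Longrightarrow> s \<le> t \<Longrightarrow> t \<le> T \<Longrightarrow> norm (X t - X s) \<le> M * (t - s) + \<beta>"
    and "0 \<le> s \<Longrightarrow> s \<le> t \<Longrightarrow> t \<le> T \<Longrightarrow> y \<in> C \<Longrightarrow> y \<in> cball x0 (R + 1) \<Longrightarrow>
        (norm (X t - y))\<^sup>2 \<le> (norm (X s - y))\<^sup>2 +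
           2 * (t - s) * (\<phi> y - \<phi> (X s) + \<rho> * (norm (y - X s))\<^sup>2 + A * (t - s)) + \<beta>"
  using assms unfolding evi_curve_def by auto

text \<open>The inequalities for single steps telescope once their brackets are evaluated at the
  common index \<open>k\<close>. The speed bound makes this replacement cost at most
  \<open>L * M + \<rho> * (4 * R + 2) * M\<close> per unit of elapsed time, where
  \<open>4 * R + 2\<close> is twice a bound on the distance between \<open>y\<close> and an
  iterate.\<close>

lemma evi_iterate:
  assumes pos: "\<And>k. 0 < \<alpha> k" and "R \<ge> 0" and "M \<ge> 0" and L: "L-lipschitz_on (C \<inter> cball x0 R) \<phi>"
    and cb: "\<And>k. elapsed \<alpha> k \<le> T \<Longrightarrow> x k \<in> C \<inter> cball x0 R"
    and M: "\<And>k. elapsed \<alpha> k \<le> T \<Longrightarrow> norm (x (Suc k) - x k) \<le> M * \<alpha> k"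
    and evi: "\<And>k. elapsed \<alpha> k \<le> T \<Longrightarrow> (norm (x (Suc k) - y))\<^sup>2 \<le>
          (norm (x k - y))\<^sup>2 + 2 * \<alpha> k * (\<phi> y - \<phi> (x k) + \<rho> * (norm (y - x k))\<^sup>2 + \<eta>)"
    and y: "y \<in> C \<inter> cball x0 (R + 1)" and kl: "k \<le> l" "elapsed \<alpha> l \<le> T"
  shows "norm (x l - x k) \<le> M * (elapsed \<alpha> l - elapsed \<alpha> k)"
    and "(norm (x l - y))\<^sup>2 \<le> (norm (x k - y))\<^sup>2 + 2 * (elapsed \<alpha> l - elapsed \<alpha> k) *
      (\<phi> y - \<phi> (x k) + \<rho> * (norm (y - x k))\<^sup>2 + \<eta> +
       (L * M + \<rho> * (4 * R + 2) * M) * (elapsed \<alpha> l - elapsed \<alpha> k))"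
proof -
  have mono: "elapsed \<alpha> i \<le> elapsed \<alpha> j" if "i \<le> j" for i j
    using elapsed_mono[of \<alpha> i j] pos that by (simp add: less_imp_le)
  have 1: "norm (x j - x k) \<le> M * (elapsed \<alpha> j - elapsed \<alpha> k)" if "k \<le> j" "elapsed \<alpha> j \<le> T" for j
    using that
  proof (induction j rule: dec_induct)
    case base
    show ?case by simp
  next
    case (step j)
    have jT: "elapsed \<alpha> j \<le> T" using step.prems pos[of j] by simp
    have "norm (x (Suc j) - x k) \<le> norm (x (Suc j) - x j) + norm (x j - x k)"
      using norm_triangle_ineq[of "x (Suc j) - x j" "x j - x k"] by simp
    then show ?case using M[OF jT] step.IH[OF jT] by (simp add: algebra_simps)
  qed
  then show "norm (x l - x k) \<le> M * (elapsed \<alpha> l - elapsed \<alpha> k)" using kl by blast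
  define s where "s = elapsed \<alpha> l - elapsed \<alpha> k"
  define c where "c = \<phi> y - \<phi> (x k) + \<rho> * (norm (y - x k))\<^sup>2 + \<eta> + (L * M + \<rho> * (4 * R + 2) * M) * s"
  have "L \<ge> 0" using L lipschitz_on_nonneg by blast
  have "(norm (x j - y))\<^sup>2 \<le> (norm (x k - y))\<^sup>2 + 2 * (elapsed \<alpha> j - elapsed \<alpha> k) * c"
    if "k \<le> j" "j \<le> l" for j
    using that
  proof (induction j rule: dec_induct)
    case base
    show ?case by simp
  next
    case (step j)
    have jl: "j \<le> l" and jT: "elapsed \<alpha> j \<le> T" using step.prems kl mono[of j l] by auto
    have kT: "elapsed \<alpha> k \<le> T" using jT mono[OF step.hyps(1)] by linarith
    have d: "norm (x j - x k) \<le> M * s"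
    proof -
      have "norm (x j - x k) \<le> M * (elapsed \<alpha> j - elapsed \<alpha> k)" using 1[OF step.hyps(1) jT] .
      also have "\<dots> \<le> M * s" using mono[OF jl] \<open>M \<ge> 0\<close> by (intro mult_left_mono) (auto simp: s_def)
      finally show ?thesis .
    qed
    have "dist (\<phi> (x k)) (\<phi> (x j)) \<le> L * dist (x k) (x j)"
      by (rule lipschitz_onD[OF L]) (use cb[OF kT] cb[OF jT] in auto)
    also have "\<dots> \<le> L * (M * s)" using d \<open>L \<ge> 0\<close> by (intro mult_left_mono) (auto simp: dist_norm norm_minus_commute)
    finally have 2: "- \<phi> (x j) \<le> - \<phi> (x k) + L * M * s" by (simp add: dist_real_def abs_le_iff)
    have nb: "norm (y - x i) \<le> 2 * R + 1" if "elapsed \<alpha> i \<le> T" for i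
    proof -
      have "dist x0 (x i) \<le> R" "dist x0 y \<le> R + 1" using cb[OF that] y by auto
      moreover have "dist y (x i) \<le> dist x0 y + dist x0 (x i)"
        by (metis dist_commute dist_triangle)
      ultimately show ?thesis unfolding dist_norm by linarith
    qed
    have "(norm (y - x j))\<^sup>2 \<le> (norm (y - x k))\<^sup>2 + 2 * (2 * R + 1) * (M * s)"
      by (rule sq_norm_diff_le[OF nb[OF jT] nb[OF kT]]) (use d in \<open>simp add: norm_minus_commute\<close>)
    from mult_left_mono[OF this rho]
    have 3: "\<rho> * (norm (y - x j))\<^sup>2 \<le> \<rho> * (norm (y - x k))\<^sup>2 + \<rho> * (4 * R + 2) * M * s"
      by (simp add: algebra_simps)
    have "\<phi> y - \<phi> (x j) + \<rho> * (norm (y - x j))\<^sup>2 + \<eta> \<le> c"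
      using 2 3 by (simp add: c_def distrib_right)
    then have "2 * \<alpha> j * (\<phi> y - \<phi> (x j) + \<rho> * (norm (y - x j))\<^sup>2 + \<eta>) \<le> 2 * \<alpha> j * c"
      using pos[of j] by (intro mult_left_mono) auto
    then show ?case using evi[OF jT] step.IH[OF jl] by (simp add: algebra_simps)
  qed
  then show "(norm (x l - y))\<^sup>2 \<le> (norm (x k - y))\<^sup>2 + 2 * (elapsed \<alpha> l - elapsed \<alpha> k) *
      (\<phi> y - \<phi> (x k) + \<rho> * (norm (y - x k))\<^sup>2 + \<eta> +
       (L * M + \<rho> * (4 * R + 2) * M) * (elapsed \<alpha> l - elapsed \<alpha> k))"
    using kl by (simp add: c_def s_def)
qed

text \<open>Passing from indices to times changes the length of an interval by at most the largest
  step, and the rest is rounding. \<open>R\<close>, \<open>M\<close> and \<open>A\<close> come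
  before \<open>\<beta>\<close>, since the comparison of two curves chooses \<open>\<beta>\<close>
  in terms of them.\<close>

lemma run_evi_curve:
  assumes T: "T \<ge> 0"
  shows "\<exists>R\<ge>0. \<exists>M>0. \<exists>A\<ge>0. \<forall>\<beta>>0. \<exists>b>0. \<forall>\<alpha> x. run \<alpha> x \<longrightarrow> (\<forall>k. \<alpha> k \<le> b) \<longrightarrow>
    (\<forall>k. elapsed \<alpha> k \<le> T \<longrightarrow> norm (x (Suc k) - x k) \<le> M * \<alpha> k) \<and>
    (\<forall>n. T \<le> elapsed \<alpha> n \<longrightarrow> evi_curve R M A T \<beta> (\<lambda>t. x (index_at \<alpha> t)))"
proof -
  \<comment> \<open>The index chosen for time \<open>T\<close> may overshoot by up to one step,
    hence control up to \<open>T + 1\<close>.\<close>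
  have "T + 1 \<ge> 0" using T by simp
  from confined[OF this] obtain R M where R: "R \<ge> 0" and M: "M > 0" and conf: "\<And>\<eta>. \<eta> > 0 \<Longrightarrow> \<exists>b>0. \<forall>\<alpha> x. run \<alpha> x \<longrightarrow> (\<forall>k. \<alpha> k \<le> b) \<longrightarrow>
    (\<forall>k. elapsed \<alpha> k \<le> T + 1 \<longrightarrow> x k \<in> C \<inter> cball x0 R \<and> norm (x (Suc k) - x k) \<le> M * \<alpha> k \<and>
       (\<forall>y\<in>C \<inter> cball x0 (R + 1). (norm (x (Suc k) - y))\<^sup>2 \<le>
          (norm (x k - y))\<^sup>2 + 2 * \<alpha> k * (\<phi> y - \<phi> (x k) + \<rho> * (norm (y - x k))\<^sup>2 + \<eta>)))"
    by blast
  obtain L where L: "L-lipschitz_on (C \<inter> cball x0 (R + 1)) \<phi>" using lip by blast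
  have L0: "L \<ge> 0" using L lipschitz_on_nonneg by blast
  have LR: "L-lipschitz_on (C \<inter> cball x0 R) \<phi>" by (rule lipschitz_on_subset[OF L]) auto
  define A where "A = L * M + \<rho> * (4 * R + 2) * M"
  have A: "A \<ge> 0" using L0 M R rho by (simp add: A_def)
  \<comment> \<open>\<open>Q\<close> bounds the bracket \<open>P\<close> below for every test point;
    it is multiplied by the rounding error of the interval length.\<close>
  define Q where "Q = L * (2 * R + 1) + \<rho> * (2 * R + 1)\<^sup>2"
  have Q: "Q \<ge> 0" using L0 R rho by (simp add: Q_def)
  show ?thesis
  proof (rule exI[of _ R], intro conjI R, rule exI[of _ M], intro conjI M, rule exI[of _ A], intro conjI A allI impI)
    fix \<beta> :: real assume \<beta>: "\<beta> > 0"
    define \<eta> where "\<eta> = \<beta> / (4 * (T + 1))"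
    have \<eta>: "\<eta> > 0" "2 * (T + 1) * \<eta> = \<beta> / 2" using \<beta> T by (auto simp: \<eta>_def field_simps)
    from conf[OF \<eta>(1)] obtain b0 where b0: "b0 > 0" and run_b0: "\<And>\<alpha> x k. run \<alpha> x \<Longrightarrow> (\<forall>k. \<alpha> k \<le> b0) \<Longrightarrow> elapsed \<alpha> k \<le> T + 1 \<Longrightarrow>
       x k \<in> C \<inter> cball x0 R \<and> norm (x (Suc k) - x k) \<le> M * \<alpha> k \<and>
       (\<forall>y\<in>C \<inter> cball x0 (R + 1). (norm (x (Suc k) - y))\<^sup>2 \<le>
          (norm (x k - y))\<^sup>2 + 2 * \<alpha> k * (\<phi> y - \<phi> (x k) + \<rho> * (norm (y - x k))\<^sup>2 + \<eta>))"
      by blast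
    define S where "S = 4 * (Q + A * (2 * T + 1) + 1)"
    have S: "S > 0" using Q A T by (simp add: S_def add_nonneg_pos)
    define b where "b = min (min b0 1) (min (\<beta> / M) (\<beta> / S))"
    have b: "b > 0" "b \<le> b0" "b \<le> 1" "M * b \<le> \<beta>" "S * b \<le> \<beta>"
    proof -
      show "b > 0" "b \<le> b0" "b \<le> 1" using b0 \<beta> M S by (auto simp: b_def)
      have "b \<le> \<beta> / M" "b \<le> \<beta> / S" by (auto simp: b_def)
      then show "M * b \<le> \<beta>" "S * b \<le> \<beta>" using M S by (simp_all add: pos_le_divide_eq mult.commute)
    qed
    show "\<exists>b>0. \<forall>\<alpha> x. run \<alpha> x \<longrightarrow> (\<forall>k. \<alpha> k \<le> b) \<longrightarrow>
      (\<forall>k. elapsed \<alpha> k \<le> T \<longrightarrow> norm (x (Suc k) - x k) \<le> M * \<alpha> k) \<and>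
      (\<forall>n. T \<le> elapsed \<alpha> n \<longrightarrow> evi_curve R M A T \<beta> (\<lambda>t. x (index_at \<alpha> t)))"
    proof (intro exI[of _ b] conjI b(1) allI impI)
      fix \<alpha> x assume run: "run \<alpha> x" and \<alpha>b: "\<forall>k. \<alpha> k \<le> b"
      then have ab0: "\<forall>k. \<alpha> k \<le> b0" using b(2) by (meson order_trans)
      note pos = run_pos[OF run]
      note B = run_b0[OF run ab0]
      show "norm (x (Suc k) - x k) \<le> M * \<alpha> k" if "elapsed \<alpha> k \<le> T" for k
        using B[of k] that by auto
      fix n assume n: "T \<le> elapsed \<alpha> n"
      have ix: "t \<le> elapsed \<alpha> (index_at \<alpha> t)" "elapsed \<alpha> (index_at \<alpha> t) \<le> t + b"
        if "0 \<le> t" "t \<le> T" for t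
        using index_at[where b=b and t=t and n=n, OF pos] \<alpha>b that n by auto
      have ixT: "elapsed \<alpha> (index_at \<alpha> t) \<le> T + 1" if "0 \<le> t" "t \<le> T" for t
        using ix(2)[OF that] that(2) b(3) by linarith
      show "evi_curve R M A T \<beta> (\<lambda>t. x (index_at \<alpha> t))"
        unfolding evi_curve_def
      proof (intro conjI ballI allI impI)
        show "x (index_at \<alpha> 0) = x0" using run_0[OF run] by simp
        fix t assume "t \<in> {0..T}"
        then show "x (index_at \<alpha> t) \<in> C \<inter> cball x0 R"
          using B[OF ixT[of t]] by auto
      next
        fix s t assume st: "0 \<le> s" "s \<le> t" "t \<le> T"
        define k l where "k = index_at \<alpha> s" and "l = index_at \<alpha> t"
        have kl: "k \<le> l" unfolding k_def l_def using st n by (intro index_at_mono[of s t \<alpha> n]) auto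
        have lT: "elapsed \<alpha> l \<le> T + 1" using ixT st by (simp add: l_def)
        define \<sigma> \<tau> where "\<sigma> = elapsed \<alpha> l - elapsed \<alpha> k" and "\<tau> = t - s"
        have \<sigma>0: "\<sigma> \<ge> 0" using elapsed_mono[of \<alpha> k l] pos kl by (simp add: \<sigma>_def less_imp_le)
        \<comment> \<open>Both ends overshoot by an amount between 0 and \<open>b\<close>, so the
          errors do not add up.\<close>
        have \<sigma>\<tau>: "\<bar>\<sigma> - \<tau>\<bar> \<le> b"
          using ix[of s] ix[of t] st unfolding \<sigma>_def \<tau>_def k_def l_def by linarith
        have \<tau>: "0 \<le> \<tau>" "\<tau> \<le> T" using st by (auto simp: \<tau>_def)
        have \<sigma>T: "\<sigma> \<le> T + 1" using \<sigma>\<tau> \<tau> b(3) by linarith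
        have cb: "x i \<in> C \<inter> cball x0 R" "norm (x (Suc i) - x i) \<le> M * \<alpha> i"
          if "elapsed \<alpha> i \<le> T + 1" for i using B[OF that] by auto
        have "norm (x l - x k) \<le> M * \<sigma>" unfolding \<sigma>_def
        proof (rule evi_iterate(1)[where T="T + 1" and y=x0 and x=x and R=R and \<eta>=\<eta> and L=L, OF pos R less_imp_le[OF M] LR cb])
          show "x0 \<in> C \<inter> cball x0 (R + 1)" using x0_C R by simp
          then show "(norm (x (Suc k) - x0))\<^sup>2 \<le>
          (norm (x k - x0))\<^sup>2 + 2 * \<alpha> k * (\<phi> x0 - \<phi> (x k) + \<rho> * (norm (x0 - x k))\<^sup>2 + \<eta>)"
            if "elapsed \<alpha> k \<le> T + 1" for k using B[OF that] by blast
        qed (use kl lT in auto)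
        also have "\<dots> \<le> M * (\<tau> + b)" using \<sigma>\<tau> M by (intro mult_left_mono) auto
        finally show "norm (x (index_at \<alpha> t) - x (index_at \<alpha> s)) \<le> M * (t - s) + \<beta>"
          using b(4) unfolding k_def l_def \<tau>_def by (simp add: distrib_left)
        fix y assume y: "y \<in> C \<inter> cball x0 (R + 1)"
        define P where "P = \<phi> y - \<phi> (x k) + \<rho> * (norm (y - x k))\<^sup>2"
        have kT: "elapsed \<alpha> k \<le> T + 1" using ixT[of s] st by (simp add: k_def)
        have xk: "x k \<in> C \<inter> cball x0 R" using cb(1)[OF kT] .
        then have "dist x0 (x k) \<le> R" "dist x0 y \<le> R + 1" using y by auto
        then have nyk: "dist y (x k) \<le> 2 * R + 1"
          using dist_triangle[of y "x k" x0] by (simp add: dist_commute)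
        have "dist (\<phi> y) (\<phi> (x k)) \<le> L * dist y (x k)"
          by (rule lipschitz_onD[OF L]) (use xk y in auto)
        also have "\<dots> \<le> L * (2 * R + 1)" using nyk L0 by (intro mult_left_mono)
        finally have p1: "\<bar>\<phi> y - \<phi> (x k)\<bar> \<le> L * (2 * R + 1)" by (simp add: dist_real_def)
        have p2: "0 \<le> \<rho> * (norm (y - x k))\<^sup>2" "\<rho> * (norm (y - x k))\<^sup>2 \<le> \<rho> * (2 * R + 1)\<^sup>2"
          using rho nyk by (auto intro!: mult_left_mono power_mono simp: dist_norm)
        have P: "\<bar>P\<bar> \<le> Q" unfolding P_def Q_def using p1 p2 by linarith
        have "(norm (x l - y))\<^sup>2 \<le> (norm (x k - y))\<^sup>2 + 2 * \<sigma> * (P + \<eta> + A * \<sigma>)"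
          unfolding \<sigma>_def P_def A_def
          by (rule evi_iterate(2)[where T="T + 1" and x=x, OF pos R less_imp_le[OF M] LR cb])
             (use B y kl lT in auto)
        also have "2 * \<sigma> * (P + \<eta> + A * \<sigma>) \<le> 2 * \<tau> * (P + A * \<tau>) + \<beta>"
        proof -
          have "(\<sigma> - \<tau>) * P \<le> \<bar>\<sigma> - \<tau>\<bar> * \<bar>P\<bar>" by (metis abs_ge_self abs_mult)
          also have "\<dots> \<le> b * Q" using \<sigma>\<tau> P b(1) by (intro mult_mono) auto
          finally have 1: "(\<sigma> - \<tau>) * P \<le> b * Q" .
          have "2 * \<sigma> * \<eta> \<le> 2 * (T + 1) * \<eta>" using \<sigma>T \<eta>(1) by simp
          then have 2: "2 * \<sigma> * \<eta> \<le> \<beta> / 2" using \<eta>(2) by linarith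
          have "(\<sigma> - \<tau>) * (\<sigma> + \<tau>) \<le> \<bar>\<sigma> - \<tau>\<bar> * (\<sigma> + \<tau>)"
            using \<sigma>0 \<tau> by (intro mult_right_mono) auto
          also have "\<dots> \<le> b * (2 * T + 1)"
            using \<sigma>\<tau> \<sigma>0 \<tau> \<sigma>T b(1) by (intro mult_mono) auto
          finally have "(\<sigma> - \<tau>) * (\<sigma> + \<tau>) \<le> b * (2 * T + 1)" .
          from mult_left_mono[OF this A]
          have 3: "A * \<sigma> * \<sigma> \<le> A * \<tau> * \<tau> + A * (b * (2 * T + 1))" by (simp add: algebra_simps)
          define G where "G = A * (b * (2 * T + 1))"
          have "S * b = 4 * (b * Q) + 4 * G + 4 * b"
            by (simp add: S_def G_def algebra_simps)
          then have 4: "4 * (b * Q) + 4 * G \<le> \<beta>" using b(1,5) by linarith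
          have "2 * \<sigma> * (P + \<eta> + A * \<sigma>) = 2 * \<tau> * P + 2 * ((\<sigma> - \<tau>) * P) + 2 * \<sigma> * \<eta> + 2 * (A * \<sigma> * \<sigma>)"
            by (simp add: algebra_simps)
          also have "\<dots> \<le> 2 * \<tau> * P + 2 * (b * Q) + \<beta> / 2 + 2 * (A * \<tau> * \<tau> + G)"
            using 1 2 3 \<tau> unfolding G_def by (intro add_mono mult_left_mono) auto
          also have "\<dots> = 2 * \<tau> * P + 2 * (A * \<tau> * \<tau>) + (2 * (b * Q) + 2 * G) + \<beta> / 2"
            by (simp only: distrib_left add_ac)
          also have "\<dots> \<le> 2 * \<tau> * P + 2 * (A * \<tau> * \<tau>) + \<beta> / 2 + \<beta> / 2"
            using 4 by simp
          also have "\<dots> = 2 * \<tau> * (P + A * \<tau>) + \<beta>" by (simp add: algebra_simps)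
          finally show ?thesis .
        qed
        finally show "(norm (x (index_at \<alpha> t) - y))\<^sup>2 \<le> (norm (x (index_at \<alpha> s) - y))\<^sup>2 +
           2 * (t - s) * (\<phi> y - \<phi> (x (index_at \<alpha> s)) + \<rho> * (norm (y - x (index_at \<alpha> s)))\<^sup>2 + A * (t - s)) + \<beta>"
          by (simp add: k_def l_def \<tau>_def P_def)
      qed
    qed
  qed
qed

text \<open>Doubling of variables: on a grid of mesh \<open>h\<close> each curve is tested at the position of the other
  one; the values of \<open>\<phi>\<close> cancel up to \<open>O(h)\<close>, and Gronwall applies to the squared distance.\<close>

lemma evi_curves_close:
  assumes T: "T \<ge> 0" and "R \<ge> 0" "M \<ge> 0" "A \<ge> 0" and \<epsilon>: "\<epsilon> > 0"
  shows "\<exists>\<beta>>0. \<forall>X X'. evi_curve R M A T \<beta> X \<longrightarrow> evi_curve R M A T \<beta> X' \<longrightarrow>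
           (\<forall>t\<in>{0..T}. norm (X t - X' t) \<le> \<epsilon>)"
proof -
  obtain L where L: "L-lipschitz_on (C \<inter> cball x0 R) \<phi>" using lip by blast
  have L0: "L \<ge> 0" using L lipschitz_on_nonneg by blast
  define B where "B = L + 4 * R * \<rho>"
  have B: "B \<ge> 0" using L0 \<open>R \<ge> 0\<close> rho by (simp add: B_def)
  \<comment> \<open>One grid step contributes the error \<open>c1 * h^2 + c2 * \<beta>\<close>,
    hence \<open>n\<close> steps of length at most \<open>T / n\<close> contribute
    \<open>c1 * T^2 / n + n * c2 * \<beta>\<close>, amplified by \<open>E\<close>. The second part
    grows with \<open>n\<close>, so \<open>n\<close> is chosen first and \<open>\<beta>\<close>
    afterwards, each part receiving half of \<open>\<epsilon>^2\<close>.\<close>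
  define c1 c2 E where "c1 = 2 * B * M + 4 * A" and "c2 = 2 * T * B + 2" and "E = exp (4 * \<rho> * T)"
  have c: "c1 \<ge> 0" "c2 > 0" "E > 0" using B \<open>M \<ge> 0\<close> \<open>A \<ge> 0\<close> T by (auto simp: c1_def c2_def E_def add_nonneg_pos)
  obtain n :: nat where n: "2 * E * c1 * T\<^sup>2 / \<epsilon>\<^sup>2 < real n" using reals_Archimedean2 by blast
  have "0 \<le> 2 * E * c1 * T\<^sup>2 / \<epsilon>\<^sup>2" using c by simp
  then have n0: "n > 0" using n by (metis of_nat_0_less_iff order_le_less_trans)
  define \<beta> where "\<beta> = \<epsilon>\<^sup>2 / (2 * E * c2 * real n)"
  have \<beta>: "\<beta> > 0" using \<epsilon> c n0 by (simp add: \<beta>_def)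
  have fin: "E * (c1 * T\<^sup>2 / real n) + E * (real n * c2 * \<beta>) \<le> \<epsilon>\<^sup>2"
  proof -
    have "2 * E * c1 * T\<^sup>2 \<le> real n * \<epsilon>\<^sup>2" using n \<epsilon> by (simp add: field_simps)
    then have "E * (c1 * T\<^sup>2 / real n) \<le> \<epsilon>\<^sup>2 / 2" using n0 by (simp add: field_simps)
    moreover have "E * (real n * c2 * \<beta>) = \<epsilon>\<^sup>2 / 2" using n0 c by (simp add: \<beta>_def)
    ultimately show ?thesis by linarith
  qed
  show ?thesis
  proof (intro exI[of _ \<beta>] conjI \<beta> allI impI ballI)
    fix X X' t assume X: "evi_curve R M A T \<beta> X" and X': "evi_curve R M A T \<beta> X'" and t: "t \<in> {0..T}"
    define h where "h = t / real n"
    have h: "h \<ge> 0" "real n * h = t" "h \<le> T"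
    proof -
      show 1: "h \<ge> 0" "real n * h = t" using t n0 by (auto simp: h_def)
      have "1 * h \<le> real n * h" using n0 1(1) by (intro mult_right_mono) auto
      then show "h \<le> T" using 1(2) t by simp
    qed
    define u where "u j = (norm (X (real j * h) - X' (real j * h)))\<^sup>2" for j
    have st: "u (Suc j) \<le> (1 + 4 * \<rho> * h) * u j + (c1 * h\<^sup>2 + c2 * \<beta>)" if j: "j < n" for j
    proof -
      define p q where "p = real j * h" and "q = real (Suc j) * h"
      have "q \<le> real n * h" unfolding q_def using j h(1) by (intro mult_right_mono) auto
      then have pq: "0 \<le> p" "p \<le> q" "q \<le> T" "q - p = h" "p \<le> T"
        using h t by (auto simp: p_def q_def algebra_simps)
      have qT: "0 \<le> q" using pq by linarith
      note xm = evi_curveD(2,3)[OF X pq(1,5)] and xm' = evi_curveD(2,3)[OF X' pq(1,5)] and xq' = evi_curveD(2,3)[OF X' qT pq(3)]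
      have big: "z \<in> cball x0 R \<Longrightarrow> z \<in> cball x0 (R + 1)" for z by auto
      \<comment> \<open>The mixed distance couples two tests on \<open>[p, q]\<close>:
        \<open>X\<close> is tested at \<open>X' q\<close> and then \<open>X'\<close> at
        \<open>X p\<close>. On adding them \<open>\<phi> (X p)\<close> cancels, and what remains,
        \<open>\<phi> (X' q) - \<phi> (X' p)\<close>, is small because one curve moves little in
        time \<open>h\<close>.\<close>
      define v where "v = norm (X p - X' q)"
      have e1: "(norm (X q - X' q))\<^sup>2 \<le> v\<^sup>2 + 2 * h * (\<phi> (X' q) - \<phi> (X p) + \<rho> * v\<^sup>2 + A * h) + \<beta>"
        using evi_curveD(5)[OF X pq(1,2,3) xq'(1) big[OF xq'(2)]] by (simp add: pq(4) v_def norm_minus_commute)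
      have e2: "v\<^sup>2 \<le> u j + 2 * h * (\<phi> (X p) - \<phi> (X' p) + \<rho> * u j + A * h) + \<beta>"
        using evi_curveD(5)[OF X' pq(1,2,3) xm(1) big[OF xm(2)]] unfolding pq(4)
        by (simp add: v_def norm_minus_commute u_def p_def)
      have d: "norm (X' q - X' p) \<le> M * h + \<beta>" using evi_curveD(4)[OF X' pq(1,2,3)] by (simp add: pq(4))
      have "dist (\<phi> (X' q)) (\<phi> (X' p)) \<le> L * dist (X' q) (X' p)"
        by (rule lipschitz_onD[OF L]) (use xm' xq' in auto)
      also have "\<dots> \<le> L * (M * h + \<beta>)" using d L0 by (intro mult_left_mono) (auto simp: dist_norm)
      finally have e3: "\<phi> (X' q) - \<phi> (X' p) \<le> L * (M * h + \<beta>)" by (simp add: dist_real_def abs_le_iff)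
      have nb: "norm (a - b) \<le> 2 * R" if "a \<in> cball x0 R" "b \<in> cball x0 R" for a b
        using that dist_triangle[of a b x0] by (simp add: dist_commute dist_norm[symmetric])
      have "v\<^sup>2 \<le> (norm (X p - X' p))\<^sup>2 + 2 * (2 * R) * (M * h + \<beta>)"
        unfolding v_def by (rule sq_norm_diff_le[OF nb nb]) (use xm xm' xq' d in \<open>auto simp: norm_minus_commute\<close>)
      then have "v\<^sup>2 \<le> u j + 4 * R * (M * h + \<beta>)" by (simp add: u_def p_def)
      from mult_left_mono[OF this rho] have e4: "\<rho> * v\<^sup>2 \<le> \<rho> * u j + 4 * R * \<rho> * (M * h + \<beta>)"
        by (simp add: algebra_simps)
      have "\<phi> (X' q) - \<phi> (X' p) + \<rho> * v\<^sup>2 + \<rho> * u j + 2 * (A * h)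
         \<le> 2 * \<rho> * u j + B * (M * h + \<beta>) + 2 * (A * h)"
        using e3 e4 by (simp add: B_def distrib_right)
      from mult_left_mono[OF this, of "2 * h"] h(1)
      have e5: "2 * h * (\<phi> (X' q) - \<phi> (X' p) + \<rho> * v\<^sup>2 + \<rho> * u j + 2 * (A * h))
         \<le> 2 * h * (2 * \<rho> * u j + B * (M * h + \<beta>) + 2 * (A * h))" by simp
      have "u (Suc j) \<le> u j + 2 * h * (\<phi> (X' q) - \<phi> (X' p) + \<rho> * v\<^sup>2 + \<rho> * u j + 2 * (A * h)) + 2 * \<beta>"
        using e1 e2 by (simp add: u_def q_def algebra_simps)
      also have "\<dots> \<le> u j + 2 * h * (2 * \<rho> * u j + B * (M * h + \<beta>) + 2 * (A * h)) + 2 * \<beta>"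
        using e5 by simp
      also have "\<dots> = (1 + 4 * \<rho> * h) * u j + c1 * h\<^sup>2 + (2 * h * B + 2) * \<beta>"
        by (simp add: c1_def power2_eq_square algebra_simps)
      also have "(2 * h * B + 2) * \<beta> \<le> c2 * \<beta>"
        using h(3) B \<beta> by (intro mult_right_mono) (auto simp: c2_def intro: mult_right_mono)
      finally show ?thesis by simp
    qed
    have "u n \<le> exp (4 * \<rho> * h * real n) * (real n * (c1 * h\<^sup>2 + c2 * \<beta>))"
    proof (rule discrete_gronwall[where u=u and n=n, OF _ st])
      show "u 0 \<le> 0" using evi_curveD(1)[OF X] evi_curveD(1)[OF X'] by (simp add: u_def)
    qed (use h rho c \<beta> in auto)
    also have "4 * \<rho> * h * real n = 4 * \<rho> * t" using h(2) by (metis mult.assoc mult.commute)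
    also have "exp (4 * \<rho> * t) * (real n * (c1 * h\<^sup>2 + c2 * \<beta>)) \<le> E * (real n * (c1 * h\<^sup>2 + c2 * \<beta>))"
      unfolding E_def using t rho c \<beta> by (intro mult_right_mono) (auto intro: mult_left_mono)
    also have "real n * (c1 * h\<^sup>2 + c2 * \<beta>) = c1 * t\<^sup>2 / real n + real n * c2 * \<beta>"
      using n0 by (simp add: h_def power2_eq_square field_simps)
    also have "E * (c1 * t\<^sup>2 / real n + real n * c2 * \<beta>) \<le> E * (c1 * T\<^sup>2 / real n + real n * c2 * \<beta>)"
      using t c n0 by (intro mult_left_mono add_right_mono divide_right_mono power_mono) auto
    also have "\<dots> \<le> \<epsilon>\<^sup>2" using fin by (simp add: distrib_left)
    finally have "(norm (X t - X' t))\<^sup>2 \<le> \<epsilon>\<^sup>2" using h(2) by (simp add: u_def)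
    then show "norm (X t - X' t) \<le> \<epsilon>" using \<epsilon> by (simp add: power2_le_iff_abs_le)
  qed
qed

section \<open>The limit curve of runs with vanishing steps\<close>

lemma continuous_\<phi>: "continuous_on C \<phi>"
proof (rule continuous_onI)
  fix x e assume x: "x \<in> C" and e: "(e::real) > 0"
  obtain L where L: "L-lipschitz_on (C \<inter> cball x0 (dist x0 x + 1)) \<phi>" using lip by blast
  have L0: "L \<ge> 0" using L lipschitz_on_nonneg by blast
  define d where "d = min 1 (e / (L + 1))"
  have d: "d > 0" using e L0 by (simp add: d_def add_nonneg_pos)
  moreover have "dist (\<phi> y) (\<phi> x) \<le> e" if y: "y \<in> C" "dist y x < d" for y
  proof -
    have "dist x0 y \<le> dist x0 x + 1" using y dist_triangle[of x0 y x] by (simp add: d_def dist_commute)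
    then have "dist (\<phi> y) (\<phi> x) \<le> L * dist y x" using x y by (intro lipschitz_onD[OF L]) auto
    also have "\<dots> \<le> (L + 1) * (e / (L + 1))" using y L0 e by (intro mult_mono) (auto simp: d_def)
    also have "\<dots> = e" using L0 by simp
    finally show ?thesis .
  qed
  ultimately show "\<exists>d>0. \<forall>x'\<in>C. dist x' x < d \<longrightarrow> dist (\<phi> x') (\<phi> x) \<le> e" by blast
qed

text \<open>Each clause constrains the curve at no more than two times and is closed in these values
  by continuity of \<open>\<phi>\<close> on the closed set \<open>C\<close>. Pointwise convergence
  therefore suffices.\<close>

lemma evi_curve_limit:
  assumes "T \<ge> 0"
    and conv: "\<And>t. 0 \<le> t \<Longrightarrow> t \<le> T \<Longrightarrow> (\<lambda>n. X n t) \<longlonglongrightarrow> Y t"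
    and ev: "\<And>\<beta>. \<beta> > 0 \<Longrightarrow> \<forall>\<^sub>F n in sequentially. evi_curve R M A T \<beta> (X n)"
  shows "evi_curve R M A T 0 Y"
  unfolding evi_curve_def
proof (intro conjI ballI allI impI)
  have "\<forall>\<^sub>F n in sequentially. X n 0 = x0"
    using ev[OF zero_less_one] by eventually_elim (rule evi_curveD(1))
  then have "(\<lambda>n. X n 0) \<longlonglongrightarrow> x0" by (rule tendsto_eventually)
  then show "Y 0 = x0" using conv[of 0] \<open>T \<ge> 0\<close> LIMSEQ_unique by auto
  have YC: "Y t \<in> C \<inter> cball x0 R" if t: "0 \<le> t" "t \<le> T" for t
  proof (rule Lim_in_closed_set[OF _ _ _ conv[OF t]])
    show "closed (C \<inter> cball x0 R)" using closed_C by auto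
    show "\<forall>\<^sub>F n in sequentially. X n t \<in> C \<inter> cball x0 R"
      using ev[OF zero_less_one] by eventually_elim (use t evi_curveD(2,3) in blast)
  qed simp
  then show "Y t \<in> C \<inter> cball x0 R" if "t \<in> {0..T}" for t using that by auto
  fix s t assume st: "0 \<le> s" "s \<le> t" "t \<le> T"
  have s: "0 \<le> s" "s \<le> T" and t: "0 \<le> t" "t \<le> T" using st by auto
  show "norm (Y t - Y s) \<le> M * (t - s) + 0"
  proof (rule field_le_epsilon)
    fix \<beta> :: real assume "\<beta> > 0"
    from ev[OF this] have ev': "\<forall>\<^sub>F n in sequentially. norm (X n t - X n s) \<le> M * (t - s) + \<beta>"
      by eventually_elim (rule evi_curveD(4)[OF _ st])
    have "(\<lambda>n. norm (X n t - X n s)) \<longlonglongrightarrow> norm (Y t - Y s)" by (intro tendsto_intros conv s t)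
    from tendsto_upperbound[OF this ev'] show "norm (Y t - Y s) \<le> M * (t - s) + 0 + \<beta>" by simp
  qed
  fix y assume y: "y \<in> C \<inter> cball x0 (R + 1)"
  show "(norm (Y t - y))\<^sup>2 \<le> (norm (Y s - y))\<^sup>2 +
           2 * (t - s) * (\<phi> y - \<phi> (Y s) + \<rho> * (norm (y - Y s))\<^sup>2 + A * (t - s)) + 0"
  proof (rule field_le_epsilon)
    fix \<beta> :: real assume "\<beta> > 0"
    have y': "y \<in> C" "y \<in> cball x0 (R + 1)" using y by auto
    from ev[OF \<open>\<beta> > 0\<close>] have ev': "\<forall>\<^sub>F n in sequentially. (norm (X n t - y))\<^sup>2 - (norm (X n s - y))\<^sup>2 -
           2 * (t - s) * (\<phi> y - \<phi> (X n s) + \<rho> * (norm (y - X n s))\<^sup>2 + A * (t - s)) \<le> \<beta>"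
    proof eventually_elim
      case (elim n)
      from evi_curveD(5)[OF elim st y'] show ?case by linarith
    qed
    have lim: "(\<lambda>n. (norm (X n t - y))\<^sup>2 - (norm (X n s - y))\<^sup>2 -
           2 * (t - s) * (\<phi> y - \<phi> (X n s) + \<rho> * (norm (y - X n s))\<^sup>2 + A * (t - s))) \<longlonglongrightarrow>
        (norm (Y t - y))\<^sup>2 - (norm (Y s - y))\<^sup>2 -
           2 * (t - s) * (\<phi> y - \<phi> (Y s) + \<rho> * (norm (y - Y s))\<^sup>2 + A * (t - s))"
    proof (intro tendsto_intros conv s t)
      show "(\<lambda>n. \<phi> (X n s)) \<longlonglongrightarrow> \<phi> (Y s)"
      proof (rule continuous_on_tendsto_compose[OF continuous_\<phi> conv[OF s]])
        show "Y s \<in> C" using YC[OF s] by auto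
        show "\<forall>\<^sub>F n in sequentially. X n s \<in> C"
          using ev[OF zero_less_one] by eventually_elim (use s evi_curveD(2) in blast)
      qed
    qed
    have "(norm (Y t - y))\<^sup>2 - (norm (Y s - y))\<^sup>2 -
           2 * (t - s) * (\<phi> y - \<phi> (Y s) + \<rho> * (norm (y - Y s))\<^sup>2 + A * (t - s)) \<le> \<beta>"
      by (rule tendsto_upperbound[OF lim ev']) simp
    then show "(norm (Y t - y))\<^sup>2 \<le> (norm (Y s - y))\<^sup>2 +
           2 * (t - s) * (\<phi> y - \<phi> (Y s) + \<rho> * (norm (y - Y s))\<^sup>2 + A * (t - s)) + 0 + \<beta>" by linarith
  qed
qed

text \<open>Runs with ever smaller steps and ever longer duration form a Cauchy sequence at each
  time, by comparison of curves. One sequence serves all horizons, so \<open>Y\<close> does not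
  depend on \<open>T\<close>, although \<open>R\<close>, \<open>M\<close> and \<open>A\<close>
  do.\<close>

lemma limit_curve:
  assumes unb: "\<And>T b. b > 0 \<Longrightarrow> \<exists>\<alpha> x n. run \<alpha> x \<and> (\<forall>k. \<alpha> k \<le> b) \<and> T \<le> elapsed \<alpha> n"
  obtains Y where "\<And>T. T \<ge> 0 \<Longrightarrow> \<exists>R\<ge>0. \<exists>M>0. \<exists>A\<ge>0. evi_curve R M A T 0 Y"
    and "\<And>T \<epsilon>. T \<ge> 0 \<Longrightarrow> \<epsilon> > 0 \<Longrightarrow> \<exists>b>0. \<forall>\<alpha> x n. run \<alpha> x \<longrightarrow> (\<forall>k. \<alpha> k \<le> b) \<longrightarrow> T \<le> elapsed \<alpha> n \<longrightarrow>
       norm (x (index_at \<alpha> T) - Y T) \<le> \<epsilon>"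
proof -
  have "\<forall>i. \<exists>\<alpha> x n. run \<alpha> x \<and> (\<forall>k. \<alpha> k \<le> 1 / real (Suc i)) \<and> real i \<le> elapsed \<alpha> n"
    using unb by simp
  then obtain \<alpha> x n where run: "\<And>i. run (\<alpha> i) (x i)" and \<alpha>: "\<And>i k. \<alpha> i k \<le> 1 / real (Suc i)"
    and el: "\<And>i. real i \<le> elapsed (\<alpha> i) (n i)" by metis
  define X where "X i t = x i (index_at (\<alpha> i) t)" for i t
  define Y where "Y t = lim (\<lambda>i. X i t)" for t
  have *: "\<exists>R\<ge>0. \<exists>M>0. \<exists>A\<ge>0. (\<forall>t. 0 \<le> t \<longrightarrow> t \<le> T \<longrightarrow> (\<lambda>i. X i t) \<longlonglongrightarrow> Y t) \<and>
      (\<forall>\<beta>>0. \<forall>\<^sub>F i in sequentially. evi_curve R M A T \<beta> (X i)) \<and>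
      (\<forall>\<epsilon>>0. \<exists>b>0. \<forall>\<alpha> x n. run \<alpha> x \<longrightarrow> (\<forall>k. \<alpha> k \<le> b) \<longrightarrow> T \<le> elapsed \<alpha> n \<longrightarrow>
       norm (x (index_at \<alpha> T) - Y T) \<le> \<epsilon>)" if T: "T \<ge> 0" for T
  proof -
    obtain R M A where R: "R \<ge> 0" and M: "M > 0" and A: "A \<ge> 0"
      and cv: "\<And>\<beta>. \<beta> > 0 \<Longrightarrow> \<exists>b>0. \<forall>\<alpha> x. run \<alpha> x \<longrightarrow> (\<forall>k. \<alpha> k \<le> b) \<longrightarrow>
        (\<forall>k. elapsed \<alpha> k \<le> T \<longrightarrow> norm (x (Suc k) - x k) \<le> M * \<alpha> k) \<and>
        (\<forall>n. T \<le> elapsed \<alpha> n \<longrightarrow> evi_curve R M A T \<beta> (\<lambda>t. x (index_at \<alpha> t)))"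
      using run_evi_curve[OF T] by blast
    have ev: "\<forall>\<^sub>F i in sequentially. evi_curve R M A T \<beta> (X i)" if \<beta>: "\<beta> > 0" for \<beta>
    proof -
      obtain b where b: "b > 0" and bb: "\<And>\<alpha> x n. run \<alpha> x \<Longrightarrow> (\<forall>k. \<alpha> k \<le> b) \<Longrightarrow>
        T \<le> elapsed \<alpha> n \<Longrightarrow> evi_curve R M A T \<beta> (\<lambda>t. x (index_at \<alpha> t))"
        using cv[OF \<beta>] by blast
      have "\<forall>\<^sub>F i in sequentially. 1 / real (Suc i) < b"
        using LIMSEQ_inverse_real_of_nat b by (auto dest: order_tendstoD simp: inverse_eq_divide)
      moreover have "\<forall>\<^sub>F i in sequentially. T \<le> real i" by (rule eventually_sequentiallyI[of "nat \<lceil>T\<rceil>"]) linarith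
      ultimately show ?thesis
      proof eventually_elim
        case (elim i)
        have "\<forall>k. \<alpha> i k \<le> b" using \<alpha>[of i] elim(1) by (meson less_imp_le order_trans)
        moreover have "T \<le> elapsed (\<alpha> i) (n i)" using el[of i] elim(2) by linarith
        ultimately show ?case using bb[OF run[of i]] unfolding X_def by blast
      qed
    qed
    \<comment> \<open>A tail of the sequence is close to every curve with the same error. Applied to
      later members this gives convergence; applied to an arbitrary run it gives the distance to
      \<open>Y\<close>.\<close>
    have Cauchy: "\<exists>\<beta>>0. \<exists>k. \<forall>i\<ge>k. \<forall>X'. evi_curve R M A T \<beta> X' \<longrightarrow> (\<forall>t\<in>{0..T}. norm (X i t - X' t) \<le> \<epsilon>)"
      if \<epsilon>: "\<epsilon> > 0" for \<epsilon>
    proof -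
      obtain \<beta> where \<beta>: "\<beta> > 0" and cl: "\<And>X X'. evi_curve R M A T \<beta> X \<Longrightarrow> evi_curve R M A T \<beta> X' \<Longrightarrow>
           (\<forall>t\<in>{0..T}. norm (X t - X' t) \<le> \<epsilon>)"
        using evi_curves_close[OF T R less_imp_le[OF M] A \<epsilon>] by blast
      from ev[OF \<beta>] obtain k where "\<And>i. i \<ge> k \<Longrightarrow> evi_curve R M A T \<beta> (X i)"
        unfolding eventually_sequentially by blast
      then show ?thesis using cl \<beta> by blast
    qed
    have conv: "(\<lambda>i. X i t) \<longlonglongrightarrow> Y t" if t: "0 \<le> t" "t \<le> T" for t
    proof -
      have "Cauchy (\<lambda>i. X i t)"
      proof (rule metric_CauchyI)
        fix e :: real assume "e > 0"
        then have e2: "e / 2 > 0" by simp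
        obtain \<beta> k where \<beta>: "\<beta> > 0" and k: "\<And>i X' t. i \<ge> k \<Longrightarrow> evi_curve R M A T \<beta> X' \<Longrightarrow> t\<in>{0..T} \<Longrightarrow> norm (X i t - X' t) \<le> e / 2"
          using Cauchy[OF e2] by blast
        obtain k' where k': "\<And>i. i \<ge> k' \<Longrightarrow> evi_curve R M A T \<beta> (X i)"
          using ev[OF \<beta>] unfolding eventually_sequentially by blast
        have "dist (X i t) (X j t) < e" if "i \<ge> max k k'" "j \<ge> max k k'" for i j
          using k[of i "X j" t] k'[of j] that t \<open>e > 0\<close> by (auto simp: dist_norm intro: le_less_trans)
        then show "\<exists>M. \<forall>m\<ge>M. \<forall>n\<ge>M. dist (X m t) (X n t) < e" by blast
      qed
      then show ?thesis unfolding Y_def by (simp add: Cauchy_convergent_iff convergent_LIMSEQ_iff)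
    qed
    have "\<exists>b>0. \<forall>\<alpha> x n. run \<alpha> x \<longrightarrow> (\<forall>k. \<alpha> k \<le> b) \<longrightarrow> T \<le> elapsed \<alpha> n \<longrightarrow>
       norm (x (index_at \<alpha> T) - Y T) \<le> \<epsilon>" if \<epsilon>: "\<epsilon> > 0" for \<epsilon>
    proof -
      obtain \<beta> k where \<beta>: "\<beta> > 0" and k: "\<And>i X' t. i \<ge> k \<Longrightarrow> evi_curve R M A T \<beta> X' \<Longrightarrow> t\<in>{0..T} \<Longrightarrow> norm (X i t - X' t) \<le> \<epsilon>"
        using Cauchy[OF \<epsilon>] by blast
      obtain b where b: "b > 0" and bb: "\<And>\<alpha> x n. run \<alpha> x \<Longrightarrow> (\<forall>k. \<alpha> k \<le> b) \<Longrightarrow>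
        T \<le> elapsed \<alpha> n \<Longrightarrow> evi_curve R M A T \<beta> (\<lambda>t. x (index_at \<alpha> t))"
        using cv[OF \<beta>] by blast
      show ?thesis
      proof (intro exI[of _ b] conjI b allI impI)
        fix \<alpha> x n assume "run \<alpha> x" "\<forall>k. \<alpha> k \<le> b" "T \<le> elapsed \<alpha> n"
        from bb[OF this] have ev': "\<forall>\<^sub>F i in sequentially. norm (x (index_at \<alpha> T) - X i T) \<le> \<epsilon>"
          unfolding eventually_sequentially using k T by (intro exI[of _ k]) (fastforce simp: norm_minus_commute)
        have lim: "(\<lambda>i. norm (x (index_at \<alpha> T) - X i T)) \<longlonglongrightarrow> norm (x (index_at \<alpha> T) - Y T)"
          by (intro tendsto_intros conv T order_refl)
        show "norm (x (index_at \<alpha> T) - Y T) \<le> \<epsilon>"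
          by (rule tendsto_upperbound[OF lim ev']) simp
      qed
    qed
    then show ?thesis using R M A conv ev by blast
  qed
  show thesis
  proof (rule that)
    fix T :: real assume T: "T \<ge> 0"
    show "\<exists>R\<ge>0. \<exists>M>0. \<exists>A\<ge>0. evi_curve R M A T 0 Y"
      using *[OF T] evi_curve_limit[OF T, where X=X and Y=Y] by meson
    fix \<epsilon> :: real assume "\<epsilon> > 0"
    then show "\<exists>b>0. \<forall>\<alpha> x n. run \<alpha> x \<longrightarrow> (\<forall>k. \<alpha> k \<le> b) \<longrightarrow> T \<le> elapsed \<alpha> n \<longrightarrow>
       norm (x (index_at \<alpha> T) - Y T) \<le> \<epsilon>" using *[OF T] by blast
  qed
qed

section \<open>Descent and stationarity along the limit curve\<close>

lemma evi_interval:
  assumes Y: "evi_curve R M A T 0 Y" and st: "0 \<le> s" "s \<le> t" "t \<le> T"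
    and y: "y \<in> C" "y \<in> cball x0 (R + 1)"
    and c: "\<And>r. s \<le> r \<Longrightarrow> r \<le> t \<Longrightarrow> \<phi> y - \<phi> (Y r) + \<rho> * (norm (y - Y r))\<^sup>2 \<le> c"
  shows "(norm (Y t - y))\<^sup>2 \<le> (norm (Y s - y))\<^sup>2 + 2 * c * (t - s)"
proof (rule le_if_le_add_divide)
  fix n :: nat assume n: "n \<ge> 1"
  \<comment> \<open>Since \<open>Y\<close> has no error \<open>\<beta>\<close>, the interval can be
    subdivided freely. The \<open>A\<close> terms of the \<open>n\<close> pieces add up to order
    \<open>1 / n\<close> and disappear, provided that the brackets are bounded by one constant
    \<open>c\<close>.\<close>
  define h where "h = (t - s) / real n"
  have h: "h \<ge> 0" "real n * h = t - s" using st n by (auto simp: h_def)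
  have "(norm (Y (s + real j * h) - y))\<^sup>2 \<le> (norm (Y s - y))\<^sup>2 + real j * (2 * h * (c + A * h))" if "j \<le> n" for j
    using that
  proof (induction j)
    case 0
    then show ?case by simp
  next
    case (Suc j)
    define p q where "p = s + real j * h" and "q = s + real (Suc j) * h"
    have "real (Suc j) * h \<le> real n * h" using Suc.prems h(1) by (intro mult_right_mono) auto
    then have pq: "0 \<le> p" "p \<le> q" "q \<le> T" "q - p = h" "p \<le> t" "s \<le> p"
      using h st by (auto simp: p_def q_def algebra_simps)
    have "(norm (Y q - y))\<^sup>2 \<le> (norm (Y p - y))\<^sup>2 +
       2 * h * (\<phi> y - \<phi> (Y p) + \<rho> * (norm (y - Y p))\<^sup>2 + A * h)"
      using evi_curveD(5)[OF Y pq(1-3) y] unfolding pq(4) by simp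
    also have "\<dots> \<le> (norm (Y p - y))\<^sup>2 + 2 * h * (c + A * h)"
      using c[OF pq(6,5)] h(1) by (intro add_left_mono mult_left_mono) auto
    also have "(norm (Y p - y))\<^sup>2 \<le> (norm (Y s - y))\<^sup>2 + real j * (2 * h * (c + A * h))"
      using Suc by (simp add: p_def)
    finally show ?case by (simp add: q_def distrib_right)
  qed
  from this[of n] have "(norm (Y (s + real n * h) - y))\<^sup>2 \<le> (norm (Y s - y))\<^sup>2 + 2 * (real n * h) * (c + A * h)"
    by (simp add: mult_ac)
  then have "(norm (Y t - y))\<^sup>2 \<le> (norm (Y s - y))\<^sup>2 + 2 * (t - s) * (c + A * h)"
    unfolding h(2) by simp
  also have "2 * (t - s) * (c + A * h) = 2 * c * (t - s) + 2 * A * (t - s)\<^sup>2 / real n"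
    using n by (simp add: h_def power2_eq_square field_simps)
  finally show "(norm (Y t - y))\<^sup>2 \<le> (norm (Y s - y))\<^sup>2 + 2 * c * (t - s) + 2 * A * (t - s)\<^sup>2 / real n"
    by simp
qed

lemma evi_curve_continuous:
  assumes "evi_curve R M A T 0 Y" "0 \<le> s"
  shows "continuous_on {s..T} Y"
proof (rule continuous_onI)
  fix t e assume t: "t \<in> {s..T}" and e: "(e::real) > 0"
  have "dist (Y r) (Y t) \<le> e" if "r \<in> {s..T}" "dist r t < e / (\<bar>M\<bar> + 1)" for r
  proof -
    have "dist (Y r) (Y t) \<le> \<bar>M\<bar> * dist r t"
    proof (cases "r \<le> t")
      case True
      then have "norm (Y t - Y r) \<le> M * (t - r)" using evi_curveD(4)[OF assms(1), of r t] that t assms by simp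
      also have "\<dots> \<le> \<bar>M\<bar> * (t - r)" using True by (intro mult_right_mono) auto
      finally show ?thesis using True by (simp add: dist_norm norm_minus_commute)
    next
      case False
      then have "norm (Y r - Y t) \<le> M * (r - t)" using evi_curveD(4)[OF assms(1), of t r] that t assms by simp
      also have "\<dots> \<le> \<bar>M\<bar> * (r - t)" using False by (intro mult_right_mono) auto
      finally show ?thesis using False by (simp add: dist_norm)
    qed
    also have "\<dots> \<le> (\<bar>M\<bar> + 1) * (e / (\<bar>M\<bar> + 1))" using that(2) e by (intro mult_mono) auto
    also have "\<dots> = e" by simp
    finally show ?thesis .
  qed
  then show "\<exists>d>0. \<forall>x'\<in>{s..T}. dist x' t < d \<longrightarrow> dist (Y x') (Y t) \<le> e"
    using e by (intro exI[of _ "e / (\<bar>M\<bar> + 1)"]) auto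
qed

lemma evi_curve_continuous_\<phi>:
  assumes "evi_curve R M A T 0 Y" "0 \<le> s"
  shows "continuous_on {s..T} (\<lambda>t. \<phi> (Y t))"
  by (rule continuous_on_compose2[OF continuous_\<phi> evi_curve_continuous[OF assms]])
     (use evi_curveD(2)[OF assms(1)] assms(2) in auto)

text \<open>Testing at the starting point \<open>Y s\<close> bounds the largest squared displacement
  \<open>b\<close> by \<open>2 * (\<kappa> + \<rho> * b) * (t - s)\<close>. On an interval this
  short the term with \<open>b\<close> on the right is at most \<open>b / 2\<close> and is
  absorbed.\<close>

lemma evi_curve_displacement:
  assumes Y: "evi_curve R M A T 0 Y" and st: "0 \<le> s" "s \<le> t" "t \<le> T"
    and short: "4 * \<rho> * (t - s) \<le> 1" and \<kappa>: "\<And>r. s \<le> r \<Longrightarrow> r \<le> t \<Longrightarrow> \<phi> (Y s) - \<phi> (Y r) \<le> \<kappa>"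
    and r: "s \<le> r" "r \<le> t"
  shows "(norm (Y r - Y s))\<^sup>2 \<le> 4 * \<kappa> * (t - s)"
proof -
  have s: "Y s \<in> C" "Y s \<in> cball x0 (R + 1)" using evi_curveD(2,3)[OF Y, of s] st by auto
  have \<kappa>0: "\<kappa> \<ge> 0" using \<kappa>[of s] st by simp
  have "continuous_on {s..t} (\<lambda>r. (norm (Y r - Y s))\<^sup>2)"
    by (intro continuous_intros continuous_on_subset[OF evi_curve_continuous[OF Y st(1)]]) (use st in auto)
  moreover have "compact {s..t}" "{s..t} \<noteq> {}" using st by auto
  ultimately obtain w where w: "w \<in> {s..t}" "\<And>r. r \<in> {s..t} \<Longrightarrow> (norm (Y r - Y s))\<^sup>2 \<le> (norm (Y w - Y s))\<^sup>2"
    using continuous_attains_sup[of "{s..t}" "\<lambda>r. (norm (Y r - Y s))\<^sup>2"] by blast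
  define b where "b = (norm (Y w - Y s))\<^sup>2"
  have b: "b \<ge> 0" by (simp add: b_def)
  have "b \<le> (norm (Y s - Y s))\<^sup>2 + 2 * (\<kappa> + \<rho> * b) * (w - s)"
    unfolding b_def
  proof (rule evi_interval[OF Y st(1) _ _ s])
    fix r assume "s \<le> r" "r \<le> w"
    then have r: "r \<in> {s..t}" using w(1) by auto
    have "\<rho> * (norm (Y s - Y r))\<^sup>2 \<le> \<rho> * (norm (Y w - Y s))\<^sup>2"
      using w(2)[OF r] rho by (intro mult_left_mono) (auto simp: norm_minus_commute)
    then show "\<phi> (Y s) - \<phi> (Y r) + \<rho> * (norm (Y s - Y r))\<^sup>2 \<le> \<kappa> + \<rho> * (norm (Y w - Y s))\<^sup>2"
      using \<kappa>[of r] r by simp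
  qed (use w st in auto)
  also have "\<dots> \<le> 2 * (\<kappa> + \<rho> * b) * (t - s)"
    using w(1) \<kappa>0 rho b by (simp add: mult_left_mono)
  also have "\<dots> = 2 * \<kappa> * (t - s) + (4 * \<rho> * (t - s)) * b / 2" by (simp add: field_simps)
  also have "\<dots> \<le> 2 * \<kappa> * (t - s) + 1 * b / 2"
    using short b by (intro add_left_mono divide_right_mono mult_right_mono) auto
  finally have "b \<le> 4 * \<kappa> * (t - s)" by simp
  moreover have "(norm (Y r - Y s))\<^sup>2 \<le> b" using w(2)[of r] r unfolding b_def by auto
  ultimately show ?thesis by linarith
qed

text \<open>If \<open>\<phi>\<close> increased, then after the last time \<open>w\<close> with a value below the initial one the inequality
  tested at \<open>Y w\<close> would force the curve to stand still.\<close>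

lemma evi_curve_antimono:
  assumes Y: "evi_curve R M A T 0 Y" and st: "0 \<le> s" "s \<le> t" "t \<le> T"
  shows "\<phi> (Y t) \<le> \<phi> (Y s)"
proof (rule ccontr)
  assume neg: "\<not> ?thesis"
  define S where "S = {r \<in> {s..t}. \<phi> (Y r) \<le> \<phi> (Y s)}"
  have cont: "continuous_on {s..t} (\<lambda>r. \<phi> (Y r))"
    by (rule continuous_on_subset[OF evi_curve_continuous_\<phi>[OF Y st(1)]]) (use st in auto)
  have "closed S" unfolding S_def by (rule continuous_on_closed_Collect_le[OF cont]) auto
  moreover have "bounded S" unfolding S_def by (rule bounded_subset[OF bounded_closed_interval[of s t]]) auto
  ultimately have "compact S" by (simp add: compact_eq_bounded_closed)
  moreover have "S \<noteq> {}" using st by (auto simp: S_def)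
  ultimately obtain w where w: "w \<in> S" "\<And>r. r \<in> S \<Longrightarrow> r \<le> w" by (meson compact_attains_sup)
  have wt: "s \<le> w" "w < t" "\<phi> (Y w) \<le> \<phi> (Y s)" using w(1) neg unfolding S_def by (auto simp: less_le)
  \<comment> \<open>Beyond \<open>w\<close> the values along the curve exceed
    \<open>\<phi> (Y s)\<close>, hence also \<open>\<phi> (Y w)\<close>; up to \<open>q\<close> the
    displacement bound is available, here with \<open>\<kappa> = 0\<close>.\<close>
  define q where "q = min t (w + 1 / (4 * \<rho> + 4))"
  have q: "w < q" "q \<le> t" "4 * \<rho> * (q - w) \<le> 1"
  proof -
    show "w < q" "q \<le> t" using wt rho by (auto simp: q_def)
    have "4 * \<rho> * (q - w) \<le> 4 * \<rho> * (1 / (4 * \<rho> + 4))" using rho by (intro mult_left_mono) (auto simp: q_def)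
    also have "\<dots> \<le> 1" using rho by (simp add: field_simps)
    finally show "4 * \<rho> * (q - w) \<le> 1" .
  qed
  have "(norm (Y q - Y w))\<^sup>2 \<le> 4 * 0 * (q - w)"
  proof (rule evi_curve_displacement[OF Y _ _ _ q(3)])
    fix r assume r: "w \<le> r" "r \<le> q"
    show "\<phi> (Y w) - \<phi> (Y r) \<le> 0"
    proof (cases "r = w")
      case False
      then have "r \<notin> S" using w(2)[of r] r by auto
      then show ?thesis using r wt q by (auto simp: S_def)
    qed simp
  qed (use wt q st in auto)
  then have "Y q = Y w" by simp
  then have "q \<in> S" using q wt by (simp add: S_def)
  then show False using w(2) q(1) by fastforce
qed

text \<open>A drop of at most \<open>\<mu>^2\<close> lets the curve move by at most
  \<open>\<mu>\<close> on \<open>[s, T]\<close>. In the inequality tested at \<open>z\<close> and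
  divided by \<open>2 * h\<close>, the change of the squared distance thus costs at most
  \<open>3 * \<mu> * (2 * \<rho> + 2)\<close>. The bound
  \<open>(a + 2 * \<mu>)^2 \<le> 2 * a^2 + 8 * \<mu>\<close> is the origin of
  \<open>2 * \<rho>\<close> in place of \<open>\<rho>\<close> and adds
  \<open>8 * \<rho> * \<mu>\<close>; together this is
  \<open>(14 * \<rho> + 6) * \<mu>\<close>.\<close>

lemma evi_curve_almost_stationary:
  assumes Y: "evi_curve R M A T 0 Y" and st: "0 \<le> s" "s \<le> T" "T - s = 1 / (4 * \<rho> + 4)"
    and drop: "\<phi> (Y s) - \<phi> (Y T) \<le> \<mu>\<^sup>2" and \<mu>: "0 \<le> \<mu>" "\<mu> \<le> 1"
    and z: "z \<in> C" "z \<in> cball (Y T) 1"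
  shows "\<phi> (Y T) - \<phi> z \<le> 2 * \<rho> * (norm (z - Y T))\<^sup>2 + (14 * \<rho> + 6) * \<mu>"
proof -
  define h where "h = T - s"
  have h_eq: "h = 1 / (4 * \<rho> + 4)" using st(3) by (simp add: h_def)
  have h: "h > 0" "4 * h \<le> 1" "4 * \<rho> * h \<le> 1" "1 / (2 * h) = 2 * \<rho> + 2"
    using rho by (auto simp: h_eq field_simps)
  have disp: "norm (Y r - Y s) \<le> \<mu>" if r: "s \<le> r" "r \<le> T" for r
  proof -
    have "(norm (Y r - Y s))\<^sup>2 \<le> 4 * \<mu>\<^sup>2 * (T - s)"
    proof (rule evi_curve_displacement[OF Y st(1,2) _ _ _ r])
      fix r assume "s \<le> r" "r \<le> T"
      then show "\<phi> (Y s) - \<phi> (Y r) \<le> \<mu>\<^sup>2"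
        using evi_curve_antimono[OF Y, of r T] st drop by simp
    qed (use h in \<open>simp_all add: h_def\<close>)
    also have "\<dots> = 4 * h * \<mu>\<^sup>2" by (simp add: h_def)
    also have "\<dots> \<le> 1 * \<mu>\<^sup>2" using h(2) by (intro mult_right_mono) auto
    also have "\<dots> = \<mu>\<^sup>2" by simp
    finally show ?thesis using \<mu>(1) by (rule power2_le_imp_le)
  qed
  define a where "a = norm (z - Y T)"
  have a: "0 \<le> a" "a \<le> 1" using z(2) by (auto simp: a_def dist_norm norm_minus_commute)
  have T: "0 \<le> T" "T \<le> T" using st by auto
  have "dist x0 z \<le> R + 1"
    using evi_curveD(3)[OF Y T] z(2) dist_triangle[of x0 z "Y T"] by simp
  then have zb: "z \<in> cball x0 (R + 1)" by simp
  have "(norm (Y T - z))\<^sup>2 \<le> (norm (Y s - z))\<^sup>2 + 2 * (\<phi> z - \<phi> (Y T) + \<rho> * (a + 2 * \<mu>)\<^sup>2) * (T - s)"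
  proof (rule evi_interval[OF Y st(1,2) _ z(1) zb])
    fix r assume r: "s \<le> r" "r \<le> T"
    have "norm (z - Y r) \<le> norm (z - Y T) + norm (Y T - Y s) + norm (Y s - Y r)"
      using norm_triangle_ineq[of "z - Y T" "Y T - Y r"] norm_triangle_ineq[of "Y T - Y s" "Y s - Y r"] by simp
    also have "\<dots> \<le> a + 2 * \<mu>"
      using disp[OF r] disp[OF st(2) order_refl] by (simp add: a_def norm_minus_commute)
    finally have "\<rho> * (norm (z - Y r))\<^sup>2 \<le> \<rho> * (a + 2 * \<mu>)\<^sup>2" using rho by (intro mult_left_mono power_mono) auto
    then show "\<phi> z - \<phi> (Y r) + \<rho> * (norm (z - Y r))\<^sup>2 \<le> \<phi> z - \<phi> (Y T) + \<rho> * (a + 2 * \<mu>)\<^sup>2"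
      using evi_curve_antimono[OF Y, of r T] st r by simp
  qed simp
  moreover have "norm (Y s - z) \<le> a + \<mu>"
    using norm_triangle_ineq[of "Y s - Y T" "Y T - z"] disp[OF st(2) order_refl]
    by (simp add: a_def norm_minus_commute)
  then have "(norm (Y s - z))\<^sup>2 \<le> (a + \<mu>)\<^sup>2" by (intro power_mono) auto
  moreover have "(norm (Y T - z))\<^sup>2 = a\<^sup>2" by (simp add: a_def norm_minus_commute)
  ultimately have "2 * h * (\<phi> (Y T) - \<phi> z) \<le> (a + \<mu>)\<^sup>2 - a\<^sup>2 + 2 * h * (\<rho> * (a + 2 * \<mu>)\<^sup>2)"
    by (simp add: h_def algebra_simps)
  then have "\<phi> (Y T) - \<phi> z \<le> ((a + \<mu>)\<^sup>2 - a\<^sup>2) * (1 / (2 * h)) + \<rho> * (a + 2 * \<mu>)\<^sup>2"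
    using h(1) by (simp add: field_simps)
  also have "(a + \<mu>)\<^sup>2 - a\<^sup>2 \<le> 3 * \<mu>"
  proof -
    have "a * \<mu> \<le> 1 * \<mu>" by (rule mult_right_mono[OF a(2) \<mu>(1)])
    moreover have "\<mu> * \<mu> \<le> 1 * \<mu>" by (rule mult_right_mono[OF \<mu>(2,1)])
    ultimately show ?thesis by (simp add: power2_eq_square algebra_simps)
  qed
  also have "(a + 2 * \<mu>)\<^sup>2 \<le> 2 * a\<^sup>2 + 8 * \<mu>"
  proof -
    have "\<mu> * \<mu> \<le> 1 * \<mu>" using \<mu> by (intro mult_right_mono) auto
    moreover have "0 \<le> (a - 2 * \<mu>)\<^sup>2" by simp
    ultimately show ?thesis by (simp add: power2_eq_square algebra_simps)
  qed
  finally have "\<phi> (Y T) - \<phi> z \<le> 3 * \<mu> * (1 / (2 * h)) + \<rho> * (2 * a\<^sup>2 + 8 * \<mu>)"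
    using h(1) rho by (simp add: mult_left_mono divide_right_mono)
  then show ?thesis unfolding h(4) a_def by (simp add: algebra_simps)
qed

text \<open>Along \<open>Y\<close> the values of \<open>\<phi>\<close> decrease to their infimum.
  Once they are within \<open>\<mu>^2\<close> of it, at time \<open>t1\<close>, the drop over every
  later interval is less than \<open>\<mu>^2\<close>; so \<open>T0 = t1 + h\<close> works and
  depends only on \<open>Y\<close>.\<close>

lemma runs_end_almost_stationary:
  assumes \<epsilon>: "\<epsilon> > 0" and \<theta>: "\<theta> > 0"
  shows "\<exists>T0\<ge>0. \<forall>T\<ge>T0. \<exists>b>0. \<forall>\<alpha> x. run \<alpha> x \<longrightarrow> (\<forall>k. \<alpha> k \<le> b) \<longrightarrow> \<alpha> sums T \<longrightarrow>
    (\<exists>y p. x \<longlonglongrightarrow> y \<and> p \<in> C \<and> norm (y - p) \<le> \<epsilon> \<and>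
       (\<forall>z\<in>C \<inter> cball p 1. \<phi> p - \<phi> z \<le> 2 * \<rho> * (norm (z - p))\<^sup>2 + \<theta>))"
proof (cases "\<forall>T. \<forall>b>0. \<exists>\<alpha> x n. run \<alpha> x \<and> (\<forall>k. \<alpha> k \<le> b) \<and> T \<le> elapsed \<alpha> n")
  case False
  \<comment> \<open>For \<open>T\<close> beyond \<open>T1\<close> there are no runs to consider, so existence of proximal points is never needed.\<close>
  then obtain T1 b where b: "b > 0" and no: "\<And>\<alpha> x n. run \<alpha> x \<Longrightarrow> (\<forall>k. \<alpha> k \<le> b) \<Longrightarrow> \<not> T1 \<le> elapsed \<alpha> n"
    by blast
  have "\<not> \<alpha> sums T" if "T \<ge> max T1 0 + 1" "run \<alpha> x" "\<forall>k. \<alpha> k \<le> b" for T \<alpha> x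
  proof
    assume "\<alpha> sums T"
    then have "elapsed \<alpha> \<longlonglongrightarrow> T" unfolding sums_def elapsed_def .
    moreover have "T1 < T" using that(1) by simp
    ultimately have "\<forall>\<^sub>F n in sequentially. T1 < elapsed \<alpha> n" by (rule order_tendstoD)
    then show False using no[OF that(2,3)] unfolding eventually_sequentially by (meson less_imp_le order_refl)
  qed
  then show ?thesis using b by (intro exI[of _ "max T1 0 + 1"]) auto
next
  case True
  then obtain Y where Y: "\<And>T. T \<ge> 0 \<Longrightarrow> \<exists>R\<ge>0. \<exists>M>0. \<exists>A\<ge>0. evi_curve R M A T 0 Y"
    and cl: "\<And>T \<epsilon>. T \<ge> 0 \<Longrightarrow> \<epsilon> > 0 \<Longrightarrow> \<exists>b>0. \<forall>\<alpha> x n. run \<alpha> x \<longrightarrow> (\<forall>k. \<alpha> k \<le> b) \<longrightarrow> T \<le> elapsed \<alpha> n \<longrightarrow>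
       norm (x (index_at \<alpha> T) - Y T) \<le> \<epsilon>"
    using limit_curve by metis
  define \<mu> where "\<mu> = min 1 (\<theta> / (14 * \<rho> + 6))"
  have \<mu>: "0 < \<mu>" "\<mu> \<le> 1" "(14 * \<rho> + 6) * \<mu> \<le> \<theta>"
  proof -
    show "0 < \<mu>" "\<mu> \<le> 1" using \<theta> rho by (auto simp: \<mu>_def add_nonneg_pos)
    have "(14 * \<rho> + 6) * \<mu> \<le> (14 * \<rho> + 6) * (\<theta> / (14 * \<rho> + 6))"
      using rho by (intro mult_left_mono) (auto simp: \<mu>_def)
    also have "\<dots> = \<theta>" using rho by simp
    finally show "(14 * \<rho> + 6) * \<mu> \<le> \<theta>" .
  qed
  define e where "e t = \<phi> (Y t)" for t
  have anti: "e t \<le> e s" if "0 \<le> s" "s \<le> t" for s t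
    using Y[of t] evi_curve_antimono[of _ _ _ t Y s t] that unfolding e_def by force
  have YC: "Y t \<in> C" if "0 \<le> t" for t
    using Y[of t] evi_curveD(2)[of _ _ _ t _ Y t] that by force
  have bdd: "bdd_below (e ` {0..})"
    by (rule bdd_belowI2[of _ m]) (auto simp: e_def intro!: lower YC)
  have "\<exists>t1\<in>{0..}. e t1 < Inf (e ` {0..}) + \<mu>\<^sup>2"
    using cInf_lessD[of "e ` {0..}" "Inf (e ` {0..}) + \<mu>\<^sup>2"] \<mu>(1) by auto
  then obtain t1 where t1: "t1 \<ge> 0" "e t1 < Inf (e ` {0..}) + \<mu>\<^sup>2" by auto
  define h where "h = 1 / (4 * \<rho> + 4)"
  have h: "h > 0" using rho by (simp add: h_def)
  show ?thesis
  proof (rule exI[of _ "t1 + h"], intro conjI allI impI)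
    show "0 \<le> t1 + h" using t1 h by simp
    fix T assume T: "T \<ge> t1 + h"
    then have T0: "T > 0" using t1 h by simp
    obtain R M A where "M > 0" and YT: "evi_curve R M A T 0 Y" using Y[of T] T0 by auto
    \<comment> \<open>Only the speed bound is taken from here, so any error level will do, such as
      1.\<close>
    obtain M' b1 where M': "M' > 0" and b1: "b1 > 0" and steps: "\<And>\<alpha> x k. run \<alpha> x \<Longrightarrow> (\<forall>k. \<alpha> k \<le> b1) \<Longrightarrow>
        elapsed \<alpha> k \<le> T \<Longrightarrow> norm (x (Suc k) - x k) \<le> M' * \<alpha> k"
      using run_evi_curve[OF less_imp_le[OF T0]] zero_less_one by metis
    \<comment> \<open>The comparison takes place at time \<open>T - d\<close>, which the partial
      sums do pass. After it the run moves by at most \<open>M' * d\<close> and the curve by at most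
      \<open>M * d\<close>; half of \<open>\<epsilon>\<close> is reserved for these, half for the
      distance at time \<open>T - d\<close>.\<close>
    define d where "d = min T (\<epsilon> / (2 * (M + M')))"
    have d: "0 < d" "d \<le> T" "(M + M') * d \<le> \<epsilon> / 2"
    proof -
      show "0 < d" "d \<le> T" using T0 \<epsilon> \<open>M > 0\<close> M' by (auto simp: d_def)
      have "(M + M') * d \<le> (M + M') * (\<epsilon> / (2 * (M + M')))"
        using \<open>M > 0\<close> M' by (intro mult_left_mono) (auto simp: d_def)
      also have "\<dots> = \<epsilon> / 2" using \<open>M > 0\<close> M' by (simp add: field_simps)
      finally show "(M + M') * d \<le> \<epsilon> / 2" .
    qed
    have Td: "T - d \<ge> 0" "\<epsilon> / 2 > 0" using d \<epsilon> by auto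
    obtain b2 where b2: "b2 > 0" and close: "\<And>\<alpha> x n. run \<alpha> x \<Longrightarrow> (\<forall>k. \<alpha> k \<le> b2) \<Longrightarrow> T - d \<le> elapsed \<alpha> n \<Longrightarrow>
       norm (x (index_at \<alpha> (T - d)) - Y (T - d)) \<le> \<epsilon> / 2"
      using cl[OF Td] by blast
    have p: "\<phi> (Y T) - \<phi> z \<le> 2 * \<rho> * (norm (z - Y T))\<^sup>2 + \<theta>" if z: "z \<in> C" "z \<in> cball (Y T) 1" for z
    proof -
      have "Inf (e ` {0..}) \<le> e T" using T0 bdd by (intro cInf_lower) auto
      moreover have "e (T - h) \<le> e t1" using T t1 by (intro anti) auto
      ultimately have "\<phi> (Y (T - h)) - \<phi> (Y T) \<le> \<mu>\<^sup>2" using t1(2) unfolding e_def by linarith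
      from evi_curve_almost_stationary[OF YT _ _ _ this less_imp_le[OF \<mu>(1)] \<mu>(2) z]
      show ?thesis using \<mu>(3) T t1 h by (simp add: h_def)
    qed
    show "\<exists>b>0. \<forall>\<alpha> x. run \<alpha> x \<longrightarrow> (\<forall>k. \<alpha> k \<le> b) \<longrightarrow> \<alpha> sums T \<longrightarrow>
      (\<exists>y p. x \<longlonglongrightarrow> y \<and> p \<in> C \<and> norm (y - p) \<le> \<epsilon> \<and>
       (\<forall>z\<in>C \<inter> cball p 1. \<phi> p - \<phi> z \<le> 2 * \<rho> * (norm (z - p))\<^sup>2 + \<theta>))"
    proof (rule exI[of _ "min b1 b2"], intro conjI allI impI)
      show "min b1 b2 > 0" using b1 b2 by simp
      fix \<alpha> x assume run: "run \<alpha> x" and \<alpha>b: "\<forall>k. \<alpha> k \<le> min b1 b2" and sums: "\<alpha> sums T"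
      note pos = run_pos[OF run]
      have lim: "elapsed \<alpha> \<longlonglongrightarrow> T" using sums unfolding sums_def elapsed_def .
      have elT: "elapsed \<alpha> k \<le> T" for k
        by (rule incseq_le[OF _ lim]) (use pos in \<open>auto simp: incseq_Suc_iff less_imp_le\<close>)
      have st: "norm (x (Suc k) - x k) \<le> M' * \<alpha> k" for k
        by (rule steps[OF run _ elT]) (use \<alpha>b in auto)
      obtain y where y: "x \<longlonglongrightarrow> y" "\<And>k. norm (y - x k) \<le> M' * (T - elapsed \<alpha> k)"
        using steps_sum_converges[OF sums less_imp_le[OF M'] st] by blast
      have "\<forall>\<^sub>F n in sequentially. T - d < elapsed \<alpha> n" using lim d(1) by (intro order_tendstoD) auto
      then obtain n where n: "T - d \<le> elapsed \<alpha> n"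
        unfolding eventually_sequentially by (meson less_imp_le order_refl)
      define k where "k = index_at \<alpha> (T - d)"
      have k: "T - d \<le> elapsed \<alpha> k" unfolding k_def index_at_def by (rule LeastI) (rule n)
      have "norm (y - x k) \<le> M' * (T - elapsed \<alpha> k)" by (rule y)
      also have "\<dots> \<le> M' * d" using k M' by (intro mult_left_mono) auto
      finally have 1: "norm (y - x k) \<le> M' * d" .
      have 2: "norm (x k - Y (T - d)) \<le> \<epsilon> / 2" unfolding k_def using \<alpha>b by (intro close[OF run _ n]) auto
      have 3: "norm (Y (T - d) - Y T) \<le> M * d"
        using evi_curveD(4)[OF YT, of "T - d" T] d by (simp add: norm_minus_commute)
      have "norm (y - Y T) \<le> norm (y - x k) + norm (x k - Y (T - d)) + norm (Y (T - d) - Y T)"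
        using norm_triangle_ineq[of "y - x k" "x k - Y T"] norm_triangle_ineq[of "x k - Y (T - d)" "Y (T - d) - Y T"] by simp
      then have "norm (y - Y T) \<le> \<epsilon>" using 1 2 3 d(3) by (simp add: algebra_simps)
      then show "\<exists>y p. x \<longlonglongrightarrow> y \<and> p \<in> C \<and> norm (y - p) \<le> \<epsilon> \<and>
       (\<forall>z\<in>C \<inter> cball p 1. \<phi> p - \<phi> z \<le> 2 * \<rho> * (norm (z - p))\<^sup>2 + \<theta>)"
        using y(1) p YC[of T] T0 by (intro exI[of _ y] exI[of _ "Y T"]) auto
    qed
  qed
qed

end

section \<open>Near stationarity of almost minimizers\<close>

text \<open>Local minimality of \<open>z\<close> puts the epigraph above a downward paraboloid
  through \<open>(z, h z)\<close>, whose normal there is \<open>(v, -1)\<close>. The defect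
  \<open>\<nu> * norm (y - z)\<close> squared is of second order, so this is a regular normal;
  constant sequences make it a limiting one.\<close>

lemma proximal_normal_clarke_subdiff:
  fixes h :: "'a::euclidean_space \<Rightarrow> ereal"
  assumes z: "\<bar>h z\<bar> \<noteq> \<infinity>" and "r > 0" and "\<nu> \<ge> 0" and nm: "\<And>y. h y \<noteq> -\<infinity>"
    and min: "\<And>y. y \<in> edom h \<Longrightarrow> dist y z < r \<Longrightarrow>
      real_of_ereal (h z) + \<nu> * (norm (z - p))\<^sup>2 \<le> real_of_ereal (h y) + \<nu> * (norm (y - p))\<^sup>2"
  shows "(2 * \<nu>) *\<^sub>R (p - z) \<in> clarke_subdiff h z"
proof -
  define c where "c = real_of_ereal (h z)"
  define v where "v = (2 * \<nu>) *\<^sub>R (p - z)"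
  have mem: "(z, c) \<in> epi h" using z by (auto simp: epi_def c_def ereal_real)
  have "(v, -1) \<in> regular_normal_cone (epi h) (z, c)"
    unfolding regular_normal_cone_def
  proof (intro CollectI conjI mem allI impI)
    fix e :: real assume e: "e > 0"
    \<comment> \<open>Within this radius the quadratic defect is at most \<open>e\<close> times the
      distance.\<close>
    define d where "d = min r (e / (\<nu> + 1))"
    have d: "d > 0" using e \<open>r > 0\<close> \<open>\<nu> \<ge> 0\<close> by (simp add: d_def add_nonneg_pos)
    have "(v, -1) \<bullet> (q - (z, c)) \<le> e * norm (q - (z, c))" if q: "q \<in> epi h" "dist q (z, c) < d" for q
    proof -
      obtain y t where yt: "q = (y, t)" by (cases q)
      have y: "y \<in> edom h" "real_of_ereal (h y) \<le> t"
        using q(1) nm[of y] by (cases "h y"; auto simp: yt epi_def edom_def)+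
      define n where "n = norm (q - (z, c))"
      have yz: "norm (y - z) \<le> n" using norm_fst_le[of "y - z" "t - c"] by (simp add: n_def yt)
      have n: "n < d" using q(2) by (simp add: n_def dist_norm)
      have "dist y z < r" using yz n by (simp add: dist_norm d_def)
      then have "c + \<nu> * (norm (z - p))\<^sup>2 \<le> t + \<nu> * (norm (y - p))\<^sup>2"
        using min[OF y(1)] y(2) unfolding c_def by linarith
      moreover have "(norm (y - p))\<^sup>2 = (norm (y - z))\<^sup>2 + 2 * ((y - z) \<bullet> (z - p)) + (norm (z - p))\<^sup>2"
        using sq_norm_add[of "y - z" "z - p"] by simp
      moreover have "v \<bullet> (y - z) = - (2 * \<nu> * ((y - z) \<bullet> (z - p)))"
        by (simp add: v_def inner_diff_left inner_diff_right inner_commute algebra_simps)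
      ultimately have "v \<bullet> (y - z) - (t - c) \<le> \<nu> * (norm (y - z))\<^sup>2"
        by (simp add: distrib_left)
      also have "\<dots> \<le> (\<nu> + 1) * (d * n)"
        unfolding power2_eq_square using yz n d \<open>\<nu> \<ge> 0\<close> by (intro mult_mono) auto
      also have "\<dots> \<le> (\<nu> + 1) * (e / (\<nu> + 1) * n)"
        using \<open>\<nu> \<ge> 0\<close> by (intro mult_left_mono mult_right_mono) (auto simp: d_def n_def)
      also have "\<dots> = e * n" using \<open>\<nu> \<ge> 0\<close> by simp
      finally show ?thesis by (simp add: yt n_def)
    qed
    then show "\<forall>\<^sub>F q in at (z, c) within epi h. (v, -1) \<bullet> (q - (z, c)) \<le> e * norm (q - (z, c))"
      unfolding eventually_at using d by blast
  qed
  then have "(v, -1) \<in> limiting_normal_cone (epi h) (z, c)"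
    unfolding limiting_normal_cone_def using mem
    by (intro CollectI conjI exI[of _ "\<lambda>_. (z, c)"] exI[of _ "\<lambda>_. (v, -1)"]) auto
  then have "(v, -1) \<in> closure (convex hull (limiting_normal_cone (epi h) (z, c)))"
    by (rule subsetD[OF subset_trans[OF hull_subset closure_subset]])
  then show ?thesis using z unfolding clarke_subdiff_def v_def[symmetric] c_def[symmetric] by simp
qed

text \<open>Minimize \<open>h\<close> plus \<open>2 * \<rho> + 1\<close> times the squared distance
  to \<open>p\<close> over the unit ball. Comparing the minimizer \<open>z\<close> with
  \<open>p\<close>, the growth bound uses up \<open>2 * \<rho>\<close> of that coefficient and the
  remaining 1 gives \<open>norm (z - p) \<le> s\<close>. As \<open>s < 1\<close>, the ball of radius
  \<open>1 - s\<close> about \<open>z\<close> stays inside the unit ball, so \<open>z\<close> is a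
  local minimizer on the domain and carries a subgradient of norm
  \<open>(4 * \<rho> + 2) * norm (z - p)\<close>.\<close>

lemma near_stationary_if_quadratic_growth:
  fixes h :: "'a::euclidean_space \<Rightarrow> ereal"
  assumes nm: "\<And>y. h y \<noteq> -\<infinity>" and closed: "closed (edom h)"
    and cont: "continuous_on (edom h) (\<lambda>x. real_of_ereal (h x))"
    and p: "p \<in> edom h" and \<rho>: "\<rho> \<ge> 0" and s: "0 \<le> s" "s < 1"
    and growth: "\<And>z. z \<in> edom h \<Longrightarrow> dist p z \<le> 1 \<Longrightarrow>
      real_of_ereal (h p) - real_of_ereal (h z) \<le> 2 * \<rho> * (norm (z - p))\<^sup>2 + s\<^sup>2"
  obtains z v where "norm (z - p) \<le> s" "v \<in> clarke_subdiff h z" "norm v \<le> (4 * \<rho> + 2) * s"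
proof -
  define \<phi> where "\<phi> x = real_of_ereal (h x)" for x
  define \<nu> where "\<nu> = 2 * \<rho> + 1"
  have "compact (edom h \<inter> cball p 1)" using closed by (rule closed_Int_compact) simp
  moreover have "edom h \<inter> cball p 1 \<noteq> {}" using p by auto
  moreover have "continuous_on (edom h \<inter> cball p 1) (\<lambda>x. \<phi> x + \<nu> * (norm (x - p))\<^sup>2)"
    unfolding \<phi>_def by (intro continuous_intros continuous_on_subset[OF cont]) auto
  ultimately obtain z where z': "z \<in> edom h \<inter> cball p 1" and
    min': "\<forall>y\<in>edom h \<inter> cball p 1. \<phi> z + \<nu> * (norm (z - p))\<^sup>2 \<le> \<phi> y + \<nu> * (norm (y - p))\<^sup>2"
    using continuous_attains_inf[of "edom h \<inter> cball p 1" "\<lambda>x. \<phi> x + \<nu> * (norm (x - p))\<^sup>2"] by blast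
  from z' have z: "z \<in> edom h" "dist p z \<le> 1" by auto
  have min: "\<phi> z + \<nu> * (norm (z - p))\<^sup>2 \<le> \<phi> y + \<nu> * (norm (y - p))\<^sup>2"
    if "y \<in> edom h" "dist p y \<le> 1" for y using min' that by simp
  have "\<phi> z + \<nu> * (norm (z - p))\<^sup>2 \<le> \<phi> p" using min[OF p] by simp
  moreover have "\<phi> p - \<phi> z \<le> 2 * \<rho> * (norm (z - p))\<^sup>2 + s\<^sup>2" using growth[OF z] by (simp add: \<phi>_def)
  ultimately have "(norm (z - p))\<^sup>2 \<le> s\<^sup>2" unfolding \<nu>_def distrib_right by linarith
  then have zs: "norm (z - p) \<le> s" using s(1) by (rule power2_le_imp_le)
  have "(2 * \<nu>) *\<^sub>R (p - z) \<in> clarke_subdiff h z"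
  proof (rule proximal_normal_clarke_subdiff[where r="1 - s"])
    show "\<bar>h z\<bar> \<noteq> \<infinity>" using z(1) nm[of z] by (cases "h z") (auto simp: edom_def)
    fix y assume y: "y \<in> edom h" "dist y z < 1 - s"
    have "dist p y \<le> 1"
      using dist_triangle[of p y z] y(2) zs by (simp add: dist_norm norm_minus_commute)
    then show "real_of_ereal (h z) + \<nu> * (norm (z - p))\<^sup>2 \<le> real_of_ereal (h y) + \<nu> * (norm (y - p))\<^sup>2"
      using min[OF y(1)] by (simp add: \<phi>_def)
  qed (use s \<rho> nm in \<open>auto simp: \<nu>_def\<close>)
  moreover have "norm ((2 * \<nu>) *\<^sub>R (p - z)) \<le> (4 * \<rho> + 2) * s"
  proof -
    have "norm ((2 * \<nu>) *\<^sub>R (p - z)) = (4 * \<rho> + 2) * norm (z - p)"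
      using \<rho> by (simp add: \<nu>_def norm_minus_commute)
    also have "\<dots> \<le> (4 * \<rho> + 2) * s" using zs \<rho> by (intro mult_left_mono) auto
    finally show ?thesis .
  qed
  ultimately show thesis using zs that by blast
qed

lemma lipschitz_on_sum_exists:
  fixes f :: "'i \<Rightarrow> 'a::metric_space \<Rightarrow> 'b::real_normed_vector"
  assumes "finite I" "\<And>i. i \<in> I \<Longrightarrow> \<exists>L. L-lipschitz_on K (f i)"
  shows "\<exists>L. L-lipschitz_on K (\<lambda>x. \<Sum>i\<in>I. f i x)"
  using assms
proof (induction I rule: finite_induct)
  case empty
  show ?case using lipschitz_on_constant[of K "0::'b"] by auto
next
  case (insert i I)
  then obtain L L' where "L-lipschitz_on K (f i)" "L'-lipschitz_on K (\<lambda>x. \<Sum>i\<in>I. f i x)" by force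
  then have "(L + L')-lipschitz_on K (\<lambda>x. f i x + (\<Sum>i\<in>I. f i x))" by (rule lipschitz_on_add)
  then show ?case using insert.hyps by auto
qed

section \<open>Application to the objective\<close>

theorem theorem3p9:
  fixes N :: nat
    and f :: "nat \<Rightarrow> 'a::euclidean_space \<Rightarrow> real"
    and D :: "nat \<Rightarrow> 'a \<Rightarrow> 'a set"
    and g :: "'a \<Rightarrow> ereal"
    and \<delta> \<epsilon> :: real
  assumes "standing_assumption N f D g"
    and "\<forall>i\<in>{1..N}. subdiff_regular (f i)"
    and "\<forall>i\<in>{1..N}. D i = clarke_subdiff (\<lambda>x. ereal (f i x))"
    and "weakly_convex (objective N f g)"
    and "\<delta> > 0" and "\<epsilon> > 0"
  shows "\<forall>x0\<in>edom (objective N f g). \<exists>T0\<ge>0. \<forall>T\<ge>T0. \<exists>\<alpha>bar>0.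
           \<forall>(\<alpha>::nat \<Rightarrow> real) (x::nat \<Rightarrow> 'a).
             prr_sequence N D g \<alpha> x \<and> x 0 = x0 \<and>
             (\<forall>k. 0 < \<alpha> k \<and> \<alpha> k \<le> \<alpha>bar) \<and> \<alpha> sums T \<longrightarrow>
             (\<exists>xlim. x \<longlonglongrightarrow> xlim \<and>
                near_approx_stationary \<epsilon> \<delta> (clarke_subdiff (objective N f g)) xlim)"
proof
  fix x0 assume x0: "x0 \<in> edom (objective N f g)"
  let ?\<Phi> = "objective N f g"
  define \<phi> where "\<phi> x = real_of_ereal (?\<Phi> x)" for x
  have f: "locally_lipschitz_on UNIV (f i)" if "i \<in> {1..N}" for i
    using assms(1) that unfolding standing_assumption_def by blast
  have bd: "locally_bounded (D i)" if "i \<in> {1..N}" for i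
    using assms(1) that unfolding standing_assumption_def by blast
  have g: "proper_fun g" "convex_fun g" "closed (edom g)"
      "locally_lipschitz_on (edom g) (\<lambda>x. real_of_ereal (g x))"
    using assms(1) unfolding standing_assumption_def by blast+
  obtain m where m: "\<And>x. ereal m \<le> ?\<Phi> x"
    using assms(1) unfolding standing_assumption_def by blast
  have nm: "g x \<noteq> -\<infinity>" "?\<Phi> x \<noteq> -\<infinity>" for x
    using g(1) m[of x] by (auto simp: proper_fun_def)
  have dom: "edom ?\<Phi> = edom g" by (auto simp: edom_def objective_def)
  have \<phi>: "\<phi> x = (\<Sum>i\<in>{1..N}. f i x) + real_of_ereal (g x)" if "x \<in> edom g" for x
    using edom_real[OF g(1) that] unfolding \<phi>_def objective_def
    by (metis plus_ereal.simps(1) real_of_ereal.simps(1))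
  obtain \<rho> where \<rho>: "\<rho> \<ge> 0" and "convex_fun (\<lambda>x. ?\<Phi> x + ereal (\<rho> * (norm x)\<^sup>2))"
    using assms(4) unfolding weakly_convex_def by blast
  define H where "H x = ?\<Phi> x + ereal (\<rho> * (norm x)\<^sup>2)" for x
  have H: "convex_fun H" "\<And>x. H x \<noteq> -\<infinity>"
    using \<open>convex_fun (\<lambda>x. ?\<Phi> x + ereal (\<rho> * (norm x)\<^sup>2))\<close> nm(2) unfolding H_def by auto
  have domH: "edom H = edom g" by (auto simp: edom_def H_def objective_def)
  have H_real: "real_of_ereal (H x) = \<phi> x + \<rho> * (norm x)\<^sup>2" if "x \<in> edom g" for x
    using that nm(2)[of x] unfolding dom[symmetric] H_def \<phi>_def by (cases "?\<Phi> x") (auto simp: edom_def)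
  \<comment> \<open>The squared norm satisfies the convexity inequality with the exact defect
    \<open>t * (1 - t) * (norm (y - x))\<^sup>2\<close>. Subtracting \<open>\<rho>\<close> times
    this identity from convexity of \<open>H\<close> gives the claim for
    \<open>\<phi>\<close>.\<close>
  have wc: "\<phi> (x + t *\<^sub>R (y - x)) \<le> (1 - t) * \<phi> x + t * \<phi> y + \<rho> * t * (1 - t) * (norm (y - x))\<^sup>2"
    if x: "x \<in> edom g" and y: "y \<in> edom g" and t: "0 < t" "t < 1" for x y t
  proof -
    define z where "z = x + t *\<^sub>R (y - x)"
    have z: "z \<in> edom g" "real_of_ereal (H z) \<le> (1 - t) * real_of_ereal (H x) + t * real_of_ereal (H y)"
      using convex_fun_edom[OF H(2,1), of x y t] x y t by (auto simp: domH z_def)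
    have "(norm z)\<^sup>2 = (1 - t) * (norm x)\<^sup>2 + t * (norm y)\<^sup>2 - t * (1 - t) * (norm (y - x))\<^sup>2"
      unfolding z_def power2_norm_eq_inner
      by (simp add: inner_add_left inner_add_right inner_diff_left inner_diff_right inner_commute algebra_simps)
    then have "\<rho> * (norm z)\<^sup>2 = \<rho> * ((1 - t) * (norm x)\<^sup>2 + t * (norm y)\<^sup>2 - t * (1 - t) * (norm (y - x))\<^sup>2)"
      by (rule arg_cong)
    also have "\<dots> = (1 - t) * (\<rho> * (norm x)\<^sup>2) + t * (\<rho> * (norm y)\<^sup>2) - \<rho> * t * (1 - t) * (norm (y - x))\<^sup>2"
      by (simp add: algebra_simps)
    finally have "\<rho> * (norm z)\<^sup>2 = (1 - t) * (\<rho> * (norm x)\<^sup>2) + t * (\<rho> * (norm y)\<^sup>2) - \<rho> * t * (1 - t) * (norm (y - x))\<^sup>2" .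
    then show ?thesis
      using z(2) unfolding H_real[OF z(1)] H_real[OF x] H_real[OF y] z_def[symmetric] distrib_left
      by linarith
  qed
  have lip: "\<exists>L. L-lipschitz_on (edom g \<inter> cball x0 R) \<phi>" for R
  proof -
    have K: "compact (edom g \<inter> cball x0 R)" using g(3) by (rule closed_Int_compact) simp
    have "\<exists>L. L-lipschitz_on (edom g \<inter> cball x0 R) (\<lambda>x. \<Sum>i\<in>{1..N}. f i x)"
      by (rule lipschitz_on_sum_exists) (auto intro: locally_lipschitz_on_compact[OF f K])
    moreover obtain L where "L-lipschitz_on (edom g \<inter> cball x0 R) (\<lambda>x. real_of_ereal (g x))"
      by (rule locally_lipschitz_on_compact[OF g(4) K]) auto
    ultimately obtain L' where "L'-lipschitz_on (edom g \<inter> cball x0 R) (\<lambda>x. (\<Sum>i\<in>{1..N}. f i x) + real_of_ereal (g x))"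
      using lipschitz_on_add by blast
    then have "L'-lipschitz_on (edom g \<inter> cball x0 R) \<phi>"
      using \<phi> by (subst lipschitz_on_cong[OF refl refl]) auto
    then show ?thesis by blast
  qed
  interpret evi_runs "edom g" \<phi> \<rho> m x0 "\<lambda>\<alpha> x. prr_sequence N D g \<alpha> x \<and> x 0 = x0 \<and> (\<forall>k. 0 < \<alpha> k)"
  proof
    show "m \<le> \<phi> x" if "x \<in> edom g" for x
      using m[of x] nm(2)[of x] that unfolding dom[symmetric] \<phi>_def by (cases "?\<Phi> x") (auto simp: edom_def)
    fix R :: real assume R: "R \<ge> 0"
    let ?Q = "\<lambda>M \<eta> b \<alpha> x k. \<alpha> k \<le> b \<longrightarrow> x k \<in> edom g \<inter> cball x0 R \<longrightarrow>
       x (Suc k) \<in> edom g \<and> norm (x (Suc k) - x k) \<le> M * \<alpha> k \<and>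
       (\<forall>y\<in>edom g \<inter> cball x0 R. (norm (x (Suc k) - y))\<^sup>2 \<le>
          (norm (x k - y))\<^sup>2 + 2 * \<alpha> k * (\<phi> y - \<phi> (x k) + \<rho> * (norm (y - x k))\<^sup>2 + \<eta>))"
    have "\<exists>M>0. \<forall>\<eta>>0. \<exists>b>0. \<forall>\<alpha> x k. prr_sequence N D g \<alpha> x \<longrightarrow> 0 < \<alpha> k \<longrightarrow> ?Q M \<eta> b \<alpha> x k"
      by (rule prr_step[where f=f]) (use assms(2,3) bd g \<phi> wc \<rho> R lip in blast)+
    then obtain M where M: "M > 0"
      and st: "\<forall>\<eta>>0. \<exists>b>0. \<forall>\<alpha> x k. prr_sequence N D g \<alpha> x \<longrightarrow> 0 < \<alpha> k \<longrightarrow> ?Q M \<eta> b \<alpha> x k"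
      by (elim exE conjE) (rule that)
    show "\<exists>M>0. \<forall>\<eta>>0. \<exists>b>0. \<forall>\<alpha> x k.
       prr_sequence N D g \<alpha> x \<and> x 0 = x0 \<and> (\<forall>k. 0 < \<alpha> k) \<longrightarrow> ?Q M \<eta> b \<alpha> x k"
    proof (rule exI[of _ M], intro conjI M allI impI[of "_ > 0"])
      fix \<eta> :: real assume \<eta>: "\<eta> > 0"
      obtain b where b: "b > 0"
        and stb: "\<forall>\<alpha> x k. prr_sequence N D g \<alpha> x \<longrightarrow> 0 < \<alpha> k \<longrightarrow> ?Q M \<eta> b \<alpha> x k"
        using st[THEN spec, THEN mp, OF \<eta>] by (elim exE conjE) (rule that)
      have "\<forall>\<alpha> x k. prr_sequence N D g \<alpha> x \<and> x 0 = x0 \<and> (\<forall>k. 0 < \<alpha> k) \<longrightarrow> ?Q M \<eta> b \<alpha> x k"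
      proof (intro allI, rule impI)
        fix \<alpha> x k assume "prr_sequence N D g \<alpha> x \<and> x 0 = x0 \<and> (\<forall>k. 0 < \<alpha> k)"
        then have "prr_sequence N D g \<alpha> x" "0 < \<alpha> k" by auto
        then show "?Q M \<eta> b \<alpha> x k" by (rule stb[THEN spec, THEN spec, THEN spec, THEN mp, THEN mp])
      qed
      with b show "\<exists>b>0. \<forall>\<alpha> x k.
         prr_sequence N D g \<alpha> x \<and> x 0 = x0 \<and> (\<forall>k. 0 < \<alpha> k) \<longrightarrow> ?Q M \<eta> b \<alpha> x k"
        by (intro exI[of _ b] conjI)
    qed
  qed (use g(3) x0 dom \<rho> lip in auto)
  \<comment> \<open>\<open>1 / 2\<close> keeps \<open>s\<close> below 1,
    \<open>\<epsilon> / 2\<close> leaves the other half of \<open>\<epsilon>\<close> for the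
    distance from the limit of the run to \<open>p\<close>, and the last bound brings the
    subgradient norm \<open>(4 * \<rho> + 2) * s\<close> below \<open>\<delta>\<close>.\<close>
  define s where "s = min (1 / 2) (min (\<epsilon> / 2) (\<delta> / (4 * \<rho> + 2)))"
  have s: "0 < s" "s < 1" "s \<le> \<epsilon> / 2" "(4 * \<rho> + 2) * s \<le> \<delta>"
  proof -
    show "0 < s" "s < 1" using assms(5,6) \<rho> by (auto simp: s_def add_nonneg_pos)
    show "s \<le> \<epsilon> / 2" unfolding s_def by linarith
    have "(4 * \<rho> + 2) * s \<le> (4 * \<rho> + 2) * (\<delta> / (4 * \<rho> + 2))" using \<rho> by (intro mult_left_mono) (auto simp: s_def)
    also have "\<dots> = \<delta>" using \<rho> by simp
    finally show "(4 * \<rho> + 2) * s \<le> \<delta>" .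
  qed
  have near: "near_approx_stationary \<epsilon> \<delta> (clarke_subdiff ?\<Phi>) y"
    if p: "p \<in> edom g" and yp: "norm (y - p) \<le> \<epsilon> / 2"
      and growth: "\<forall>z\<in>edom g \<inter> cball p 1. \<phi> p - \<phi> z \<le> 2 * \<rho> * (norm (z - p))\<^sup>2 + s\<^sup>2" for y p
  proof -
    obtain z v where z: "norm (z - p) \<le> s" and v: "v \<in> clarke_subdiff ?\<Phi> z" "norm v \<le> (4 * \<rho> + 2) * s"
    proof (rule near_stationary_if_quadratic_growth[of ?\<Phi> p \<rho> s])
      show "continuous_on (edom ?\<Phi>) (\<lambda>x. real_of_ereal (?\<Phi> x))"
        using continuous_\<phi> unfolding \<phi>_def dom .
      show "real_of_ereal (?\<Phi> p) - real_of_ereal (?\<Phi> z) \<le> 2 * \<rho> * (norm (z - p))\<^sup>2 + s\<^sup>2"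
        if "z \<in> edom ?\<Phi>" "dist p z \<le> 1" for z
        using growth that unfolding dom \<phi>_def by auto
    qed (use nm(2) g(3) p \<rho> s dom that in auto)
    have "dist y z \<le> \<epsilon>"
      using dist_triangle[of y z p] yp z s(3) by (simp add: dist_norm norm_minus_commute)
    then have "v \<in> (\<Union>y\<in>cball y \<epsilon>. clarke_subdiff ?\<Phi> y)" using v(1) by auto
    then have "edist_set 0 (\<Union>y\<in>cball y \<epsilon>. clarke_subdiff ?\<Phi> y) \<le> ereal (dist 0 v)"
      unfolding edist_set_def by (rule INF_lower)
    also have "\<dots> \<le> ereal \<delta>" using v(2) s(4) by simp
    finally show ?thesis unfolding near_approx_stationary_def .
  qed
  \<comment> \<open>The tolerance \<open>\<theta>\<close> is taken to be \<open>s\<close> squared,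
    the defect that puts the penalized minimizer within distance \<open>s\<close> of
    \<open>p\<close>.\<close>
  have "\<epsilon> / 2 > 0" "s\<^sup>2 > 0" using assms(6) s(1) by auto
  from runs_end_almost_stationary[OF this] obtain T0 where T0: "T0 \<ge> 0" and ex: "\<And>T. T \<ge> T0 \<Longrightarrow> \<exists>b>0. \<forall>\<alpha> x.
      prr_sequence N D g \<alpha> x \<and> x 0 = x0 \<and> (\<forall>k. 0 < \<alpha> k) \<longrightarrow> (\<forall>k. \<alpha> k \<le> b) \<longrightarrow> \<alpha> sums T \<longrightarrow>
      (\<exists>y p. x \<longlonglongrightarrow> y \<and> p \<in> edom g \<and> norm (y - p) \<le> \<epsilon> / 2 \<and>
        (\<forall>z\<in>edom g \<inter> cball p 1. \<phi> p - \<phi> z \<le> 2 * \<rho> * (norm (z - p))\<^sup>2 + s\<^sup>2))"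
    by (elim exE conjE) (rule that, assumption, simp)
  show "\<exists>T0\<ge>0. \<forall>T\<ge>T0. \<exists>\<alpha>bar>0. \<forall>(\<alpha>::nat \<Rightarrow> real) (x::nat \<Rightarrow> 'a).
             prr_sequence N D g \<alpha> x \<and> x 0 = x0 \<and>
             (\<forall>k. 0 < \<alpha> k \<and> \<alpha> k \<le> \<alpha>bar) \<and> \<alpha> sums T \<longrightarrow>
             (\<exists>xlim. x \<longlonglongrightarrow> xlim \<and> near_approx_stationary \<epsilon> \<delta> (clarke_subdiff ?\<Phi>) xlim)"
  proof (rule exI[of _ T0], intro conjI T0 allI impI)
    fix T assume "T \<ge> T0"
    from ex[OF this] obtain b where b: "b > 0" and run: "\<And>\<alpha> x. prr_sequence N D g \<alpha> x \<and> x 0 = x0 \<and> (\<forall>k. 0 < \<alpha> k) \<Longrightarrow>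
      (\<forall>k. \<alpha> k \<le> b) \<Longrightarrow> \<alpha> sums T \<Longrightarrow>
      (\<exists>y p. x \<longlonglongrightarrow> y \<and> p \<in> edom g \<and> norm (y - p) \<le> \<epsilon> / 2 \<and>
        (\<forall>z\<in>edom g \<inter> cball p 1. \<phi> p - \<phi> z \<le> 2 * \<rho> * (norm (z - p))\<^sup>2 + s\<^sup>2))"
      by blast
    show "\<exists>\<alpha>bar>0. \<forall>(\<alpha>::nat \<Rightarrow> real) (x::nat \<Rightarrow> 'a).
             prr_sequence N D g \<alpha> x \<and> x 0 = x0 \<and>
             (\<forall>k. 0 < \<alpha> k \<and> \<alpha> k \<le> \<alpha>bar) \<and> \<alpha> sums T \<longrightarrow>
             (\<exists>xlim. x \<longlonglongrightarrow> xlim \<and> near_approx_stationary \<epsilon> \<delta> (clarke_subdiff ?\<Phi>) xlim)"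
    proof (intro exI[of _ b] conjI b allI impI)
      fix \<alpha> x assume "prr_sequence N D g \<alpha> x \<and> x 0 = x0 \<and> (\<forall>k. 0 < \<alpha> k \<and> \<alpha> k \<le> b) \<and> \<alpha> sums T"
      then obtain y p where "x \<longlonglongrightarrow> y" "p \<in> edom g" "norm (y - p) \<le> \<epsilon> / 2"
        "\<forall>z\<in>edom g \<inter> cball p 1. \<phi> p - \<phi> z \<le> 2 * \<rho> * (norm (z - p))\<^sup>2 + s\<^sup>2"
        using run[of \<alpha> x] by blast
      then show "\<exists>xlim. x \<longlonglongrightarrow> xlim \<and> near_approx_stationary \<epsilon> \<delta> (clarke_subdiff ?\<Phi>) xlim"
        using near by blast
    qed
  qed
qed

end
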